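(* Let $\mathscr{F}=\ell\boxtimes\mathcal{F}$ be a pre-foliation of co-degree $1$ and degree $3$ on $\mathbb{P}^2_{\mathbb{C}}$. Assume that the foliation $\mathcal{F}$ has only non-degenerate singularities and that the $3$-web $\mathrm{Leg}\,\mathscr{F}$ is flat. Then $\mathcal{F}$ is linearly conjugate to the Fermat foliation $\mathcal{F}_0^2$, and the line $\ell$ is either invariant by $\mathcal{F}$ or it joins two non-radial singularities of $\mathcal{F}$.
   Context: Foliations and pre-foliations. A holomorphic foliation of degree $n$ on $\mathbb{P}^2_{\mathbb{C}}$ is given in homogeneous coordinates by a 1-form $\Omega_0=a\,dx+b\,dy+c\,dz$, with $a,b,c$ homogeneous of degree $n+1$ without common factor and $xa+yb+zc=0$; its singularities are the zeros of $\Omega_0$. A pre-foliation of co-degree $1$ and degree $d$ on $\mathbb{P}^2_{\mathbb{C}}$ is a pair, written $\ell\boxtimes\mathcal{F}$, of a line $\ell$ and a holomorphic foliation $\mathcal{F}$ of degree $d-1$. "Linearly conjugate" means conjugate by an element of $\mathrm{Aut}(\mathbb{P}^2_{\mathbb{C}})$. A singularity $s$, with $\mathcal F$ locally defined by a vector field $X$ with isolated zero at $s$, is non-degenerate if its Milnor number is $1$, i.e. the linear part of $X$ at $s$ is invertible; it is radial if that linear part is a nonzero multiple of the identity. The Fermat foliation $\mathcal F_0^2$ is defined in the affine chart $(x,y)$ by $x\,dy-y\,dx+y^{2}dx-x^{2}dy$. Legendre transform. If $\ell\boxtimes\mathcal F$ is given in an affine chart by $f(x,y)(A\,dx+B\,dy)$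 ($f=0$ being an equation of $\ell$), then in the affine chart $(p,q)$ of $\check{\mathbb{P}}^2_{\mathbb{C}}$ associated to the line $\{y=px-q\}$, $\mathrm{Leg}(\ell\boxtimes\mathcal F)$ is the $d$-web given by $f(x,px-q)\big(A(x,px-q)+pB(x,px-q)\big)=0$ with $x=dq/dp$. Equivalently $\mathrm{Leg}(\ell\boxtimes\mathcal F)=\mathrm{Leg}\,\ell\boxtimes\mathrm{Leg}\,\mathcal F$, where $\mathrm{Leg}\,\ell$ is the pencil of lines through the point $\check\ell$ dual to $\ell$, and the tangents of $\mathrm{Leg}\,\mathcal F$ at a generic $L\in\check{\mathbb{P}}^2_{\mathbb{C}}$ are the lines dual to the tangency points of $L$ with $\mathcal F$. Curvature. At a generic point a $3$-web is a superposition $\mathcal F_1\boxtimes\mathcal F_2\boxtimes\mathcal F_3$ of pairwise transverse foliations, $\mathcal F_i:\omega_i=0$. Put $\omega_i\wedge\omega_j=\delta_{ij}\,dx\wedge dy$ and let $\eta$ be the unique meromorphic 1-form with $d(\delta_{23}\omega_1)=\eta\wedge\delta_{23}\omega_1$, $d(\delta_{31}\omega_2)=\eta\wedge\delta_{31}\omega_2$, $d(\delta_{12}\omega_3)=\eta\wedge\delta_{12}\omega_3$. The curvature $K(\mathcal W)=d\eta$ is a well-defined global meromorphic 2-form; $\mathcal W$ is flat if $K(\mathcal W)\equiv0$. *)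

theory Defs
  imports "HOL-Analysis.Analysis"
begin

section \<open>Polynomials in three variables\<close>

text \<open>
  Since the field of complex numbers is infinite, polynomials are identified with the
  polynomial functions they define.
\<close>

definition polynomial3 :: "(complex^3 \<Rightarrow> complex) \<Rightarrow> bool" where
  "polynomial3 f \<longleftrightarrow> (\<exists>N c. \<forall>v. f v =
     (\<Sum>i\<le>N. \<Sum>j\<le>N. \<Sum>k\<le>N. c i j k * (v$1)^i * (v$2)^j * (v$3)^k))"

definition homogeneous3 :: "nat \<Rightarrow> (complex^3 \<Rightarrow> complex) \<Rightarrow> bool" where
  "homogeneous3 n f \<longleftrightarrow> (\<exists>c. \<forall>v. f v =
     (\<Sum>i\<le>n. \<Sum>j\<le>n - i. c i j * (v$1)^i * (v$2)^j * (v$3)^(n - i - j)))"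

definition divides3 :: "(complex^3 \<Rightarrow> complex) \<Rightarrow> (complex^3 \<Rightarrow> complex) \<Rightarrow> bool" where
  "divides3 h f \<longleftrightarrow> (\<exists>k. polynomial3 k \<and> (\<forall>v. f v = h v * k v))"


section \<open>Foliations and pre-foliations on the complex projective plane\<close>

text \<open>
  A point of the plane is given by a nonzero vector \<open>v\<close> of homogeneous coordinates, a line by
  the nonzero coefficient vector \<open>l\<close> of a linear equation. The 1-form \<open>a dx + b dy + c dz\<close> is
  the vector-valued function with components \<open>a\<close>, \<open>b\<close>, \<open>c\<close>. The pairing below is bilinear, not
  Hermitian (and is not the real inner product of the library).
\<close>

definition pair :: "complex^3 \<Rightarrow> complex^3 \<Rightarrow> complex" where
  "pair l v = (\<Sum>i\<in>UNIV. l$i * v$i)"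

type_synonym form3 = "complex^3 \<Rightarrow> complex^3"

definition foliation :: "nat \<Rightarrow> form3 \<Rightarrow> bool" where
  "foliation n \<Omega> \<longleftrightarrow>
     (\<forall>i. homogeneous3 (n + 1) (\<lambda>v. \<Omega> v $ i)) \<and>
     (\<forall>v. pair v (\<Omega> v) = 0) \<and>
     (\<forall>h. polynomial3 h \<and> (\<forall>i. divides3 h (\<lambda>v. \<Omega> v $ i)) \<longrightarrow> (\<exists>c. \<forall>v. h v = c))"

definition prefoliation :: "nat \<Rightarrow> complex^3 \<Rightarrow> form3 \<Rightarrow> bool" where
  "prefoliation d l \<Omega> \<longleftrightarrow> d \<ge> 1 \<and> l \<noteq> 0 \<and> foliation (d - 1) \<Omega>"

definition pullback :: "complex^3^3 \<Rightarrow> form3 \<Rightarrow> form3" where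
  "pullback g \<Omega> v = transpose g *v \<Omega> (g *v v)"

definition pullback_line :: "complex^3^3 \<Rightarrow> complex^3 \<Rightarrow> complex^3" where
  "pullback_line g l = transpose g *v l"

text \<open>Two homogeneous forms define the same foliation iff they are proportional.\<close>

definition linearly_conjugate :: "form3 \<Rightarrow> form3 \<Rightarrow> bool" where
  "linearly_conjugate \<Omega> \<Omega>' \<longleftrightarrow>
     (\<exists>g c. invertible g \<and> c \<noteq> 0 \<and> (\<forall>v. pullback g \<Omega> v = c *s \<Omega>' v))"

text \<open>
  Invariance: at every point of the line the form vanishes on the directions of the line.
\<close>

definition invariant_line :: "complex^3 \<Rightarrow> form3 \<Rightarrow> bool" where
  "invariant_line l \<Omega> \<longleftrightarrow>
     (\<forall>v w. pair l v = 0 \<and> pair l w = 0 \<longrightarrow> pair (\<Omega> v) w = 0)"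

definition singular :: "form3 \<Rightarrow> complex^3 \<Rightarrow> bool" where
  "singular \<Omega> s \<longleftrightarrow> s \<noteq> 0 \<and> \<Omega> s = 0"


section \<open>Affine charts and linear parts at singularities\<close>

text \<open>
  An invertible matrix \<open>g\<close> gives the affine chart sending \<open>(x, y)\<close> to the point with
  homogeneous coordinates \<open>g (x, y, 1)\<close>. There the foliation is given by \<open>A dx + B dy\<close>, and
  by the vector field \<open>B \<partial>/\<partial>x - A \<partial>/\<partial>y\<close>.
\<close>

definition affine_form :: "complex^3^3 \<Rightarrow> form3 \<Rightarrow> complex \<times> complex \<Rightarrow> complex \<times> complex" where
  "affine_form g \<Omega> z =
     (let \<theta> = pullback g \<Omega> (vector [fst z, snd z, 1]) in (\<theta>$1, \<theta>$2))"

definition chart_at :: "complex^3^3 \<Rightarrow> complex \<times> complex \<Rightarrow> complex^3 \<Rightarrow> bool" where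
  "chart_at g z s \<longleftrightarrow>
     invertible g \<and> (\<exists>c. c \<noteq> 0 \<and> s = c *s (g *v vector [fst z, snd z, 1]))"

definition pd1 :: "(complex \<times> complex \<Rightarrow> complex) \<Rightarrow> complex \<times> complex \<Rightarrow> complex" where
  "pd1 f z = deriv (\<lambda>t. f (t, snd z)) (fst z)"

definition pd2 :: "(complex \<times> complex \<Rightarrow> complex) \<Rightarrow> complex \<times> complex \<Rightarrow> complex" where
  "pd2 f z = deriv (\<lambda>t. f (fst z, t)) (snd z)"

definition linear_part :: "complex^3^3 \<Rightarrow> form3 \<Rightarrow> complex \<times> complex \<Rightarrow> complex^2^2" where
  "linear_part g \<Omega> z =
     (let A = (\<lambda>u. fst (affine_form g \<Omega> u)); B = (\<lambda>u. snd (affine_form g \<Omega> u))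
      in vector [vector [pd1 B z, pd2 B z], vector [- pd1 A z, - pd2 A z]])"

text \<open>
  A change of chart conjugates the linear part and multiplies it by a nonzero scalar, so the
  two conditions below do not depend on the chart; every singular point lies in some chart.
\<close>

definition nondegenerate_singularity :: "form3 \<Rightarrow> complex^3 \<Rightarrow> bool" where
  "nondegenerate_singularity \<Omega> s \<longleftrightarrow>
     singular \<Omega> s \<and> (\<forall>g z. chart_at g z s \<longrightarrow> invertible (linear_part g \<Omega> z))"

definition radial_singularity :: "form3 \<Rightarrow> complex^3 \<Rightarrow> bool" where
  "radial_singularity \<Omega> s \<longleftrightarrow>
     singular \<Omega> s \<and> (\<forall>g z. chart_at g z s \<longrightarrow> (\<exists>\<mu>. \<mu> \<noteq> 0 \<and> linear_part g \<Omega> z = mat \<mu>))"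

definition joins_two_nonradial :: "complex^3 \<Rightarrow> form3 \<Rightarrow> bool" where
  "joins_two_nonradial l \<Omega> \<longleftrightarrow>
     (\<exists>s t. singular \<Omega> s \<and> \<not> radial_singularity \<Omega> s \<and>
            singular \<Omega> t \<and> \<not> radial_singularity \<Omega> t \<and>
            (\<nexists>c. t = c *s s) \<and> pair l s = 0 \<and> pair l t = 0)"


section \<open>The Fermat foliation of degree two\<close>

definition fermat2 :: form3 where
  "fermat2 v =
     (let x = v$1; y = v$2; z = v$3
      in vector [y * z * (y - z), x * z * (z - x), x * y * (x - y)])"

text \<open>
  The third component is determined by the first two and \<open>x a + y b + z c = 0\<close>; in the standard
  chart one recovers \<open>x dy - y dx + y^2 dx - x^2 dy\<close>.
\<close>

lemma fermat2_affine: "affine_form (mat 1) fermat2 (x, y) = (y^2 - y, x - x^2)"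
  by (simp add: affine_form_def pullback_def fermat2_def Let_def transpose_mat
      vector_3 power2_eq_square algebra_simps)

lemma fermat2_Euler: "pair v (fermat2 v) = 0"
  by (simp add: pair_def fermat2_def Let_def sum_3 vector_3 algebra_simps)


section \<open>Holomorphic 1-forms in two variables and curvature of a 3-web\<close>

text \<open>The 1-form \<open>u dp + w dq\<close> is represented by the function with values \<open>(u, w)\<close>.\<close>

type_synonym form2 = "complex \<times> complex \<Rightarrow> complex \<times> complex"

definition holomorphic2 :: "(complex \<times> complex \<Rightarrow> complex) \<Rightarrow> (complex \<times> complex) set \<Rightarrow> bool" where
  "holomorphic2 f U \<longleftrightarrow>
     (\<forall>z\<in>U. \<exists>a b. (f has_derivative (\<lambda>h. a * fst h + b * snd h)) (at z))"

definition holomorphic_form :: "form2 \<Rightarrow> (complex \<times> complex) set \<Rightarrow> bool" where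
  "holomorphic_form \<omega> U \<longleftrightarrow>
     holomorphic2 (\<lambda>z. fst (\<omega> z)) U \<and> holomorphic2 (\<lambda>z. snd (\<omega> z)) U"

text \<open>2-forms are represented by their coefficient with respect to \<open>dp \<and> dq\<close>.\<close>

definition wedge :: "form2 \<Rightarrow> form2 \<Rightarrow> complex \<times> complex \<Rightarrow> complex" where
  "wedge \<omega> \<theta> z = fst (\<omega> z) * snd (\<theta> z) - snd (\<omega> z) * fst (\<theta> z)"

definition ext_deriv :: "form2 \<Rightarrow> complex \<times> complex \<Rightarrow> complex" where
  "ext_deriv \<omega> z = pd1 (\<lambda>u. snd (\<omega> u)) z - pd2 (\<lambda>u. fst (\<omega> u)) z"

definition fmult :: "(complex \<times> complex \<Rightarrow> complex) \<Rightarrow> form2 \<Rightarrow> form2" where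
  "fmult f \<omega> z = (f z * fst (\<omega> z), f z * snd (\<omega> z))"

text \<open>
  The defining equations of the form \<open>\<eta>\<close> are linear equations for its value at each point; they
  have a unique solution wherever the three forms are holomorphic and pairwise transverse
  (the three forms on the left-hand sides add up to zero).
\<close>

definition web_eta :: "form2 \<Rightarrow> form2 \<Rightarrow> form2 \<Rightarrow> form2" where
  "web_eta \<omega>1 \<omega>2 \<omega>3 z = (THE e.
     ext_deriv (fmult (wedge \<omega>2 \<omega>3) \<omega>1) z = wedge (\<lambda>_. e) (fmult (wedge \<omega>2 \<omega>3) \<omega>1) z \<and>
     ext_deriv (fmult (wedge \<omega>3 \<omega>1) \<omega>2) z = wedge (\<lambda>_. e) (fmult (wedge \<omega>3 \<omega>1) \<omega>2) z \<and>
     ext_deriv (fmult (wedge \<omega>1 \<omega>2) \<omega>3) z = wedge (\<lambda>_. e) (fmult (wedge \<omega>1 \<omega>2) \<omega>3) z)"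

definition web_curvature :: "form2 \<Rightarrow> form2 \<Rightarrow> form2 \<Rightarrow> complex \<times> complex \<Rightarrow> complex" where
  "web_curvature \<omega>1 \<omega>2 \<omega>3 = ext_deriv (web_eta \<omega>1 \<omega>2 \<omega>3)"


section \<open>The Legendre transform\<close>

text \<open>
  The polynomial \<open>f(x, px - q) (A(x, px - q) + p B(x, px - q))\<close>, where \<open>x = dq/dp\<close>, in the
  affine chart \<open>g\<close> of the plane and the chart \<open>(p, q)\<close> of the dual plane attached to it.
\<close>

definition legendre :: "complex^3^3 \<Rightarrow> complex^3 \<Rightarrow> form3 \<Rightarrow> complex \<times> complex \<Rightarrow> complex \<Rightarrow> complex" where
  "legendre g l \<Omega> = (\<lambda>(p, q) x.
     pair (pullback_line g l) (vector [x, p * x - q, 1]) *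
     (fst (affine_form g \<Omega> (x, p * x - q)) + p * snd (affine_form g \<Omega> (x, p * x - q))))"

text \<open>
  On \<open>U\<close> the implicit differential equation \<open>F(p, q, dq/dp) = 0\<close> is the superposition of the
  three pairwise transverse foliations \<open>\<omega>i = 0\<close>, none of them with vertical tangents.
\<close>

definition web3_on ::
  "(complex \<times> complex \<Rightarrow> complex \<Rightarrow> complex) \<Rightarrow> (complex \<times> complex) set
     \<Rightarrow> form2 \<Rightarrow> form2 \<Rightarrow> form2 \<Rightarrow> bool" where
  "web3_on F U \<omega>1 \<omega>2 \<omega>3 \<longleftrightarrow>
     open U \<and>
     (\<forall>\<omega>\<in>{\<omega>1, \<omega>2, \<omega>3}. holomorphic_form \<omega> U \<and> (\<forall>z\<in>U. snd (\<omega> z) \<noteq> 0)) \<and>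
     (\<forall>z\<in>U. wedge \<omega>1 \<omega>2 z \<noteq> 0 \<and> wedge \<omega>2 \<omega>3 z \<noteq> 0 \<and> wedge \<omega>3 \<omega>1 z \<noteq> 0) \<and>
     (\<forall>z\<in>U. \<forall>x. F z x = 0 \<longleftrightarrow> (\<exists>\<omega>\<in>{\<omega>1, \<omega>2, \<omega>3}. fst (\<omega> z) + snd (\<omega> z) * x = 0))"

text \<open>
  The curvature is a global meromorphic 2-form, holomorphic wherever the web decomposes as
  above. It vanishes identically iff it vanishes at all such points of all the affine charts.
  (A chart in which \<open>l\<close> is the line at infinity has no such points, because the pencil of lines
  dual to \<open>l\<close> is then vertical; in the other charts they form a dense open set.)
\<close>

definition flat_legendre :: "complex^3 \<Rightarrow> form3 \<Rightarrow> bool" where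
  "flat_legendre l \<Omega> \<longleftrightarrow>
     (\<forall>g U \<omega>1 \<omega>2 \<omega>3. invertible g \<and> web3_on (legendre g l \<Omega>) U \<omega>1 \<omega>2 \<omega>3 \<longrightarrow>
        (\<forall>z\<in>U. web_curvature \<omega>1 \<omega>2 \<omega>3 z = 0))"

end

theory Submission
  imports Defs "HOL-Computational_Algebra.Polynomial_Factorial"
    "HOL-Computational_Algebra.Fundamental_Theorem_Algebra"
    "HOL-Computational_Algebra.Field_as_Ring"
begin

text \<open>
  In a chart where \<open>l\<close> is \<open>x = 0\<close>, the dual web is \<open>x (\<alpha> x\<^sup>2 + \<beta> x + \<gamma>) = 0\<close> with \<open>x = dq/dp\<close>, and its flatness
  is a polynomial identity in \<open>\<alpha>\<close>, \<open>\<beta>\<close>, \<open>\<gamma>\<close> and their derivatives. Let \<open>f\<close> be an irreducible factor of the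
  discriminant \<open>\<Delta> = \<beta>\<^sup>2 - 4\<alpha>\<gamma>\<close>, which is a quartic. Comparing double poles along \<open>f = 0\<close> shows that either
  \<open>f\<close> does not involve \<open>p\<close>, or it is a solution of the web; in the latter case the double tangency point is
  singular, hence constant because the singularities are isolated. In both cases \<open>f = 0\<close> is the dual line of
  a point all of whose lines are doubly tangent, and in the absence of degenerate singularities such a point
  is a radial singularity, whose dual line is a simple component of \<open>\<Delta>\<close>. So there are four radial
  singularities. No three of them are collinear, and a foliation of degree two with four radial
  singularities in general position is the Fermat foliation. For the Fermat foliation and the line
  \<open>x + m y + n z = 0\<close>, the lowest-order part of the flatness identity leaves six values of \<open>(m, n)\<close>.
\<close>

section \<open>Polynomials in two variables\<close>

text \<open>The comparison of double poles does not test the invariance of \<open>f\<close> when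
  \<open>f\<close> divides \<gamma>: then \<open>f\<close> divides \<beta> too, and all three web
  directions coincide along \<open>f = 0\<close>. If \<open>f\<close> also divides \<alpha>, a whole
  family of lines would be invariant; otherwise the residual identity is refuted by the choice of
  the chart. With l given by x = 0, the tangency points of l are the zeros of
  \<open>k 1 2 * y^2 + k 1 4 * y * z + k 1 3 * z^2\<close>. The chart puts \<open>e3\<close> on a
  zero and, unless l is invariant, keeps \<open>e2\<close> off the zeros. It also keeps
  \<open>e2\<close> nonradial: the dual line of \<open>e2\<close> is the line at infinity of the (p,
  q) chart, so that otherwise the affine polynomial \<Delta> would miss one of its four components.
  The double tangency point is singular because of one identity. The point with coordinates x, z on
  the line (p, q) stays fixed when (p, q) moves in the direction (z, x), so differentiating the
  tangency form in that direction gives the second component of the 1-form.\<close>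

text \<open>The outer variable is \<open>p\<close>, the inner one is \<open>q\<close>.\<close>

definition ev :: "complex poly poly \<Rightarrow> complex \<Rightarrow> complex \<Rightarrow> complex" where
  "ev P p q = poly (poly P [:p:]) q"

definition Dq :: "complex poly poly \<Rightarrow> complex poly poly" where
  "Dq = map_poly pderiv"

abbreviation Dp :: "complex poly poly \<Rightarrow> complex poly poly" where
  "Dp \<equiv> pderiv"

abbreviation cst :: "complex \<Rightarrow> complex poly poly" where
  "cst c \<equiv> [:[:c:]:]"

abbreviation var_p :: "complex poly poly" where "var_p \<equiv> [:0, 1:]"

abbreviation var_q :: "complex poly poly" where "var_q \<equiv> [:[:0, 1:]:]"

lemma ev_simps [simp]:
  "ev 0 p q = 0" "ev 1 p q = 1" "ev (P + Q) p q = ev P p q + ev Q p q"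
  "ev (P - Q) p q = ev P p q - ev Q p q" "ev (- P) p q = - ev P p q"
  "ev (P * Q) p q = ev P p q * ev Q p q" "ev (P ^ n) p q = ev P p q ^ n"
  "ev (numeral k) p q = numeral k" "ev (pCons a P) p q = poly a q + p * ev P p q"
  "ev (of_nat n) p q = of_nat n"
  by (simp_all add: ev_def)

lemma ev_smult [simp]: "ev (smult a P) p q = poly a q * ev P p q"
  by (simp add: ev_def)

lemma ev_prod_mset: "ev (prod_mset A) p q = (\<Prod>f\<in>#A. ev f p q)"
  by (induction A) auto

text \<open>All the constants \<open>[:p:]\<close> are roots of \<open>P\<close> over the domain
  \<open>complex poly\<close>, and there are infinitely many of them.\<close>

lemma ev_eq_0D:
  assumes "\<And>p q. ev P p q = 0"
  shows "P = 0"
proof -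
  have "poly P [:p:] = 0" for p
    using assms[of p] by (simp add: ev_def flip: poly_all_0_iff_0)
  moreover have "infinite (range (\<lambda>p::complex. [:p:]))"
    by (subst finite_image_iff) (auto simp: inj_on_def infinite_UNIV_char_0)
  ultimately have "infinite {a. poly P a = 0}"
    by (metis (mono_tags, lifting) finite_subset image_subsetI mem_Collect_eq)
  then show ?thesis
    using poly_roots_finite by blast
qed

lemma Dq_pCons [simp]: "Dq (pCons a P) = pCons (pderiv a) (Dq P)"
  by (simp add: Dq_def map_poly_pCons)

lemma Dq_0 [simp]: "Dq 0 = 0" and Dq_1 [simp]: "Dq 1 = 0"
  by (simp_all add: Dq_def one_pCons map_poly_pCons)

lemma Dq_add: "Dq (P + Q) = Dq P + Dq Q"
  and Dq_diff: "Dq (P - Q) = Dq P - Dq Q"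
  and Dq_minus: "Dq (- P) = - Dq P"
  by (simp_all add: Dq_def poly_eq_iff coeff_map_poly pderiv_add pderiv_diff pderiv_minus)

lemma Dq_smult: "Dq (smult a P) = smult a (Dq P) + smult (pderiv a) P"
  by (simp add: Dq_def poly_eq_iff coeff_map_poly pderiv_mult mult.commute)

lemma Dq_mult: "Dq (P * Q) = P * Dq Q + Q * Dq P"
proof (induction P)
  case (pCons a P)
  then show ?case
    by (simp add: Dq_add Dq_smult algebra_simps)
qed simp

lemma Dq_numeral [simp]: "Dq (numeral n) = 0"
  by (simp add: numeral_poly)

lemma Dp_numeral [simp]: "Dp (numeral n) = 0"
  by (simp add: numeral_poly)

lemma Dq_power2: "Dq (P^2) = 2 * P * Dq P"
  by (simp add: power2_eq_square Dq_mult)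

lemma Dp_power2: "Dp (P^2) = 2 * P * Dp P"
  by (simp add: power2_eq_square pderiv_mult)

lemma has_derivative_ev:
  "((\<lambda>z. ev P (fst z) (snd z)) has_derivative
     (\<lambda>h. ev (Dp P) (fst z) (snd z) * fst h + ev (Dq P) (fst z) (snd z) * snd h)) (at z)"
proof (induction P)
  case 0
  then show ?case by simp
next
  case (pCons a P)
  have 1: "((\<lambda>z. poly a (snd z)) has_derivative (\<lambda>h. poly (pderiv a) (snd z) * snd h)) (at z)"
    by (rule has_derivative_compose[of snd snd z UNIV "poly a", OF _ has_field_derivative_imp_has_derivative[OF poly_DERIV]])
      (auto intro: derivative_eq_intros)
  show ?case
    by (rule has_derivative_eq_rhs, simp, (rule derivative_intros 1 pCons.IH)+)
      (auto simp: pderiv_pCons algebra_simps fun_eq_iff)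
qed

lemma DERIV_ev_p: "((\<lambda>t. ev P t q) has_field_derivative ev (Dp P) p q) (at p)"
proof (induction P)
  case (pCons a P)
  show ?case
    by simp (rule derivative_eq_intros pCons.IH | simp add: pderiv_pCons algebra_simps)+
qed simp

lemma DERIV_ev_q: "((\<lambda>t. ev P p t) has_field_derivative ev (Dq P) p q) (at q)"
proof (induction P)
  case (pCons a P)
  show ?case
    by simp (rule derivative_eq_intros pCons.IH poly_DERIV | simp)+
qed simp

lemma isCont_ev: "isCont (\<lambda>z. ev P (fst z) (snd z)) z"
  using has_derivative_continuous[OF has_derivative_ev] .

text \<open>An equation of the dual line of the point \<open>s\<close>.\<close>

definition lin :: "complex^3 \<Rightarrow> complex poly poly" where
  "lin s = [:[:- s$2, - s$3:], [:s$1:]:]"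

lemma ev_lin: "ev (lin s) p q = p * s$1 - s$2 - q * s$3"
  by (simp add: lin_def algebra_simps)

section \<open>Zeros and linear factors of polynomials in two variables\<close>

lemma finite_poly2_section:
  fixes f :: "complex poly poly"
  assumes "degree f > 0"
  obtains B where "finite B" "\<And>q. q \<notin> B \<Longrightarrow> \<exists>p. ev f p q = 0"
proof
  define B where "B = {q. poly (lead_coeff f) q = 0}"
  show "finite B"
    unfolding B_def using assms by (intro poly_roots_finite) auto
  fix q assume q: "q \<notin> B"
  define h where "h = map_poly (\<lambda>c. poly c q) f"
  have ev_h: "poly h p = ev f p q" for p
    unfolding h_def ev_def by (induction f) (auto simp: map_poly_pCons)
  \<comment> \<open>Away from the zeros of the leading coefficient, specializing \<open>q\<close>
    keeps the degree in \<open>p\<close>, so there is a point of the curve over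
    \<open>q\<close>.\<close>
  have "degree h = degree f"
    unfolding h_def using q by (intro map_poly_degree_eq) (auto simp: B_def)
  with assms have "\<not> constant (poly h)"
    using constant_degree[of h] by simp
  then show "\<exists>p. ev f p q = 0"
    using fundamental_theorem_of_algebra ev_h by metis
qed

lemma lin_smult_monic:
  assumes "s$1 \<noteq> 0"
  shows "lin s = smult [:s$1:] [:- [:s$2 / s$1, s$3 / s$1:], 1:]"
  using assms by (simp add: lin_def)

lemma unit_const: "c \<noteq> 0 \<Longrightarrow> is_unit [:[:c::complex:]:]"
  by (auto simp: is_unit_const_poly_iff dvd_field_iff)

text \<open>Up to the unit \<open>s$1\<close>, \<open>lin s\<close> is monic in \<open>p\<close>.
  Substituting its root for \<open>p\<close> in \<open>f\<close> leaves a polynomial in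
  \<open>q\<close> with infinitely many zeros, so \<open>lin s\<close> divides the irreducible
  \<open>f\<close>.\<close>

lemma irreducible_lin_of_zeros:
  fixes f :: "complex poly poly"
  assumes f: "irreducible f" and s: "s$1 \<noteq> 0"
    and inf: "infinite {q. ev f ((s$2 + q * s$3) / s$1) q = 0}"
  shows "\<exists>c. c \<noteq> 0 \<and> f = smult [:c:] (lin s)"
proof -
  define a where "a = [:s$2 / s$1, s$3 / s$1:]"
  have ev_a: "poly (poly f a) q = ev f ((s$2 + q * s$3) / s$1) q" for q
    unfolding ev_def by (induction f) (auto simp: a_def add_divide_distrib algebra_simps)
  have "poly f a = 0"
    using inf poly_roots_finite[of "poly f a"] unfolding ev_a by blast
  then obtain k where k: "f = [:- a, 1:] * k"
    unfolding poly_eq_0_iff_dvd by (elim dvdE)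
  have "\<not> is_unit [:- a, 1:]"
    by (simp add: is_unit_poly_iff)
  then have "is_unit k"
    using irreducibleD[OF f k] by blast
  then obtain b c where c: "k = [:b:]" "b = [:c:]" "c \<noteq> 0"
    by (auto simp: is_unit_poly_iff dvd_field_iff)
  have "f = smult [:c / s$1:] (lin s)"
    unfolding lin_smult_monic[OF s] using k c s by (simp add: a_def[symmetric])
  with c s show ?thesis
    by (intro exI[of _ "c / s$1"]) auto
qed

text \<open>By pigeonhole: over almost every \<open>q\<close> the curve has a point on one of
  finitely many dual lines, so one of these lines meets the curve over infinitely many
  \<open>q\<close>.\<close>

lemma irreducible_eq_lin:
  fixes f :: "complex poly poly"
  assumes f: "irreducible f" and deg: "degree f > 0"
    and S: "finite S" "0 \<notin> S" and B: "finite B"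
    and zeros: "\<And>p q. q \<notin> B \<Longrightarrow> ev f p q = 0 \<Longrightarrow> \<exists>s\<in>S. p * s$1 - s$2 - q * s$3 = 0"
  shows "\<exists>s\<in>S. \<exists>c. s$1 \<noteq> 0 \<and> c \<noteq> 0 \<and> f = smult [:c:] (lin s)"
proof -
  obtain B' where B': "finite B'" "\<And>q. q \<notin> B' \<Longrightarrow> \<exists>p. ev f p q = 0"
    using finite_poly2_section[OF deg] by blast
  define A where "A = - (B \<union> B')"
  have "infinite A"
    unfolding A_def using Diff_infinite_finite[of "B \<union> B'" UNIV] B B'
    by (simp add: infinite_UNIV_char_0 Compl_eq_Diff_UNIV)
  have "\<exists>s p. s \<in> S \<and> ev f p q = 0 \<and> p * s$1 - s$2 - q * s$3 = 0" if "q \<in> A" for q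
    using that zeros B'(2) unfolding A_def by blast
  then obtain h p where h: "\<And>q. q \<in> A \<Longrightarrow> h q \<in> S \<and> ev f (p q) q = 0 \<and>
      p q * h q $ 1 - h q $ 2 - q * h q $ 3 = 0"
    by metis
  have "finite (h ` A)"
    using h S finite_subset by (metis image_subsetI)
  then obtain q0 where q0: "q0 \<in> A" "infinite {q \<in> A. h q = h q0}"
    using pigeonhole_infinite[OF \<open>infinite A\<close>] by blast
  define s where "s = h q0"
  have s: "s \<in> S" using h q0 by (simp add: s_def)
  have eq: "p q * s$1 - s$2 - q * s$3 = 0" "ev f (p q) q = 0" if "q \<in> A" "h q = s" for q
    using h that by auto
  \<comment> \<open>If \<open>s$1\<close> were 0, the dual line would be empty or have a fixed
    \<open>q\<close>, but it contains points over two different values of \<open>q\<close>.\<close>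
  have "s$1 \<noteq> 0"
  proof
    assume 0: "s$1 = 0"
    have "infinite ({q \<in> A. h q = h q0} - {q0})"
      using q0(2) by simp
    then obtain q1 where "q1 \<in> {q \<in> A. h q = h q0} - {q0}"
      by (metis ex_in_conv finite.emptyI)
    then have q1: "q1 \<in> A" "h q1 = s" "q1 \<noteq> q0"
      by (auto simp: s_def)
    have e0: "s$2 + q0 * s$3 = 0"
      using eq(1)[OF q0(1) s_def[symmetric]] 0 by algebra
    have e1: "s$2 + q1 * s$3 = 0"
      using eq(1)[OF q1(1,2)] 0 by algebra
    with e0 have "(q1 - q0) * s$3 = 0" by algebra
    with q1(3) have "s$3 = 0" by simp
    with e0 have "s$2 = 0" by simp
    with 0 \<open>s$3 = 0\<close> have "s = 0"
      by (simp add: vec_eq_iff forall_3)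
    with s S show False by blast
  qed
  moreover have "ev f ((s$2 + q * s$3) / s$1) q = 0" if "q \<in> A" "h q = s" for q
  proof -
    have "p q * s$1 = s$2 + q * s$3"
      using eq(1)[OF that] by (simp add: diff_eq_eq)
    then have "p q = (s$2 + q * s$3) / s$1"
      using \<open>s$1 \<noteq> 0\<close> by (simp add: eq_divide_eq)
    then show ?thesis
      using eq(2)[OF that] by simp
  qed
  then have "{q \<in> A. h q = s} \<subseteq> {q. ev f ((s$2 + q * s$3) / s$1) q = 0}"
    by blast
  then have "infinite {q. ev f ((s$2 + q * s$3) / s$1) q = 0}"
    using q0(2) finite_subset unfolding s_def by blast
  ultimately show ?thesis
    using irreducible_lin_of_zeros[OF f] s by blast
qed

text \<open>Bezout's argument for a divisor of degree at most one, by pseudo-division.\<close>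

lemma finite_common_zeros:
  fixes f g :: "complex poly poly"
  assumes f: "irreducible f" and "\<not> f dvd g" and g: "degree g \<le> 1"
  obtains B where "finite B" "\<And>p q. ev f p q = 0 \<Longrightarrow> ev g p q = 0 \<Longrightarrow> q \<in> B"
proof -
  have "g \<noteq> 0" using assms by auto
  have "\<exists>r. r \<noteq> 0 \<and> (\<forall>p q. ev f p q = 0 \<longrightarrow> ev g p q = 0 \<longrightarrow> poly r q = 0)"
  proof (cases "degree g = 0")
    case True
    then obtain r where "g = [:r:]" by (auto elim: degree_eq_zeroE)
    with \<open>g \<noteq> 0\<close> show ?thesis by (intro exI[of _ r]) auto
  next
    case False
    obtain Q R where QR: "pseudo_divmod f g = (Q, R)" by fastforce
    define a where "a = lead_coeff g ^ (Suc (degree f) - degree g)"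
    have a: "smult a f = g * Q + R" "R = 0 \<or> degree R < degree g" "a \<noteq> 0"
      using pseudo_divmod[OF \<open>g \<noteq> 0\<close> QR] \<open>g \<noteq> 0\<close> by (auto simp: a_def)
    then have "degree R = 0" using g by auto
    then obtain r where r: "R = [:r:]" by (auto elim: degree_eq_zeroE)
    \<comment> \<open>If the pseudo-remainder were 0, \<open>f\<close> would divide the
      pseudo-quotient; cancelling \<open>f\<close> makes \<open>g\<close> a divisor of a polynomial
      free of \<open>p\<close>, against its degree.\<close>
    have "r \<noteq> 0"
    proof
      assume "r = 0"
      then have eq: "smult a f = g * Q" using a r by simp
      have "prime_elem f" using f by (simp add: prime_elem_iff_irreducible)
      moreover have "f dvd g * Q" unfolding eq[symmetric] by (simp add: dvd_smult)
      ultimately obtain Q' where "Q = f * Q'"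
        using \<open>\<not> f dvd g\<close> by (auto simp: prime_elem_dvd_mult_iff)
      then have "f * [:a:] = f * (g * Q')" using eq by (simp add: mult_ac)
      then have "[:a:] = g * Q'"
        using f mult_left_cancel[of f "[:a:]" "g * Q'"] irreducible_def by blast
      then have "degree (g * Q') = 0" by (metis degree_pCons_0)
      moreover have "Q' \<noteq> 0"
      proof
        assume "Q' = 0"
        with \<open>[:a:] = g * Q'\<close> have "[:a:] = 0" by (simp only: mult_zero_right)
        with a(3) show False by simp
      qed
      ultimately show False
        using False \<open>g \<noteq> 0\<close> by (simp add: degree_mult_eq)
    qed
    moreover have "poly r q = 0" if "ev f p q = 0" "ev g p q = 0" for p q
      using arg_cong[OF a(1), of "\<lambda>P. ev P p q"] that r by simp
    ultimately show ?thesis by blast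
  qed
  then obtain r where "r \<noteq> 0" "\<And>p q. ev f p q = 0 \<Longrightarrow> ev g p q = 0 \<Longrightarrow> poly r q = 0"
    by blast
  then show thesis
    using that[of "{q. poly r q = 0}"] poly_roots_finite by blast
qed

lemma ev_dvd: "f dvd g \<Longrightarrow> ev f p q = 0 \<Longrightarrow> ev g p q = 0"
  by (auto elim!: dvdE)


section \<open>Frames of homogeneous coordinates\<close>

lemma vec3_eq_iff: "v = w \<longleftrightarrow> v$1 = w$1 \<and> v$2 = w$2 \<and> v$3 = (w::'a^3)$3"
  by (simp add: vec_eq_iff forall_3)

lemma pair_eq: "pair l v = l$1 * v$1 + l$2 * v$2 + l$3 * v$3"
  by (simp add: pair_def sum_3)

lemma pair_comb:
  "pair (v + w) u = pair v u + pair w u" "pair v (w + u) = pair v w + pair v u"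
  "pair (c *s v) w = c * pair v w" "pair v (c *s w) = c * pair v w"
  by (simp_all add: pair_eq algebra_simps)

text \<open>The bilinear cross product: the line joining two points, or the zero vector if the
  points coincide.\<close>

definition crs :: "complex^3 \<Rightarrow> complex^3 \<Rightarrow> complex^3" where
  "crs v w = vector [v$2 * w$3 - v$3 * w$2, v$3 * w$1 - v$1 * w$3, v$1 * w$2 - v$2 * w$1]"

lemma crs_nth [simp]:
  "crs v w $ 1 = v$2 * w$3 - v$3 * w$2" "crs v w $ 2 = v$3 * w$1 - v$1 * w$3"
  "crs v w $ 3 = v$1 * w$2 - v$2 * w$1"
  by (simp_all add: crs_def vector_3)

lemma crs_eq_0_iff:
  assumes "s \<noteq> 0"
  shows "crs s m = 0 \<longleftrightarrow> (\<exists>c. m = c *s s)"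
proof
  assume "crs s m = 0"
  then have eq: "s$2 * m$3 = s$3 * m$2" "s$3 * m$1 = s$1 * m$3" "s$1 * m$2 = s$2 * m$1"
    by (simp_all add: vec3_eq_iff)
  consider "s$1 \<noteq> 0" | "s$2 \<noteq> 0" | "s$3 \<noteq> 0"
    using assms by (auto simp: vec3_eq_iff)
  then show "\<exists>c. m = c *s s"
  proof cases
    case 1
    then show ?thesis using eq by (intro exI[of _ "m$1 / s$1"]) (simp add: vec3_eq_iff field_simps)
  next
    case 2
    then show ?thesis using eq by (intro exI[of _ "m$2 / s$2"]) (simp add: vec3_eq_iff field_simps)
  next
    case 3
    then show ?thesis using eq by (intro exI[of _ "m$3 / s$3"]) (simp add: vec3_eq_iff field_simps)
  qed
qed (auto simp: vec3_eq_iff)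

definition frame :: "complex^3 \<Rightarrow> complex^3 \<Rightarrow> complex^3 \<Rightarrow> complex^3^3" where
  "frame a b c = (\<chi> i j. if j = 1 then a$i else if j = 2 then b$i else c$i)"

lemma matrix_vector_3:
  "((g::complex^3^3) *v v) $ i = g$i$1 * v$1 + g$i$2 * v$2 + g$i$3 * v$3"
  by (simp add: matrix_vector_mult_def sum_3)

lemma frame_mult: "frame a b c *v v = v$1 *s a + v$2 *s b + v$3 *s c"
  by (simp add: vec3_eq_iff matrix_vector_3 frame_def mult.commute)

lemma det_frame: "det (frame a b c) = pair (crs a b) c"
  by (simp add: det_3 frame_def pair_eq algebra_simps)

lemma invertible_frame_iff: "invertible (frame a b c) \<longleftrightarrow> pair (crs a b) c \<noteq> 0"
  by (simp add: invertible_det_nz det_frame)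

lemma frame_complete:
  assumes "crs a b \<noteq> 0"
  obtains r where "pair (crs a b) r \<noteq> 0"
proof -
  have "crs a b $ 1 \<noteq> 0 \<or> crs a b $ 2 \<noteq> 0 \<or> crs a b $ 3 \<noteq> 0"
    using assms by (auto simp: vec3_eq_iff)
  then have "\<exists>r. pair (crs a b) r \<noteq> 0"
    unfolding pair_eq
    by (metis (no_types) mult.right_neutral mult_zero_right add.right_neutral add.left_neutral vector_3)
  then show thesis using that by blast
qed

lemma exists_not_proportional:
  fixes s :: "complex^3"
  assumes "s \<noteq> 0"
  obtains m where "crs s m \<noteq> 0"
proof -
  have "crs s (vector [1, 0, 0]) \<noteq> 0 \<or> crs s (vector [0, 1, 0]) \<noteq> 0"
    using assms by (auto simp: vec3_eq_iff vector_3)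
  then show thesis using that by blast
qed

lemma frame_at_point:
  assumes "s \<noteq> 0"
  obtains a b where "invertible (frame a b s)"
proof -
  obtain b where "crs s b \<noteq> 0" using assms by (rule exists_not_proportional)
  then obtain a where "pair (crs s b) a \<noteq> 0" by (rule frame_complete)
  moreover have "pair (crs a b) s = - pair (crs s b) a"
    by (simp add: pair_eq algebra_simps)
  ultimately show thesis by (intro that[of a b]) (simp add: invertible_frame_iff)
qed

section \<open>Quadratic vector fields\<close>

definition quad :: "(nat \<Rightarrow> complex) \<Rightarrow> complex^3 \<Rightarrow> complex" where
  "quad a v = a 1 * (v$1)^2 + a 2 * (v$2)^2 + a 3 * (v$3)^2
     + a 4 * v$2 * v$3 + a 5 * v$1 * v$3 + a 6 * v$1 * v$2"

definition polar :: "(nat \<Rightarrow> complex) \<Rightarrow> complex^3 \<Rightarrow> complex^3 \<Rightarrow> complex" where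
  "polar a v w = 2 * a 1 * v$1 * w$1 + 2 * a 2 * v$2 * w$2 + 2 * a 3 * v$3 * w$3
     + a 4 * (v$2 * w$3 + v$3 * w$2) + a 5 * (v$1 * w$3 + v$3 * w$1) + a 6 * (v$1 * w$2 + v$2 * w$1)"

definition qfield :: "(nat \<Rightarrow> nat \<Rightarrow> complex) \<Rightarrow> complex^3 \<Rightarrow> complex^3" where
  "qfield k v = vector [quad (k 1) v, quad (k 2) v, quad (k 3) v]"

definition pfield :: "(nat \<Rightarrow> nat \<Rightarrow> complex) \<Rightarrow> complex^3 \<Rightarrow> complex^3 \<Rightarrow> complex^3" where
  "pfield k v w = vector [polar (k 1) v w, polar (k 2) v w, polar (k 3) v w]"

text \<open>Contraction of the volume form with the radial field and a quadratic field. Adding to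
  \<open>qfield k\<close> a linear form times the position vector does not change it; hence only
  differences such as \<open>k 1 5 - k 3 3\<close> have a geometric meaning.\<close>

definition field_form :: "(nat \<Rightarrow> nat \<Rightarrow> complex) \<Rightarrow> form3" where
  "field_form k v = crs v (qfield k v)"

lemma qfield_nth [simp]:
  "qfield k v $ 1 = quad (k 1) v" "qfield k v $ 2 = quad (k 2) v" "qfield k v $ 3 = quad (k 3) v"
  by (simp_all add: qfield_def vector_3)

lemma pfield_nth [simp]:
  "pfield k v w $ 1 = polar (k 1) v w" "pfield k v w $ 2 = polar (k 2) v w"
  "pfield k v w $ 3 = polar (k 3) v w"
  by (simp_all add: pfield_def vector_3)

lemma field_form_nth:
  "field_form k v $ 1 = v$2 * quad (k 3) v - v$3 * quad (k 2) v"
  "field_form k v $ 2 = v$3 * quad (k 1) v - v$1 * quad (k 3) v"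
  "field_form k v $ 3 = v$1 * quad (k 2) v - v$2 * quad (k 1) v"
  by (simp_all add: field_form_def)

lemma quad_comb:
  "quad a (x *s v + y *s w) = x^2 * quad a v + x * y * polar a v w + y^2 * quad a w"
  by (simp add: quad_def polar_def power2_eq_square algebra_simps)

lemma qfield_comb:
  "qfield k (x *s v + y *s w) = x^2 *s qfield k v + (x * y) *s pfield k v w + y^2 *s qfield k w"
  by (simp add: vec3_eq_iff quad_comb)

lemma quad_comb3:
  "quad a (x *s u + y *s v + z *s w) = x^2 * quad a u + y^2 * quad a v + z^2 * quad a w
     + y * z * polar a v w + x * z * polar a u w + x * y * polar a u v"
  by (simp add: quad_def polar_def power2_eq_square algebra_simps)

lemma quad_coeffs:
  "\<exists>a. \<forall>v. quad a v = c1 * (v$1)^2 + c2 * (v$2)^2 + c3 * (v$3)^2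
     + c4 * v$2 * v$3 + c5 * v$1 * v$3 + c6 * v$1 * v$2"
  by (rule exI[of _ "\<lambda>n. [0, c1, c2, c3, c4, c5, c6] ! n"]) (simp add: quad_def)

lemma quad_linear_subst: "\<exists>a'. \<forall>v. quad a (g *v v) = quad a' v"
proof -
  define c where "c = (\<lambda>j. (\<chi> i. g$i$j))"
  have "g *v v = v$1 *s c 1 + v$2 *s c 2 + v$3 *s c 3" for v
    by (simp add: vec3_eq_iff matrix_vector_3 c_def mult.commute)
  moreover obtain a' where "\<forall>v. quad a' v = quad a (c 1) * (v$1)^2 + quad a (c 2) * (v$2)^2
      + quad a (c 3) * (v$3)^2 + polar a (c 2) (c 3) * v$2 * v$3
      + polar a (c 1) (c 3) * v$1 * v$3 + polar a (c 1) (c 2) * v$1 * v$2"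
    using quad_coeffs by blast
  ultimately have "\<forall>v. quad a (g *v v) = quad a' v"
    by (simp add: quad_comb3 mult_ac)
  then show ?thesis by blast
qed

lemma quad_lincomb: "\<exists>a'. \<forall>v. x * quad a v + y * quad b v + z * quad c v = quad a' v"
  by (rule exI[of _ "\<lambda>n. x * a n + y * b n + z * c n"]) (simp add: quad_def algebra_simps)

section \<open>Pullbacks, and quadratic fields for foliations of degree two\<close>

lemma pullback_nth:
  "pullback g \<Omega> v $ i = g$1$i * \<Omega> (g *v v) $ 1 + g$2$i * \<Omega> (g *v v) $ 2 + g$3$i * \<Omega> (g *v v) $ 3"
  by (simp add: pullback_def matrix_vector_3 transpose_def)

lemma pullback_pair: "pair (pullback g \<Omega> v) w = pair (\<Omega> (g *v v)) (g *v w)"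
  by (simp add: pair_eq pullback_nth matrix_vector_3 algebra_simps)

lemma pullback_pullback: "pullback h (pullback g \<Omega>) = pullback (g ** h) \<Omega>"
  by (simp only: pullback_def fun_eq_iff matrix_transpose_mul matrix_vector_mul_assoc simp_thms)

text \<open>Pulling back \<open>crs v Q\<close> gives the cross product of \<open>v\<close> with the
  adjugate of \<open>g\<close> applied to \<open>Q (g v)\<close>; \<open>a1\<close>,
  \<open>a2\<close>, \<open>a3\<close> are the components of that vector. The adjugate makes this
  hold for singular \<open>g\<close> as well.\<close>

lemma pullback_field_form: "\<exists>k'. pullback g (field_form k) = field_form k'"
proof -
  have "\<exists>a. \<forall>v. x * quad (k 1) (g *v v) + y * quad (k 2) (g *v v) + z * quad (k 3) (g *v v) = quad a v" for x y z
  proof -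
    obtain a b c where "\<forall>v. quad (k 1) (g *v v) = quad a v" "\<forall>v. quad (k 2) (g *v v) = quad b v"
      "\<forall>v. quad (k 3) (g *v v) = quad c v"
      using quad_linear_subst by metis
    then show ?thesis using quad_lincomb[of x a y b z c] by simp
  qed
  note ex = this
  obtain a1 where a1: "\<And>v. quad a1 v = (g$2$2 * g$3$3 - g$2$3 * g$3$2) * quad (k 1) (g *v v)
      + (g$1$3 * g$3$2 - g$1$2 * g$3$3) * quad (k 2) (g *v v)
      + (g$1$2 * g$2$3 - g$1$3 * g$2$2) * quad (k 3) (g *v v)"
    using ex by metis
  obtain a2 where a2: "\<And>v. quad a2 v = (g$2$3 * g$3$1 - g$2$1 * g$3$3) * quad (k 1) (g *v v)
      + (g$1$1 * g$3$3 - g$1$3 * g$3$1) * quad (k 2) (g *v v)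
      + (g$1$3 * g$2$1 - g$1$1 * g$2$3) * quad (k 3) (g *v v)"
    using ex by metis
  obtain a3 where a3: "\<And>v. quad a3 v = (g$2$1 * g$3$2 - g$2$2 * g$3$1) * quad (k 1) (g *v v)
      + (g$1$2 * g$3$1 - g$1$1 * g$3$2) * quad (k 2) (g *v v)
      + (g$1$1 * g$2$2 - g$1$2 * g$2$1) * quad (k 3) (g *v v)"
    using ex by metis
  define k' where "k' = (\<lambda>i::nat. [a1, a1, a2, a3] ! i)"
  have k': "k' 1 = a1" "k' 2 = a2" "k' 3 = a3"
    by (simp_all add: k'_def)
  have "pullback g (field_form k) v = field_form k' v" for v
    unfolding vec3_eq_iff pullback_nth field_form_nth k' a1 a2 a3
    by (simp add: matrix_vector_3 algebra_simps)
  then show ?thesis by blast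
qed

lemma quartic_coeffs_eq_0:
  fixes a b c d e :: complex
  assumes "\<And>x. a + b * x + c * x^2 + d * x^3 + e * x^4 = 0"
  shows "a = 0 \<and> b = 0 \<and> c = 0 \<and> d = 0 \<and> e = 0"
proof -
  have "poly [:a, b, c, d, e:] x = 0" for x
    using assms[of x] by (simp add: algebra_simps power2_eq_square power3_eq_cube power4_eq_xxxx)
  then have "[:a, b, c, d, e:] = 0"
    using poly_all_0_iff_0 by blast
  then show ?thesis by simp
qed

text \<open>Dehomogenize by z = 1. Comparing powers of x for fixed y makes each inner sum
  \<open>s i y\<close> vanish; then compare powers of y.\<close>

lemma quartic3_coeffs_eq_0:
  fixes c :: "nat \<Rightarrow> nat \<Rightarrow> complex"
  assumes "\<And>x y z. (\<Sum>i\<le>4. \<Sum>j\<le>4 - i. c i j * x^i * y^j * z^(4 - i - j)) = 0"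
  shows "\<forall>i j. i + j \<le> 4 \<longrightarrow> c i j = 0"
proof -
  define s where "s = (\<lambda>i y. (\<Sum>j\<le>4 - i. c i j * y^j))"
  have "s 0 y + s 1 y * x + s 2 y * x^2 + s 3 y * x^3 + s 4 y * x^4 = 0" for x y
    using assms[of x y 1]
    by (simp add: s_def numeral_eq_Suc sum_distrib_right mult_ac sum_distrib_left algebra_simps)
  then have "s 0 y = 0 \<and> s 1 y = 0 \<and> s 2 y = 0 \<and> s 3 y = 0 \<and> s 4 y = 0" for y
    by (rule quartic_coeffs_eq_0)
  then have s: "s i y = 0" if "i \<le> 4" for i y
    using that by (auto simp: le_Suc_eq numeral_eq_Suc)
  have "poly (\<Sum>j\<le>4 - i. monom (c i j) j) y = 0" if "i \<le> 4" for i y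
    using s[OF that] by (simp add: s_def poly_sum poly_monom)
  then have 0: "(\<Sum>j\<le>4 - i. monom (c i j) j) = 0" if "i \<le> 4" for i
    using that poly_all_0_iff_0 by blast
  show ?thesis
  proof safe
    fix i j :: nat assume ij: "i + j \<le> 4"
    have "c i j = coeff (\<Sum>j\<le>4 - i. monom (c i j) j) j"
      using ij by (simp add: coeff_sum sum.delta)
    also have "\<dots> = 0"
      using 0[of i] ij by simp
    finally show "c i j = 0" .
  qed
qed

lemma homogeneous3_cubic:
  assumes "homogeneous3 3 f"
  obtains c where "\<And>v. f v = c 0 0 * (v$3)^3 + c 0 1 * v$2 * (v$3)^2 + c 0 2 * (v$2)^2 * v$3
     + c 0 3 * (v$2)^3 + c 1 0 * v$1 * (v$3)^2 + c 1 1 * v$1 * v$2 * v$3 + c 1 2 * v$1 * (v$2)^2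
     + c 2 0 * (v$1)^2 * v$3 + c 2 1 * (v$1)^2 * v$2 + c (3::nat) (0::nat) * (v$1)^3"
proof -
  obtain c where "\<And>v. f v = (\<Sum>i\<le>3. \<Sum>j\<le>3 - i. c i j * (v$1)^i * (v$2)^j * (v$3)^(3 - i - j))"
    using assms unfolding homogeneous3_def by blast
  then show thesis
    by (intro that[of c]) (simp add: numeral_eq_Suc)
qed

text \<open>This is exactness of the Koszul complex in the degree at hand: the relation
  \<open>x a + y b + z c = 0\<close> is solved coefficient by coefficient, and its solutions are
  cross products with the position vector.\<close>

lemma foliation2_field_form:
  assumes "foliation 2 \<Omega>"
  shows "\<exists>k. \<Omega> = field_form k"
proof -
  have hom: "homogeneous3 3 (\<lambda>v. \<Omega> v $ i)" for i
    using assms unfolding foliation_def by simp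
  obtain a where a: "\<And>v. \<Omega> v $ 1 = a 0 0 * (v$3)^3 + a 0 1 * v$2 * (v$3)^2 + a 0 2 * (v$2)^2 * v$3
     + a 0 3 * (v$2)^3 + a 1 0 * v$1 * (v$3)^2 + a 1 1 * v$1 * v$2 * v$3 + a 1 2 * v$1 * (v$2)^2
     + a 2 0 * (v$1)^2 * v$3 + a 2 1 * (v$1)^2 * v$2 + a (3::nat) (0::nat) * (v$1)^3"
    by (rule homogeneous3_cubic[OF hom[of 1]]) blast
  obtain b where b: "\<And>v. \<Omega> v $ 2 = b 0 0 * (v$3)^3 + b 0 1 * v$2 * (v$3)^2 + b 0 2 * (v$2)^2 * v$3
     + b 0 3 * (v$2)^3 + b 1 0 * v$1 * (v$3)^2 + b 1 1 * v$1 * v$2 * v$3 + b 1 2 * v$1 * (v$2)^2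
     + b 2 0 * (v$1)^2 * v$3 + b 2 1 * (v$1)^2 * v$2 + b (3::nat) (0::nat) * (v$1)^3"
    by (rule homogeneous3_cubic[OF hom[of 2]]) blast
  obtain c where c: "\<And>v. \<Omega> v $ 3 = c 0 0 * (v$3)^3 + c 0 1 * v$2 * (v$3)^2 + c 0 2 * (v$2)^2 * v$3
     + c 0 3 * (v$2)^3 + c 1 0 * v$1 * (v$3)^2 + c 1 1 * v$1 * v$2 * v$3 + c 1 2 * v$1 * (v$2)^2
     + c 2 0 * (v$1)^2 * v$3 + c 2 1 * (v$1)^2 * v$2 + c (3::nat) (0::nat) * (v$1)^3"
    by (rule homogeneous3_cubic[OF hom[of 3]]) blast
  \<comment> \<open>The coefficient of \<open>x^i y^j z^(4 - i - j)\<close> in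
    \<open>x a + y b + z c\<close>; multiplication by x or y shifts one index, multiplication by z
    shifts none.\<close>
  define e where "e = (\<lambda>i j. (if 1 \<le> i then a (i - 1) j else 0) + (if 1 \<le> j then b i (j - 1) else 0)
      + (if i + j \<le> 3 then c i j else 0))"
  have "\<forall>i j. i + j \<le> 4 \<longrightarrow> e i j = 0"
  proof (rule quartic3_coeffs_eq_0)
    fix x y z :: complex
    have "pair (vector [x, y, z]) (\<Omega> (vector [x, y, z])) = 0"
      using assms unfolding foliation_def by blast
    then have "x * \<Omega> (vector [x, y, z]) $ 1 + y * \<Omega> (vector [x, y, z]) $ 2 + z * \<Omega> (vector [x, y, z]) $ 3 = 0"
      by (simp add: pair_eq vector_3)
    then show "(\<Sum>i\<le>4. \<Sum>j\<le>4 - i. e i j * x^i * y^j * z^(4 - i - j)) = 0"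
      unfolding a b c by (simp add: numeral_eq_Suc e_def vector_3 algebra_simps)
  qed
  then have e: "e i j = 0" if "i + j \<le> 4" for i j
    using that by blast
  have solve: "x = - y - z" if "x + y + z = 0" for x y z :: complex
    using that by algebra
  have E: "c 0 0 = 0" "b 0 0 = - c 0 1" "b 0 1 = - c 0 2" "b 0 2 = - c 0 3" "b 0 3 = 0"
    "a 0 0 = - c 1 0" "a 0 1 = - b 1 0 - c 1 1" "a 0 2 = - b 1 1 - c 1 2" "a 0 3 = - b 1 2"
    "a 1 0 = - c 2 0" "a 1 1 = - b 2 0 - c 2 1" "a 1 2 = - b 2 1" "a 2 0 = - c 3 0" "a 2 1 = - b 3 0"
    "a 3 0 = 0"
    subgoal using e[of 0 0] by (simp add: e_def)
    subgoal using e[of 0 1] by (simp add: e_def eq_neg_iff_add_eq_0)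
    subgoal using e[of 0 2] by (simp add: e_def eq_neg_iff_add_eq_0)
    subgoal using e[of 0 3] by (simp add: e_def eq_neg_iff_add_eq_0)
    subgoal using e[of 0 4] by (simp add: e_def)
    subgoal using e[of 1 0] by (simp add: e_def eq_neg_iff_add_eq_0)
    subgoal using e[of 1 1] by (intro solve) (simp add: e_def)
    subgoal using e[of 1 2] by (intro solve) (simp add: e_def)
    subgoal using e[of 1 3] by (simp add: e_def eq_neg_iff_add_eq_0)
    subgoal using e[of 2 0] by (simp add: e_def eq_neg_iff_add_eq_0)
    subgoal using e[of 2 1] by (intro solve) (simp add: e_def)
    subgoal using e[of 2 2] by (simp add: e_def eq_neg_iff_add_eq_0)
    subgoal using e[of 3 0] by (simp add: e_def eq_neg_iff_add_eq_0)
    subgoal using e[of 3 1] by (simp add: e_def eq_neg_iff_add_eq_0)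
    subgoal using e[of 4 0] by (simp add: e_def)
    done
  \<comment> \<open>The freedom to add a multiple of the position vector is spent on making the
    first component of the field free of x.\<close>
  define k where "k = (\<lambda>i::nat. [[], [0, 0, - c 0 3, - c 0 1, - c 0 2, 0, 0],
     [0, c 3 0, c 1 2, c 1 0, c 1 1, c 2 0, c 2 1],
     [0, - b 3 0, - b 1 2, - b 1 0, - b 1 1, - b 2 0, - b 2 1]] ! i)"
  have "\<Omega> v = field_form (\<lambda>i j. k i ! j) v" for v
    unfolding vec3_eq_iff field_form_nth a b c E
    by (simp add: k_def quad_def algebra_simps power2_eq_square power3_eq_cube)
  then show ?thesis by blast
qed

text \<open>The inequality says that the linear part at the origin of the chart \<open>g\<close> is invertible.\<close>

definition nondegenerate_form :: "form3 \<Rightarrow> bool" where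
  "nondegenerate_form \<Omega> \<longleftrightarrow> (\<forall>g k. invertible g \<longrightarrow> pullback g \<Omega> = field_form k \<longrightarrow>
     k 1 3 = 0 \<longrightarrow> k 2 3 = 0 \<longrightarrow> (k 1 5 - k 3 3) * (k 2 4 - k 3 3) \<noteq> k 1 4 * k 2 5)"

text \<open>With Q the quadratic field, the chart shows the vector field with components
  \<open>Q1 - x * Q3\<close> and \<open>Q2 - y * Q3\<close> at z = 1. The value of Q3 at the origin
  is \<open>k 3 3\<close>, which is therefore subtracted on the diagonal.\<close>

lemma linear_part_field_form:
  assumes "pullback g \<Omega> = field_form k"
  shows "linear_part g \<Omega> (0, 0) = vector [vector [k 1 5 - k 3 3, k 1 4], vector [k 2 5, k 2 4 - k 3 3]]"
proof -
  have "deriv (\<lambda>t::complex. quad (k 1) (vector [t, 0, 1]) - t * quad (k 3) (vector [t, 0, 1])) 0 = k 1 5 - k 3 3"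
    unfolding quad_def vector_3 by (rule DERIV_imp_deriv) (auto intro!: derivative_eq_intros)
  moreover have "deriv (\<lambda>t::complex. quad (k 1) (vector [0, t, 1]) ) 0 = k 1 4"
    unfolding quad_def vector_3 by (rule DERIV_imp_deriv) (auto intro!: derivative_eq_intros)
  moreover have "deriv (\<lambda>t::complex. - quad (k 2) (vector [t, 0, 1])) 0 = - k 2 5"
    unfolding quad_def vector_3 by (rule DERIV_imp_deriv) (auto intro!: derivative_eq_intros)
  moreover have "deriv (\<lambda>t::complex. t * quad (k 3) (vector [0, t, 1]) - quad (k 2) (vector [0, t, 1])) 0 = k 3 3 - k 2 4"
    unfolding quad_def vector_3 by (rule DERIV_imp_deriv) (auto intro!: derivative_eq_intros)
  ultimately show ?thesis
    unfolding linear_part_def affine_form_def assms Let_def pd1_def pd2_def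
    by (simp add: field_form_nth vector_3)
qed

abbreviation "e3 \<equiv> vector [0, 0, 1] :: complex^3"

lemma chart_at_origin: "invertible g \<Longrightarrow> chart_at g (0, 0) (g *v e3)"
  unfolding chart_at_def by (auto intro!: exI[of _ 1])

lemma invertible_mult_eq_0:
  assumes "invertible (g::complex^3^3)" "g *v v = 0"
  shows "v = 0"
  using assms by (metis invertible_def matrix_vector_mul_assoc matrix_vector_mul_lid matrix_vector_mult_0_right)

lemma nondegenerate_formI:
  assumes "\<And>s. singular \<Omega> s \<Longrightarrow> nondegenerate_singularity \<Omega> s"
  shows "nondegenerate_form \<Omega>"
  unfolding nondegenerate_form_def
proof (intro allI impI)
  fix g k
  assume g: "invertible g" and k: "pullback g \<Omega> = field_form k" "k 1 3 = 0" "k 2 3 = 0"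
  have "field_form k e3 = 0"
    using k(2,3) by (simp add: vec3_eq_iff field_form_nth quad_def vector_3)
  then have "transpose g *v \<Omega> (g *v e3) = 0"
    unfolding k(1)[symmetric] pullback_def .
  then have "\<Omega> (g *v e3) = 0"
    using invertible_mult_eq_0[of "transpose g"] g by (simp add: invertible_det_nz det_transpose)
  moreover have "e3 $ 3 \<noteq> 0"
    by (simp add: vector_3)
  then have "g *v e3 \<noteq> 0"
    using invertible_mult_eq_0[OF g, of e3] by (metis zero_index)
  ultimately have "nondegenerate_singularity \<Omega> (g *v e3)"
    using assms unfolding singular_def by blast
  then have "invertible (linear_part g \<Omega> (0, 0))"
    using chart_at_origin[OF g] unfolding nondegenerate_singularity_def by blast
  then show "(k 1 5 - k 3 3) * (k 2 4 - k 3 3) \<noteq> k 1 4 * k 2 5"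
    unfolding linear_part_field_form[OF k(1)] by (simp add: invertible_det_nz det_2)
qed

lemma nondegenerate_form_pullback:
  assumes "nondegenerate_form \<Omega>" "invertible g"
  shows "nondegenerate_form (pullback g \<Omega>)"
  unfolding nondegenerate_form_def pullback_pullback
  using assms invertible_mult unfolding nondegenerate_form_def by blast

lemma coeff_of_double_zero:
  fixes a b c d e :: complex
  assumes "\<And>t. a * t + b * t^2 + c * t^3 = t^2 * (d + e * t)"
  shows "a = 0"
  using assms[of 1] assms[of "-1"] assms[of 2] by (simp add: power2_eq_square power3_eq_cube) algebra

text \<open>Move \<open>s\<close> to \<open>e3\<close> and \<open>m\<close> to \<open>e2\<close>.
  The pairing with \<open>m\<close> becomes the first component of the affine vector field; if it
  vanishes doubly along every line through the singularity, the first row of the linear part is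
  zero.\<close>

lemma degenerate_contradiction:
  assumes nd: "nondegenerate_form (field_form k0)" and indep: "crs s m \<noteq> 0"
    and s: "field_form k0 s = 0"
    and van: "\<And>w. \<exists>c d. \<forall>t. pair (field_form k0 (s + t *s w)) m = t^2 * (c + d * t)"
  shows False
proof -
  obtain r where r: "pair (crs s m) r \<noteq> 0"
    using frame_complete[OF indep] .
  define g where "g = frame r m s"
  have "pair (crs r m) s = - pair (crs s m) r"
    by (simp add: pair_eq algebra_simps)
  then have g: "invertible g"
    using r by (simp add: g_def invertible_frame_iff)
  obtain k where k: "pullback g (field_form k0) = field_form k"
    using pullback_field_form by blast
  have ge3: "g *v e3 = s" by (simp add: g_def frame_mult vector_3)
  have "field_form k e3 = 0"
    unfolding k[symmetric] pullback_def ge3 s by simp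
  then have k13: "k 1 3 = 0" "k 2 3 = 0"
    by (simp_all add: vec3_eq_iff field_form_nth quad_def vector_3)
  have "\<exists>c d. \<forall>t. field_form k (e3 + t *s w) $ 2 = t^2 * (c + d * t)" for w
  proof -
    have "field_form k (e3 + t *s w) $ 2 = pair (field_form k0 (s + t *s (g *v w))) m" for t
    proof -
      have "field_form k (e3 + t *s w) $ 2 = pair (pullback g (field_form k0) (e3 + t *s w)) (vector [0, 1, 0])"
        by (simp add: k pair_eq vector_3)
      also have "\<dots> = pair (field_form k0 (s + t *s (g *v w))) m"
        unfolding pullback_pair by (simp add: g_def frame_mult vector_3 algebra_simps)
      finally show ?thesis .
    qed
    then show ?thesis using van by simp
  qed
  note double = this
  obtain c d where cd: "\<And>t. field_form k (e3 + t *s vector [1, 0, 0]) $ 2 = t^2 * (c + d * t)"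
    using double by meson
  have "field_form k (e3 + t *s vector [1, 0, 0]) $ 2
      = (k 1 5 - k 3 3) * t + (k 1 1 - k 3 5) * t^2 + (- k 3 1) * t^3" for t
    using k13 by (simp add: field_form_nth quad_def vector_3 algebra_simps power2_eq_square power3_eq_cube)
  then have "k 1 5 - k 3 3 = 0"
    by (rule coeff_of_double_zero[OF trans[OF sym cd]])
  moreover obtain c d where cd: "\<And>t. field_form k (e3 + t *s vector [0, 1, 0]) $ 2 = t^2 * (c + d * t)"
    using double by meson
  have "field_form k (e3 + t *s vector [0, 1, 0]) $ 2 = k 1 4 * t + k 1 2 * t^2 + 0 * t^3" for t
    using k13 by (simp add: field_form_nth quad_def vector_3 algebra_simps power2_eq_square power3_eq_cube)
  then have "k 1 4 = 0"
    by (rule coeff_of_double_zero[OF trans[OF sym cd]])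
  moreover have "(k 1 5 - k 3 3) * (k 2 4 - k 3 3) \<noteq> k 1 4 * k 2 5"
    using nd[unfolded nondegenerate_form_def, rule_format, OF g k k13] .
  ultimately show False by simp
qed

text \<open>
  The tangency points of the line through \<open>v\<close> and \<open>w\<close> are the zeros of a binary quadratic form, of which
  \<open>h\<close> is a dehomogenization.
\<close>

definition tangency_disc :: "form3 \<Rightarrow> complex^3 \<Rightarrow> complex^3 \<Rightarrow> complex" where
  "tangency_disc \<Omega> v w = (let h = (\<lambda>y. pair (\<Omega> (v + y *s w)) w) in
     ((h 1 - h (- 1)) / 2)^2 - 4 * h 0 * ((h 1 + h (- 1)) / 2 - h 0))"

lemma tangency_disc_eq:
  assumes "\<And>y. pair (\<Omega> (v + y *s w)) w = A + B * y + C * y^2"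
  shows "tangency_disc \<Omega> v w = B^2 - 4 * A * C"
  unfolding tangency_disc_def assms by (simp add: Let_def power2_eq_square algebra_simps)

lemma tangency_disc_pullback:
  "tangency_disc (pullback g \<Omega>) v w = tangency_disc \<Omega> (g *v v) (g *v w)"
  by (simp add: tangency_disc_def pullback_pair vector_scalar_commute matrix_vector_right_distrib)

text \<open>Both pairings are determinants containing the point, the field and one of the two basis
  vectors. Expanding the point leaves a coordinate times the component of the field normal to the
  line, a binary quadratic form.\<close>

lemma field_form_line:
  fixes v w
  defines "n \<equiv> crs w v"
  shows "pair (field_form k (x *s v + y *s w)) w = x *
      (pair n (qfield k v) * x^2 + pair n (pfield k v w) * x * y + pair n (qfield k w) * y^2)"
    and "pair (field_form k (x *s v + y *s w)) v = - y *
      (pair n (qfield k v) * x^2 + pair n (pfield k v w) * x * y + pair n (qfield k w) * y^2)"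
  unfolding field_form_def qfield_comb n_def
  by (simp_all add: pair_eq power2_eq_square algebra_simps del: qfield_nth pfield_nth)

lemma tangency_disc_field_form:
  "tangency_disc (field_form k) v w =
     (pair (crs w v) (pfield k v w))^2 - 4 * pair (crs w v) (qfield k v) * pair (crs w v) (qfield k w)"
  by (rule tangency_disc_eq) (use field_form_line(1)[where x=1] in simp)

text \<open>The fourth power has two sources. The change of tangent vector multiplies each
  coefficient of the quadratic form by the determinant, hence the discriminant by its square; the
  substitution in the form contributes another square.\<close>

lemma tangency_disc_basis_change:
  "tangency_disc (field_form k) (a *s v + b *s w) (c *s v + d *s w)
     = (a * d - b * c)^4 * tangency_disc (field_form k) v w"
proof -
  define A B C where "A = pair (crs w v) (qfield k v)" and "B = pair (crs w v) (pfield k v w)"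
    and "C = pair (crs w v) (qfield k w)"
  define D where "D = a * d - b * c"
  have line: "pair (field_form k (x *s v + y *s w)) w = x * (A * x^2 + B * x * y + C * y^2)"
    "pair (field_form k (x *s v + y *s w)) v = - y * (A * x^2 + B * x * y + C * y^2)" for x y
    unfolding A_def B_def C_def by (rule field_form_line)+
  have "tangency_disc (field_form k) (a *s v + b *s w) (c *s v + d *s w)
      = (D * (2 * A * a * c + B * (a * d + b * c) + 2 * C * b * d))^2
        - 4 * (D * (A * a^2 + B * a * b + C * b^2)) * (D * (A * c^2 + B * c * d + C * d^2))"
  proof (rule tangency_disc_eq)
    fix y
    have "(a *s v + b *s w) + y *s (c *s v + d *s w) = (a + y * c) *s v + (b + y * d) *s w"
      by (simp add: vec3_eq_iff algebra_simps)
    then have "pair (field_form k ((a *s v + b *s w) + y *s (c *s v + d *s w))) (c *s v + d *s w)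
        = c * (- (b + y * d) * (A * (a + y * c)^2 + B * (a + y * c) * (b + y * d) + C * (b + y * d)^2))
        + d * ((a + y * c) * (A * (a + y * c)^2 + B * (a + y * c) * (b + y * d) + C * (b + y * d)^2))"
      by (simp only: pair_comb line)
    also have "\<dots> = D * (A * (a + y * c)^2 + B * (a + y * c) * (b + y * d) + C * (b + y * d)^2)"
      unfolding D_def by algebra
    also have "\<dots> = D * (A * a^2 + B * a * b + C * b^2)
        + D * (2 * A * a * c + B * (a * d + b * c) + 2 * C * b * d) * y
        + D * (A * c^2 + B * c * d + C * d^2) * y^2"
      by algebra
    finally show "pair (field_form k ((a *s v + b *s w) + y *s (c *s v + d *s w))) (c *s v + d *s w) =
       D * (A * a^2 + B * a * b + C * b^2)
        + D * (2 * A * a * c + B * (a * d + b * c) + 2 * C * b * d) * y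
        + D * (A * c^2 + B * c * d + C * d^2) * y^2" .
  qed
  also have "\<dots> = D^4 * (B^2 - 4 * A * C)"
    unfolding D_def by algebra
  also have "B^2 - 4 * A * C = tangency_disc (field_form k) v w"
    by (simp add: tangency_disc_field_form A_def B_def C_def)
  finally show ?thesis unfolding D_def .
qed


section \<open>Points all of whose lines are doubly tangent\<close>

text \<open>
  A point is called radial here if every line through it is doubly tangent; for a nondegenerate form
  it is then a radial singularity in the usual sense.
\<close>

definition radial :: "form3 \<Rightarrow> complex^3 \<Rightarrow> bool" where
  "radial \<Omega> m \<longleftrightarrow> m \<noteq> 0 \<and> (\<forall>w. tangency_disc \<Omega> m w = 0)"

lemma invertible_mult_eq_0_iff: "invertible (g::complex^3^3) \<Longrightarrow> g *v v = 0 \<longleftrightarrow> v = 0"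
  using invertible_mult_eq_0 by auto

lemma invertible_surj:
  assumes "invertible (g::complex^3^3)"
  obtains w where "v = g *v w"
  using assms by (metis invertible_def matrix_vector_mul_assoc matrix_vector_mul_lid)

lemma radial_pullback:
  assumes "invertible g"
  shows "radial (pullback g \<Omega>) m \<longleftrightarrow> radial \<Omega> (g *v m)"
  unfolding radial_def tangency_disc_pullback invertible_mult_eq_0_iff[OF assms]
  by (metis invertible_surj[OF assms])

lemma binary_quadratic_root:
  fixes a b c :: complex
  obtains x y where "x \<noteq> 0 \<or> y \<noteq> 0" "a * x^2 + b * x * y + c * y^2 = 0"
proof (cases "a = 0")
  case True
  then show thesis using that[of 1 0] by simp
next
  case False
  define x where "x = (- b + csqrt (b^2 - 4 * a * c)) / (2 * a)"
  have "2 * a * x + b = csqrt (b^2 - 4 * a * c)"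
    using False by (simp add: x_def)
  then have "(2 * a * x + b)^2 = b^2 - 4 * a * c"
    by simp
  then have "4 * a * (a * x^2 + b * x + c) = 0"
    by algebra
  then show thesis using that[of x 1] False by simp
qed

text \<open>
  If every line through the point were doubly tangent without the point being singular, the
  polar cubic of the point would be \<open>x (2cz + \<epsilon>x - \<delta>y)\<^sup>2\<close> up to a factor, and the foliation would
  have a degenerate singularity on the double line.
\<close>

lemma radial_e3_singular:
  assumes nd: "nondegenerate_form (field_form k)" and rad: "radial (field_form k) e3"
    and c1: "k 1 3 = 0"
  shows "k 2 3 = 0"
proof (rule ccontr)
  assume "k 2 3 \<noteq> 0"
  define c \<delta> \<epsilon> d where "c = k 2 3" and "\<delta> = k 1 5 - k 2 4" and "\<epsilon> = k 2 5" and "d = k 1 4"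
  define e a f b where "e = k 2 1" and "a = k 1 1 - k 2 6" and "f = k 1 6 - k 2 2" and "b = k 1 2"
  note defs = c_def \<delta>_def \<epsilon>_def d_def e_def a_def f_def b_def
  have c: "c \<noteq> 0" using \<open>k 2 3 \<noteq> 0\<close> by (simp add: c_def)
  have disc: "(d * y^2 + \<delta> * x * y - \<epsilon> * x^2)^2
     = - 4 * c * x * (b * y^3 + f * x * y^2 + a * x^2 * y - e * x^3)" for x y
  proof -
    have "tangency_disc (field_form k) e3 (vector [x, y, 0]) = 0"
      using rad unfolding radial_def by blast
    then have "(y * (k 1 4 * y + k 1 5 * x) - x * (k 2 4 * y + k 2 5 * x))^2
      = 4 * (y * k 1 3 - x * k 2 3) * (y * (k 1 1 * x^2 + k 1 2 * y^2 + k 1 6 * x * y) - x * (k 2 1 * x^2 + k 2 2 * y^2 + k 2 6 * x * y))"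
      unfolding tangency_disc_field_form by (simp add: pair_eq quad_def polar_def vector_3 algebra_simps)
    then show ?thesis unfolding c1 defs by algebra
  qed
  \<comment> \<open>The positional instantiation sets y = 1 and x = 0, where the right-hand side
    vanishes.\<close>
  have d: "d = 0" using disc[of 1 0] by simp
  have "(\<epsilon>^2 - 4 * c * e) + (4 * c * a - 2 * \<delta> * \<epsilon>) * y + (\<delta>^2 + 4 * c * f) * y^2 + (4 * c * b) * y^3 + 0 * y^4 = 0" for y
    using disc[of y 1] unfolding d mult_1_right power_one mult_zero_left add_0 by algebra
  from quartic_coeffs_eq_0[OF this] c
  have coeffs: "\<epsilon>^2 = 4 * c * e" "2 * \<delta> * \<epsilon> = 4 * c * a" "\<delta>^2 = - 4 * c * f" "b = 0"
    by (auto simp: add_eq_0_iff)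
  have polar_cubic: "4 * c * pair (field_form k v) e3 = v$1 * (2 * c * v$3 + \<epsilon> * v$1 - \<delta> * v$2)^2" for v
  proof -
    have "pair (field_form k v) e3 = e * (v$1)^3 - a * (v$1)^2 * v$2 - f * v$1 * (v$2)^2 - b * (v$2)^3
       + v$3 * (\<epsilon> * (v$1)^2 - \<delta> * v$1 * v$2 - d * (v$2)^2) + c * v$1 * (v$3)^2"
      using c1 unfolding defs
      by (simp add: pair_eq field_form_nth vector_3 quad_def power2_eq_square power3_eq_cube algebra_simps)
    then show ?thesis
      using coeffs d by algebra
  qed
  \<comment> \<open>A basis of the double line \<open>2 c z + \<epsilon> x - \<delta> y = 0\<close>
    of the polar cubic.\<close>
  define u w where "u = (vector [1, 0, - \<epsilon> / (2 * c)] :: complex^3)" and "w = (vector [0, 1, \<delta> / (2 * c)] :: complex^3)"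
  define P Q R where "P = (\<lambda>i. quad (k i) u)" and "Q = (\<lambda>i. polar (k i) u w)" and "R = (\<lambda>i. quad (k i) w)"
  have quad_uw: "quad (k i) (x *s u + y *s w) = x^2 * P i + x * y * Q i + y^2 * R i" for i x y
    by (simp add: quad_comb P_def Q_def R_def)
  have uw: "(x *s u + y *s w) $ 1 = x" "(x *s u + y *s w) $ 2 = y"
    "(x *s u + y *s w) $ 3 = (\<delta> * y - \<epsilon> * x) / (2 * c)" for x y
    by (simp_all add: u_def w_def vector_3 diff_divide_distrib mult.commute)
  have polar_line: "2 * c * (x *s u + y *s w) $ 3 + \<epsilon> * (x *s u + y *s w) $ 1 - \<delta> * (x *s u + y *s w) $ 2 = 0" for x y
    unfolding uw using c by simp
  have "x * (x^2 * P 2 + x * y * Q 2 + y^2 * R 2) = y * (x^2 * P 1 + x * y * Q 1 + y^2 * R 1)" for x y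
  proof -
    have "4 * c * pair (field_form k (x *s u + y *s w)) e3 = 0"
      unfolding polar_cubic polar_line by simp
    then have "pair (field_form k (x *s u + y *s w)) e3 = 0"
      using c by simp
    moreover have "pair (field_form k (x *s u + y *s w)) e3 =
       x * (x^2 * P 2 + x * y * Q 2 + y^2 * R 2) - y * (x^2 * P 1 + x * y * Q 1 + y^2 * R 1)"
      using uw(1,2)[of x y] quad_uw by (simp add: pair_eq field_form_nth vector_3)
    ultimately show ?thesis by simp
  qed
  note eq = this[of 1, unfolded mult_1_left power_one]
  have "P 2 + (Q 2 - P 1) * y + (R 2 - Q 1) * y^2 + (- R 1) * y^3 + 0 * y^4 = 0" for y
    using eq[of y] by algebra
  from quartic_coeffs_eq_0[OF this] have PQR: "P 2 = 0" "Q 2 = P 1" "R 2 = Q 1" "R 1 = 0"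
    by auto
  \<comment> \<open>On the double line the first two components of the field are (x, y) times the
    linear form \<open>x * P 1 + y * Q 1\<close>. The quadratic form here is the third component
    minus the third coordinate times that linear form; at a root, the field is parallel to the
    position vector.\<close>
  obtain x y where xy: "x \<noteq> 0 \<or> y \<noteq> 0" "(P 3 + \<epsilon> / (2 * c) * P 1) * x^2
      + (Q 3 + \<epsilon> / (2 * c) * Q 1 - \<delta> / (2 * c) * P 1) * x * y + (R 3 - \<delta> / (2 * c) * Q 1) * y^2 = 0"
    by (rule binary_quadratic_root)
  define s where "s = x *s u + y *s w"
  have s: "s$1 = x" "s$2 = y" "s$3 = (\<delta> * y - \<epsilon> * x) / (2 * c)"
    unfolding s_def by (rule uw)+
  have L: "quad (k 1) s = x * (x * P 1 + y * Q 1)" "quad (k 2) s = y * (x * P 1 + y * Q 1)"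
    unfolding s_def quad_uw PQR by algebra+
  have L3: "quad (k 3) s = s$3 * (x * P 1 + y * Q 1)"
  proof -
    have "quad (k 3) s = x^2 * P 3 + x * y * Q 3 + y^2 * R 3"
      unfolding s_def quad_uw ..
    moreover have "s$3 = \<delta> / (2 * c) * y - \<epsilon> / (2 * c) * x"
      unfolding s by (simp add: diff_divide_distrib)
    ultimately show ?thesis using xy(2) by algebra
  qed
  have "field_form k s = 0"
    using L L3 s(1,2) by (simp add: vec3_eq_iff field_form_nth)
  moreover have "crs s e3 \<noteq> 0"
    using xy(1) by (auto simp: vec3_eq_iff vector_3 s)
  moreover have "\<exists>p q. \<forall>t. pair (field_form k (s + t *s v)) e3 = t^2 * (p + q * t)" for v
  proof (intro exI allI)
    fix t
    define h where "h = 2 * c * v$3 + \<epsilon> * v$1 - \<delta> * v$2"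
    have h0: "2 * c * s$3 + \<epsilon> * s$1 - \<delta> * s$2 = 0"
      unfolding s_def by (rule polar_line)
    have "4 * c * pair (field_form k (s + t *s v)) e3
       = (s$1 + t * v$1) * (2 * c * (s$3 + t * v$3) + \<epsilon> * (s$1 + t * v$1) - \<delta> * (s$2 + t * v$2))^2"
      by (simp add: polar_cubic)
    also have "\<dots> = t^2 * (h^2 * s$1 + h^2 * v$1 * t)"
      using h0 unfolding h_def by algebra
    finally show "pair (field_form k (s + t *s v)) e3 = t^2 * (h^2 * s$1 / (4 * c) + h^2 * v$1 / (4 * c) * t)"
      using c by (simp add: field_simps)
  qed
  ultimately show False
    using degenerate_contradiction[OF nd] by blast
qed

text \<open>If \<open>m\<close> were not singular, \<open>m\<close> and the field at
  \<open>m\<close> would be independent. A frame sending \<open>e3\<close> to \<open>m\<close> and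
  \<open>e2\<close> to the field at \<open>m\<close> achieves the normalization
  \<open>k' 1 3 = 0\<close> of \<open>radial_e3_singular\<close>.\<close>

lemma radial_singular:
  assumes nd: "nondegenerate_form (field_form k)" and rad: "radial (field_form k) m"
  shows "field_form k m = 0"
proof (rule ccontr)
  assume "field_form k m \<noteq> 0"
  then have "crs m (qfield k m) \<noteq> 0" by (simp add: field_form_def)
  then obtain r where r: "pair (crs m (qfield k m)) r \<noteq> 0"
    by (rule frame_complete)
  define g where "g = frame r (qfield k m) m"
  have "pair (crs r (qfield k m)) m = - pair (crs m (qfield k m)) r"
    by (simp add: pair_eq algebra_simps del: qfield_nth)
  then have g: "invertible g"
    using r by (simp add: g_def invertible_frame_iff)
  obtain k' where k': "pullback g (field_form k) = field_form k'"
    using pullback_field_form by blast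
  have ge3: "g *v e3 = m" "g *v vector [1, 0, 0] = r" "g *v vector [0, 1, 0] = qfield k m"
    by (simp_all add: g_def frame_mult vector_3)
  have nd': "nondegenerate_form (field_form k')"
    using nondegenerate_form_pullback[OF nd g] k' by simp
  have rad': "radial (field_form k') e3"
    using rad radial_pullback[OF g, of "field_form k" e3] unfolding k' ge3 by simp
  have "k' 1 3 = pair (pullback g (field_form k) e3) (vector [0, 1, 0])"
    by (simp add: k' pair_eq field_form_nth vector_3 quad_def)
  also have "\<dots> = 0"
    unfolding pullback_pair ge3 by (simp add: field_form_def pair_eq algebra_simps del: qfield_nth)
  finally have "k' 2 3 = 0"
    using radial_e3_singular[OF nd' rad'] by blast
  have "pair (field_form k m) r = pair (pullback g (field_form k) e3) (vector [1, 0, 0])"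
    unfolding pullback_pair ge3 ..
  also have "\<dots> = - k' 2 3"
    by (simp add: k' pair_eq field_form_nth vector_3 quad_def)
  finally show False
    using r \<open>k' 2 3 = 0\<close> by (simp add: field_form_def)
qed

text \<open>On a line through \<open>m\<close> the tangency form has coefficients \<open>A\<close>,
  \<open>B\<close>, \<open>C\<close>. Singularity of \<open>m\<close> gives \<open>A = 0\<close>,
  and then the vanishing discriminant is \<open>B^2\<close>. Only \<open>C\<close> survives, so the
  polar cubic of \<open>m\<close> is a cone with vertex \<open>m\<close>.\<close>

lemma radial_invariance:
  assumes nd: "nondegenerate_form (field_form k)" and rad: "radial (field_form k) m"
  shows "pair (field_form k (w + t *s m)) m = pair (field_form k w) m"
proof -
  define A B C where "A = pair (crs w m) (qfield k m)" and "B = pair (crs w m) (pfield k m w)"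
    and "C = pair (crs w m) (qfield k w)"
  have line: "pair (field_form k (x *s m + y *s w)) m = - y * (A * x^2 + B * x * y + C * y^2)" for x y
    unfolding A_def B_def C_def by (rule field_form_line)
  have "A = pair w (field_form k m)"
    unfolding A_def field_form_def by (simp add: pair_eq algebra_simps del: qfield_nth)
  then have "A = 0"
    using radial_singular[OF nd rad] by (simp add: pair_eq)
  moreover have "B^2 - 4 * A * C = 0"
    using rad unfolding radial_def A_def B_def C_def tangency_disc_field_form[symmetric] by blast
  ultimately have "A = 0" "B = 0" by auto
  then show ?thesis
    using line[of t 1] line[of 0 1] by (simp add: add.commute)
qed

lemma radial_scale:
  assumes "c \<noteq> 0" "radial (field_form k) m"
  shows "radial (field_form k) (c *s m)"
proof -
  have "tangency_disc (field_form k) (c *s m + 0 *s w) (0 *s m + 1 *s w) = 0" for w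
    using assms(2) unfolding tangency_disc_basis_change radial_def by simp
  then show ?thesis
    using assms unfolding radial_def by simp
qed

text \<open>The coefficients of positive powers of \<open>t\<close> in the polar cubic must vanish.
  In the chart this makes the linear part the scalar \<open>k 1 5 - k 3 3\<close>, which
  nondegeneracy keeps nonzero.\<close>

lemma radial_e3_coeffs:
  assumes nd: "nondegenerate_form (field_form k)" and rad: "radial (field_form k) e3"
  shows "k 1 3 = 0" "k 2 3 = 0" "k 1 4 = 0" "k 2 5 = 0" "k 2 4 = k 1 5" "k 1 5 \<noteq> k 3 3"
proof -
  have inv: "pair (field_form k (w + t *s e3)) e3 = pair (field_form k w) e3" for w t
    by (rule radial_invariance[OF nd rad])
  have c: "x * (k 2 3 * t^2 + k 2 4 * y * t + k 2 5 * x * t) = y * (k 1 3 * t^2 + k 1 4 * y * t + k 1 5 * x * t)" for x y t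
    using inv[of "vector [x, y, 0]" t]
    by (simp add: pair_eq field_form_nth vector_3 quad_def) algebra
  have 1: "k 1 3 = 0" "k 1 4 = 0"
    using c[of 0 1 1] c[of 0 1 "-1"] by (simp_all add: eq_neg_iff_add_eq_0)
  have 2: "k 2 3 = 0" "k 2 5 = 0"
    using c[of 1 1 0] c[of 1 "-1" 0] by simp_all
  show "k 1 3 = 0" "k 2 3 = 0" "k 1 4 = 0" "k 2 5 = 0" by fact+
  show eq: "k 2 4 = k 1 5"
    using c[of 1 1 1] 1 2 by simp
  moreover have "invertible (mat 1 :: complex^3^3)" "pullback (mat 1) (field_form k) = field_form k"
    by (simp_all add: invertible_det_nz pullback_def fun_eq_iff transpose_mat)
  then have "(k 1 5 - k 3 3) * (k 2 4 - k 3 3) \<noteq> k 1 4 * k 2 5"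
    using nd 1 2 unfolding nondegenerate_form_def by blast
  ultimately show "k 1 5 \<noteq> k 3 3"
    using 1 by auto
qed


text \<open>The discriminant vanishes to order exactly one as a line moves off \<open>s\<close>;
  \<open>lin_square_not_dvd\<close> uses this. With \<open>s\<close> at \<open>e3\<close>, the
  product of the outer coefficients starts with
  \<open>(k' 3 3 - k' 1 5) * \<theta> * \<nu> x y * t\<close>, whereas the middle coefficient is
  O(t) and enters squared. The condition on \<open>crs w s\<close> puts the line in the (p, q)
  chart.\<close>

lemma radial_tangency_order:
  assumes nd: "nondegenerate_form (field_form k)" and rad: "radial (field_form k) s"
    and s: "crs s (vector [0, 1, 0]) \<noteq> 0"
  obtains r w \<kappa> where "crs w s $ 2 \<noteq> 0" "\<kappa> \<noteq> 0"
    "((\<lambda>t. tangency_disc (field_form k) (s + t *s r) w) has_field_derivative \<kappa>) (at 0)"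
proof -
  have "s \<noteq> 0" using rad by (simp add: radial_def)
  then obtain g1 g2 where "invertible (frame g1 g2 s)" by (rule frame_at_point)
  moreover define g where "g = frame g1 g2 s"
  ultimately have g: "invertible g" by simp
  obtain k' where k': "pullback g (field_form k) = field_form k'"
    using pullback_field_form by blast
  have ge3: "g *v e3 = s"
    by (simp_all add: g_def frame_mult vector_3)
  have nd': "nondegenerate_form (field_form k')"
    using nondegenerate_form_pullback[OF nd g] k' by simp
  have rad': "radial (field_form k') e3"
    using rad radial_pullback[OF g, of "field_form k" e3] unfolding k' ge3 by simp
  note co = radial_e3_coeffs[OF nd' rad']
  \<comment> \<open>The linear form \<open>j1 * x + j2 * y\<close> decides whether the line joining
    \<open>s\<close> to the image of (x, y, 0) lies in the (p, q) chart. The direction (x, y) has to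
    avoid its zeros as well as those of the cubic \<nu>.\<close>
  define j1 j2 where "j1 = crs g1 s $ 2" and "j2 = crs g2 s $ 2"
  have j: "crs (g *v vector [x, y, 0]) s $ 2 = j1 * x + j2 * y" for x y
    by (simp add: g_def frame_mult vector_3 j1_def j2_def algebra_simps)
  have j12: "j1 \<noteq> 0 \<or> j2 \<noteq> 0"
  proof (rule ccontr)
    assume "\<not> (j1 \<noteq> 0 \<or> j2 \<noteq> 0)"
    then have j0: "j1 = 0" "j2 = 0" by auto
    have "crs (g *v w) s $ 2 = w$1 * j1 + w$2 * j2" for w
      by (simp add: g_def frame_mult j1_def j2_def algebra_simps)
    then have *: "crs v s $ 2 = 0" for v
      using invertible_surj[OF g, of v] j0 by (metis add.right_neutral mult_zero_right)
    have "s$1 = 0" "s$3 = 0"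
      using *[of "vector [0, 0, 1]"] *[of "vector [1, 0, 0]"] by (simp_all add: vector_3)
    with s show False by (simp add: vec3_eq_iff vector_3)
  qed
  define n0 n1 n2 n3 where "n0 = - k' 2 1" and "n1 = k' 1 1 - k' 2 6" and "n2 = k' 1 6 - k' 2 2"
    and "n3 = k' 1 2"
  define \<nu> where "\<nu> = (\<lambda>x y. n0 * x^3 + n1 * x^2 * y + n2 * x * y^2 + n3 * y^3)"
  have polar_cubic: "pair (field_form k' v) e3 = - \<nu> (v$1) (v$2)" for v
    using co unfolding \<nu>_def n0_def n1_def n2_def n3_def
    by (simp add: pair_eq field_form_nth vector_3 quad_def power2_eq_square power3_eq_cube algebra_simps)
  have \<nu>_nz: "\<exists>x y. \<nu> x y \<noteq> 0"
  proof (rule ccontr)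
    assume "\<not> (\<exists>x y. \<nu> x y \<noteq> 0)"
    then have 0: "\<nu> x y = 0" for x y by blast
    \<comment> \<open>The equation for a singular point (1, 0, z) on y = 0. If \<nu> vanished
      identically, the polar cubic of \<open>e3\<close> would be zero and this point would be
      degenerate.\<close>
    obtain z where z: "(k' 1 5 - k' 3 3) * z^2 + (k' 1 1 - k' 3 5) * z - k' 3 1 = 0"
    proof -
      have "\<not> constant (poly [:- k' 3 1, k' 1 1 - k' 3 5, k' 1 5 - k' 3 3:])"
        using co(6) by (simp add: constant_degree)
      then obtain z where "poly [:- k' 3 1, k' 1 1 - k' 3 5, k' 1 5 - k' 3 3:] z = 0"
        using fundamental_theorem_of_algebra by blast
      then show thesis by (intro that[of z]) (simp add: power2_eq_square algebra_simps)
    qed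
    have "k' 2 1 = 0" using 0[of 1 0] by (simp add: \<nu>_def n0_def)
    then have "field_form k' (vector [1, 0, z]) = 0"
      using z co by (simp add: vec3_eq_iff field_form_nth quad_def vector_3 power2_eq_square algebra_simps)
    moreover have "crs (vector [1, 0, z]) e3 \<noteq> 0"
      by (simp add: vec3_eq_iff vector_3)
    moreover have "\<exists>c d. \<forall>t. pair (field_form k' (vector [1, 0, z] + t *s w)) e3 = t^2 * (c + d * t)" for w
      unfolding polar_cubic 0 by (intro exI[of _ 0]) simp
    ultimately show False
      using degenerate_contradiction[OF nd'] by blast
  qed
  have "\<exists>x y. \<nu> x y * (j1 * x + j2 * y) \<noteq> 0"
  proof (rule ccontr)
    assume "\<not> (\<exists>x y. \<nu> x y * (j1 * x + j2 * y) \<noteq> 0)"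
    then have "\<nu> 1 y * (j1 * 1 + j2 * y) = 0" for y by blast
    note 0 = this[unfolded \<nu>_def mult_1_right power_one]
    have "n0 * j1 + (n0 * j2 + n1 * j1) * y + (n1 * j2 + n2 * j1) * y^2 + (n2 * j2 + n3 * j1) * y^3
        + n3 * j2 * y^4 = 0" for y
      using 0[of y] by algebra
    from quartic_coeffs_eq_0[OF this]
    have eqs: "n0 * j1 = 0" "n0 * j2 + n1 * j1 = 0" "n1 * j2 + n2 * j1 = 0" "n2 * j2 + n3 * j1 = 0" "n3 * j2 = 0"
      by auto
    have "n0 = 0 \<and> n1 = 0 \<and> n2 = 0 \<and> n3 = 0"
    proof (cases "j1 = 0")
      case True
      with j12 eqs show ?thesis by simp
    next
      case False
      with eqs have "n0 = 0" by simp
      with False eqs have "n1 = 0" by simp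
      with False eqs have "n2 = 0" by simp
      with False eqs have "n3 = 0" by simp
      show ?thesis by (intro conjI) fact+
    qed
    with \<nu>_nz show False by (simp add: \<nu>_def)
  qed
  then obtain x y where xy: "\<nu> x y \<noteq> 0" "j1 * x + j2 * y \<noteq> 0" by auto
  then have "x \<noteq> 0 \<or> y \<noteq> 0" by auto
  then obtain r1 r2 where \<theta>: "x * r2 - y * r1 \<noteq> 0"
    by (metis diff_0_right diff_0 mult_zero_right mult.right_neutral neg_equal_0_iff_equal)
  define \<theta> where "\<theta> = x * r2 - y * r1"
  define v where "v = (\<lambda>t::complex. vector [t * r1, t * r2, 1] :: complex^3)"
  define w where "w = (vector [x, y, 0] :: complex^3)"
  define a2 a3 b1 b2 c1 where "a2 = y * quad (k' 1) (vector [r1, r2, 0]) - x * quad (k' 2) (vector [r1, r2, 0])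
      + \<theta> * (k' 3 4 * r2 + k' 3 5 * r1)" and "a3 = \<theta> * quad (k' 3) (vector [r1, r2, 0])"
    and "b1 = y * polar (k' 1) (vector [r1, r2, 0]) w - x * polar (k' 2) (vector [r1, r2, 0]) w
      + \<theta> * (k' 3 4 * y + k' 3 5 * x)" and "b2 = \<theta> * polar (k' 3) (vector [r1, r2, 0]) w"
    and "c1 = \<theta> * quad (k' 3) w"
  have disc: "tangency_disc (field_form k') (v t) w
      = (b1 * t + b2 * t^2)^2 - 4 * ((k' 3 3 - k' 1 5) * \<theta> * t + a2 * t^2 + a3 * t^3) * (\<nu> x y + c1 * t)" for t
  proof -
    have n: "crs w (v t) $ 1 = y" "crs w (v t) $ 2 = - x" "crs w (v t) $ 3 = t * \<theta>"
      by (simp_all add: w_def v_def vector_3 \<theta>_def algebra_simps)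
    have 1: "pair (crs w (v t)) (pfield k' (v t) w) = b1 * t + b2 * t^2"
      unfolding pair_eq n pfield_nth using co(1-5)
      by (simp add: b1_def b2_def polar_def v_def w_def vector_3 power2_eq_square algebra_simps)
    have 2: "pair (crs w (v t)) (qfield k' (v t)) = (k' 3 3 - k' 1 5) * \<theta> * t + a2 * t^2 + a3 * t^3"
      unfolding pair_eq n qfield_nth using co(1-5)
      by (simp add: a2_def a3_def quad_def v_def vector_3 power2_eq_square power3_eq_cube \<theta>_def algebra_simps)
    have 3: "pair (crs w (v t)) (qfield k' w) = \<nu> x y + c1 * t"
      unfolding pair_eq n qfield_nth using co(1-5)
      by (simp add: c1_def \<nu>_def n0_def n1_def n2_def n3_def quad_def w_def vector_3
          power2_eq_square power3_eq_cube algebra_simps)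
    show ?thesis unfolding tangency_disc_field_form 1 2 3 ..
  qed
  have gv: "g *v v t = s + t *s (g *v vector [r1, r2, 0])" for t
    by (simp add: v_def g_def frame_mult vector_3 vec3_eq_iff algebra_simps)
  have "((\<lambda>t. (b1 * t + b2 * t^2)^2 - 4 * ((k' 3 3 - k' 1 5) * \<theta> * t + a2 * t^2 + a3 * t^3) * (\<nu> x y + c1 * t))
      has_field_derivative (- 4 * ((k' 3 3 - k' 1 5) * \<theta> * \<nu> x y))) (at 0)"
    by (auto intro!: derivative_eq_intros)
  then have "((\<lambda>t. tangency_disc (field_form k) (s + t *s (g *v vector [r1, r2, 0])) (g *v w))
      has_field_derivative (- 4 * ((k' 3 3 - k' 1 5) * \<theta> * \<nu> x y))) (at 0)"
    unfolding disc[symmetric] k'[symmetric] tangency_disc_pullback gv .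
  moreover have "- 4 * ((k' 3 3 - k' 1 5) * \<theta> * \<nu> x y) \<noteq> 0"
    using co(6) \<theta> xy(1) by (simp add: \<theta>_def)
  moreover have "crs (g *v w) s $ 2 \<noteq> 0"
    unfolding w_def j by (rule xy)
  ultimately show thesis using that by blast
qed

section \<open>Finiteness of the singular set\<close>

lemma continuous_on_vec_nth3: "continuous_on A (\<lambda>v::complex^3. v $ i)"
  by (intro continuous_intros)

text \<open>In place of an inverse function theorem: the equations of a singular point near
  \<open>e3\<close> are written as a linear system in \<open>v$1\<close>, \<open>v$2\<close> whose
  coefficients depend on \<open>v\<close>. Its determinant \<open>D\<close> is the Jacobian at
  \<open>e3\<close>, hence nonzero nearby, and the system has only the zero solution.\<close>

lemma singularity_isolated:
  assumes nd: "nondegenerate_form (field_form k)" and s: "s \<noteq> 0" "field_form k s = 0"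
  shows "\<exists>U. open U \<and> s \<in> U \<and> (\<forall>v\<in>U. field_form k v = 0 \<longrightarrow> (\<exists>c. v = c *s s))"
proof -
  obtain g1 g2 where "invertible (frame g1 g2 s)" using s(1) by (rule frame_at_point)
  moreover define g where "g = frame g1 g2 s"
  ultimately have g: "invertible g" by simp
  then obtain h where h: "g ** h = mat 1" "h ** g = mat 1"
    unfolding invertible_def by blast
  obtain k' where k': "pullback g (field_form k) = field_form k'"
    using pullback_field_form by blast
  have ge3: "g *v e3 = s"
    by (simp_all add: g_def frame_mult vector_3)
  have gh: "g *v (h *v v) = v" "h *v (g *v v) = v" for v
    by (simp_all add: matrix_vector_mul_assoc h)
  have "field_form k' e3 = 0"
    unfolding k'[symmetric] pullback_def ge3 s by simp
  then have k'0: "k' 1 3 = 0" "k' 2 3 = 0"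
    by (simp_all add: vec3_eq_iff field_form_nth quad_def vector_3)
  define D where "D = (\<lambda>v. (v$3 * (k' 1 5 * v$3 + k' 1 1 * v$1 + k' 1 6 * v$2) - quad (k' 3) v)
     * (v$3 * (k' 2 4 * v$3 + k' 2 2 * v$2 + k' 2 6 * v$1) - quad (k' 3) v)
     - (v$3 * (k' 1 4 * v$3 + k' 1 2 * v$2)) * (v$3 * (k' 2 5 * v$3 + k' 2 1 * v$1)))"
  have det: "D e3 \<noteq> 0"
    using nd g k' k'0 unfolding nondegenerate_form_def D_def
    by (simp add: vector_3 quad_def)
  have D: "v$1 = 0 \<and> v$2 = 0" if "field_form k' v = 0" "D v \<noteq> 0" for v
  proof -
    define a b c d where "a = v$3 * (k' 1 5 * v$3 + k' 1 1 * v$1 + k' 1 6 * v$2) - quad (k' 3) v"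
      and "b = v$3 * (k' 1 4 * v$3 + k' 1 2 * v$2)"
      and "c = v$3 * (k' 2 5 * v$3 + k' 2 1 * v$1)"
      and "d = v$3 * (k' 2 4 * v$3 + k' 2 2 * v$2 + k' 2 6 * v$1) - quad (k' 3) v"
    have "v$3 * quad (k' 1) v - v$1 * quad (k' 3) v = 0" "v$3 * quad (k' 2) v - v$2 * quad (k' 3) v = 0"
      using that(1) by (simp_all add: vec3_eq_iff field_form_nth)
    then have ab: "a * v$1 + b * v$2 = 0" and cd: "c * v$1 + d * v$2 = 0"
      unfolding a_def b_def c_def d_def quad_def[of "k' 1"] quad_def[of "k' 2"] k'0 by algebra+
    have "a * d - b * c \<noteq> 0"
      using that(2) unfolding D_def a_def b_def c_def d_def .
    moreover have "(a * d - b * c) * v$1 = 0" "(a * d - b * c) * v$2 = 0"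
      using ab cd by algebra+
    ultimately show ?thesis by simp
  qed
  define U where "U = {v. D (h *v v) \<noteq> 0}"
  have "open U"
    unfolding U_def D_def quad_def matrix_vector_3
    by (intro open_Collect_neq continuous_intros continuous_on_vec_nth3)
  moreover have "s \<in> U"
    unfolding U_def using det gh(2)[of e3] ge3 by simp
  moreover have "\<exists>c. v = c *s s" if "v \<in> U" "field_form k v = 0" for v
  proof -
    have "field_form k' (h *v v) = 0"
      unfolding k'[symmetric] pullback_def gh that by simp
    then have "(h *v v)$1 = 0" "(h *v v)$2 = 0"
      using D that(1) unfolding U_def by blast+
    then have "h *v v = (h *v v)$3 *s e3"
      by (simp add: vec3_eq_iff vector_3)
    then have "v = (h *v v)$3 *s s"
      by (metis gh(1) ge3 vector_scalar_commute)
    then show ?thesis by blast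
  qed
  ultimately show ?thesis by blast
qed

lemma field_form_scale: "field_form k (c *s v) = c^3 *s field_form k v"
  by (simp add: vec3_eq_iff field_form_nth quad_def power2_eq_square power3_eq_cube algebra_simps)

text \<open>The singular vectors of norm 1 form a compact set. Finitely many of the isolating
  neighbourhoods cover it, and each contains only multiples of one singular vector.\<close>

lemma finite_singularities:
  assumes nd: "nondegenerate_form (field_form k)"
  obtains S where "finite S" "0 \<notin> S" "\<And>v. v \<noteq> 0 \<Longrightarrow> field_form k v = 0 \<Longrightarrow> \<exists>s\<in>S. \<exists>c. v = c *s s"
proof -
  define K where "K = {v. norm v = 1 \<and> field_form k v = 0}"
  have "K = sphere 0 1 \<inter> {v. field_form k v $ 1 = 0 \<and> field_form k v $ 2 = 0 \<and> field_form k v $ 3 = 0}"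
    unfolding K_def by (auto simp: vec3_eq_iff dist_norm)
  moreover have "closed {v. field_form k v $ 1 = 0 \<and> field_form k v $ 2 = 0 \<and> field_form k v $ 3 = 0}"
    unfolding field_form_nth quad_def
    by (intro closed_Collect_conj closed_Collect_eq continuous_intros continuous_on_vec_nth3)
  ultimately have "compact K"
    by (simp add: compact_Int_closed)
  have "\<exists>U. open U \<and> s \<in> U \<and> (\<forall>v\<in>U. field_form k v = 0 \<longrightarrow> (\<exists>c. v = c *s s))" if "s \<in> K" for s
    using that singularity_isolated[OF nd, of s] unfolding K_def by force
  then obtain U where U: "\<And>s. s \<in> K \<Longrightarrow> open (U s) \<and> s \<in> U s \<and> (\<forall>v\<in>U s. field_form k v = 0 \<longrightarrow> (\<exists>c. v = c *s s))"
    by metis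
  have "\<forall>s\<in>K. open (U s)" "K \<subseteq> (\<Union>s\<in>K. U s)"
    using U by auto
  then obtain S where S: "S \<subseteq> K" "finite S" "K \<subseteq> (\<Union>s\<in>S. U s)"
    using compactE_image[OF \<open>compact K\<close>, of K U] by metis
  have "\<exists>s\<in>S. \<exists>c. v = c *s s" if v: "v \<noteq> 0" "field_form k v = 0" for v
  proof -
    define a where "a = complex_of_real (inverse (norm v))"
    have a: "a \<noteq> 0" using v by (simp add: a_def)
    have "a *s v = inverse (norm v) *\<^sub>R v"
      unfolding vec_eq_iff vector_scaleR_component by (simp add: a_def scaleR_conv_of_real)
    then have "norm (a *s v) = 1" using v by simp
    then have "a *s v \<in> K"
      using v by (simp add: K_def field_form_scale)
    then obtain s c where s: "s \<in> S" "a *s v = c *s s"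
      using S U unfolding K_def by blast
    have "v = inverse a *s (a *s v)" using a by (simp add: vec_eq_iff)
    then have "v = (inverse a * c) *s s" unfolding s by (simp add: vec_eq_iff)
    then show ?thesis using s by blast
  qed
  moreover have "0 \<notin> S" using S unfolding K_def by auto
  ultimately show thesis using that S by blast
qed

section \<open>Relative position of radial points\<close>

lemma radial_e1_coeffs:
  assumes nd: "nondegenerate_form (field_form k)" and rad: "radial (field_form k) (vector [1, 0, 0])"
  shows "k 3 1 = 0" "k 3 6 = 0" "k 2 1 = 0" "k 2 5 = 0" "k 3 5 = k 2 6"
proof -
  have c: "y * (k 3 1 * t^2 + k 3 5 * t * z + k 3 6 * t * y) = z * (k 2 1 * t^2 + k 2 5 * t * z + k 2 6 * t * y)" for t y z
    using radial_invariance[OF nd rad, of "vector [0, y, z]" t]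
    by (simp add: pair_eq field_form_nth vector_3 quad_def) algebra
  show k: "k 3 1 = 0" "k 3 6 = 0" "k 2 1 = 0" "k 2 5 = 0"
    using c[of 1 1 0] c[of 1 "-1" 0] c[of 0 1 1] c[of 0 "-1" 1] by simp_all
  show "k 3 5 = k 2 6"
    using c[of 1 1 1] k by simp
qed

lemma radial_e2_coeffs:
  assumes nd: "nondegenerate_form (field_form k)" and rad: "radial (field_form k) (vector [0, 1, 0])"
  shows "k 3 2 = 0" "k 3 6 = 0" "k 1 2 = 0" "k 1 4 = 0" "k 1 6 = k 3 4"
proof -
  have c: "z * (k 1 2 * t^2 + k 1 4 * t * z + k 1 6 * t * x) = x * (k 3 2 * t^2 + k 3 4 * t * z + k 3 6 * t * x)" for t x z
    using radial_invariance[OF nd rad, of "vector [x, 0, z]" t]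
    by (simp add: pair_eq field_form_nth vector_3 quad_def) algebra
  show k: "k 3 2 = 0" "k 3 6 = 0" "k 1 2 = 0" "k 1 4 = 0"
    using c[of 1 1 0] c[of 1 "-1" 0] c[of 0 1 1] c[of 0 "-1" 1] by simp_all
  show "k 1 6 = k 3 4"
    using c[of 1 1 1] k by simp
qed

text \<open>Scaling makes the three points (1, 0, 0), (0, 1, 0) and (1, 1, 0). Their radial
  conditions force \<open>k' 1 1 = k' 3 5\<close>, and this difference is, up to sign, the scalar
  linear part at (1, 0, 0), which therefore vanishes.\<close>

lemma radial_noncollinear:
  assumes nd: "nondegenerate_form (field_form k)"
    and rad: "radial (field_form k) s1" "radial (field_form k) s2" "radial (field_form k) (a *s s1 + b *s s2)"
    and indep: "crs s1 s2 \<noteq> 0" and ab: "a \<noteq> 0" "b \<noteq> 0"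
  shows False
proof -
  obtain r where r: "pair (crs s1 s2) r \<noteq> 0" using indep by (rule frame_complete)
  define g where "g = frame (a *s s1) (b *s s2) r"
  have "pair (crs (a *s s1) (b *s s2)) r = a * b * pair (crs s1 s2) r"
    by (simp add: pair_eq algebra_simps)
  then have g: "invertible g"
    using r ab by (simp add: g_def invertible_frame_iff)
  obtain k' where k': "pullback g (field_form k) = field_form k'"
    using pullback_field_form by blast
  have ge: "g *v vector [1, 0, 0] = a *s s1" "g *v vector [0, 1, 0] = b *s s2"
    "g *v vector [1, 1, 0] = a *s s1 + b *s s2"
    by (simp_all add: g_def frame_mult vector_3)
  have nd': "nondegenerate_form (field_form k')"
    using nondegenerate_form_pullback[OF nd g] k' by simp
  have rad': "radial (field_form k') (vector [1, 0, 0])" "radial (field_form k') (vector [0, 1, 0])"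
    "radial (field_form k') (vector [1, 1, 0])"
    unfolding k'[symmetric] radial_pullback[OF g] ge using rad radial_scale ab by blast+
  note k1 = radial_e1_coeffs[OF nd' rad'(1)] and k2 = radial_e2_coeffs[OF nd' rad'(2)]
  have "k' 1 1 = k' 3 5"
  proof -
    have "pair (field_form k' (vector [x + t, t, z])) (vector [1, 1, 0]) = pair (field_form k' (vector [x, 0, z])) (vector [1, 1, 0])" for x z t
    proof -
      have "vector [x, 0, z] + t *s vector [1, 1, 0] = (vector [x + t, t, z] :: complex^3)"
        by (simp add: vec3_eq_iff vector_3)
      then show ?thesis using radial_invariance[OF nd' rad'(3), of "vector [x, 0, z]" t] by simp
    qed
    note inv3 = this[unfolded pair_eq field_form_nth vector_3 quad_def]
    from inv3[of 1 1 1] inv3[of 1 "-1" 1] show ?thesis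
      using k1 k2 by (simp add: algebra_simps) algebra
  qed
  moreover have "field_form k' (vector [1, 0, 0]) = 0"
    using k1 by (simp add: vec3_eq_iff field_form_nth vector_3 quad_def)
  moreover have "crs (vector [1, 0, 0]) (vector [0, 1, 0] :: complex^3) \<noteq> 0"
    by (simp add: vec3_eq_iff vector_3)
  moreover have "\<exists>c d. \<forall>t. pair (field_form k' (vector [1, 0, 0] + t *s w)) (vector [0, 1, 0]) = t^2 * (c + d * t)" for w
  proof (intro exI allI)
    fix t
    have "pair (field_form k' (vector [1, 0, 0] + t *s w)) (vector [0, 1, 0]) =
       t * w$3 * (k' 1 3 * (t * w$3)^2 + (k' 1 5 - k' 3 3) * (1 + t * w$1) * (t * w$3))"
      using \<open>k' 1 1 = k' 3 5\<close> k1 k2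
      by (simp add: pair_eq field_form_nth vector_3 quad_def power2_eq_square algebra_simps)
    then show "pair (field_form k' (vector [1, 0, 0] + t *s w)) (vector [0, 1, 0]) =
       t^2 * ((w$3)^2 * (k' 1 5 - k' 3 3) + (w$3)^2 * (k' 1 3 * w$3 + (k' 1 5 - k' 3 3) * w$1) * t)"
      by algebra
  qed
  ultimately show False
    using degenerate_contradiction[OF nd'] by blast
qed

text \<open>Radiality at the coordinate points leaves only \<open>k 1 1 - k 3 5\<close>,
  \<open>k 2 2 - k 3 4\<close> and \<open>k 3 3 - k 1 5\<close> in the form; the singularity at (1,
  1, 1) makes the three equal.\<close>

lemma radial_frame_fermat:
  assumes nd: "nondegenerate_form (field_form k)"
    and rad: "radial (field_form k) (vector [1, 0, 0])" "radial (field_form k) (vector [0, 1, 0])"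
      "radial (field_form k) e3"
    and s4: "field_form k (vector [1, 1, 1]) = 0"
  shows "\<exists>c. c \<noteq> 0 \<and> (\<forall>v. field_form k v = c *s fermat2 v)"
proof -
  note k1 = radial_e1_coeffs[OF nd rad(1)] and k2 = radial_e2_coeffs[OF nd rad(2)]
  note k3 = radial_e3_coeffs[OF nd rad(3)]
  have s4': "quad (k 1) (vector [1, 1, 1]) = quad (k 3) (vector [1, 1, 1])" "quad (k 2) (vector [1, 1, 1]) = quad (k 3) (vector [1, 1, 1])"
  proof -
    have "field_form k (vector [1, 1, 1]) $ 1 = 0" "field_form k (vector [1, 1, 1]) $ 2 = 0"
      unfolding s4 by simp_all
    then show "quad (k 1) (vector [1, 1, 1]) = quad (k 3) (vector [1, 1, 1])"
      "quad (k 2) (vector [1, 1, 1]) = quad (k 3) (vector [1, 1, 1])"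
      unfolding field_form_nth vector_3 by algebra+
  qed
  define c where "c = k 1 5 - k 3 3"
  have "k 1 1 - k 3 5 = k 3 3 - k 1 5" "k 2 2 - k 3 4 = k 3 3 - k 1 5"
    using s4'[unfolded quad_def vector_3 power_one mult_1_right] k1 k2 k3(1-5) by algebra+
  then have co: "k 1 1 = k 3 5 - c" "k 2 2 = k 3 4 - c" "k 3 3 = k 1 5 - c"
    unfolding c_def by (simp_all add: algebra_simps)
  have "field_form k v = c *s fermat2 v" for v
    unfolding vec3_eq_iff vector_smult_component field_form_nth fermat2_def Let_def vector_3 quad_def
    using k1 k2 k3(1-5) co by (intro conjI) algebra+
  moreover have "c \<noteq> 0" using k3(6) by (simp add: c_def)
  ultimately show ?thesis by blast
qed

lemma radial_independent:
  assumes nd: "nondegenerate_form (field_form k)"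
    and rad: "radial (field_form k) s1" "radial (field_form k) s2" "radial (field_form k) s3"
    and indep: "crs s1 s2 \<noteq> 0" "crs s1 s3 \<noteq> 0" "crs s2 s3 \<noteq> 0"
  shows "pair (crs s1 s2) s3 \<noteq> 0"
proof
  assume 0: "pair (crs s1 s2) s3 = 0"
  obtain r where r: "pair (crs s1 s2) r \<noteq> 0" using indep(1) by (rule frame_complete)
  then have g: "invertible (frame s1 s2 r)" by (simp add: invertible_frame_iff)
  then obtain w where w: "s3 = frame s1 s2 r *v w" by (rule invertible_surj)
  then have s3: "s3 = w$1 *s s1 + w$2 *s s2 + w$3 *s r" by (simp add: frame_mult)
  have "pair (crs s1 s2) s3 = w$3 * pair (crs s1 s2) r"
    unfolding s3 by (simp add: pair_eq algebra_simps)
  with 0 r have "w$3 = 0" by simp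
  with s3 have s3: "s3 = w$1 *s s1 + w$2 *s s2" by simp
  have "w$1 \<noteq> 0"
  proof
    assume "w$1 = 0"
    then have "crs s2 s3 = 0" unfolding s3 by (simp add: vec3_eq_iff)
    with indep show False by simp
  qed
  moreover have "w$2 \<noteq> 0"
  proof
    assume "w$2 = 0"
    then have "crs s1 s3 = 0" unfolding s3 by (simp add: vec3_eq_iff)
    with indep show False by simp
  qed
  ultimately show False
    using radial_noncollinear[OF nd rad(1,2), of "w$1" "w$2"] rad(3) indep(1) s3 by metis
qed

text \<open>No three of the points being collinear, they form a projective frame: the first three
  are rescaled so that their sum is the fourth.\<close>

lemma four_radial_points_fermat:
  assumes nd: "nondegenerate_form (field_form k)"
    and rad: "\<And>i. i < (4::nat) \<Longrightarrow> radial (field_form k) (s i)"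
    and indep: "\<And>i j. i < 4 \<Longrightarrow> j < 4 \<Longrightarrow> i \<noteq> j \<Longrightarrow> crs (s i) (s j) \<noteq> 0"
  shows "\<exists>g c. invertible g \<and> c \<noteq> 0 \<and> (\<forall>v. pullback g (field_form k) v = c *s fermat2 v)"
proof -
  have ind: "pair (crs (s i) (s j)) (s l) \<noteq> 0" if "i < 4" "j < 4" "l < 4" "i \<noteq> j" "i \<noteq> l" "j \<noteq> l" for i j l
    using that by (intro radial_independent[OF nd] rad indep)
  have "invertible (frame (s 0) (s 1) (s 2))"
    using ind[of 0 1 2] by (simp add: invertible_frame_iff)
  then obtain w where "s 3 = frame (s 0) (s 1) (s 2) *v w" by (rule invertible_surj)
  then have s3: "s 3 = w$1 *s s 0 + w$2 *s s 1 + w$3 *s s 2" by (simp add: frame_mult)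
  have "pair (crs (s 1) (s 2)) (s 3) = w$1 * pair (crs (s 1) (s 2)) (s 0)"
    "pair (crs (s 0) (s 2)) (s 3) = w$2 * pair (crs (s 0) (s 2)) (s 1)"
    "pair (crs (s 0) (s 1)) (s 3) = w$3 * pair (crs (s 0) (s 1)) (s 2)"
    unfolding s3 by (simp_all add: pair_eq algebra_simps)
  then have w: "w$1 \<noteq> 0" "w$2 \<noteq> 0" "w$3 \<noteq> 0"
    using ind[of 1 2 3] ind[of 0 2 3] ind[of 0 1 3] by auto
  define g where "g = frame (w$1 *s s 0) (w$2 *s s 1) (w$3 *s s 2)"
  have "pair (crs (w$1 *s s 0) (w$2 *s s 1)) (w$3 *s s 2) = w$1 * w$2 * w$3 * pair (crs (s 0) (s 1)) (s 2)"
    by (simp add: pair_eq algebra_simps)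
  then have g: "invertible g"
    using w ind[of 0 1 2] by (simp add: g_def invertible_frame_iff)
  obtain k' where k': "pullback g (field_form k) = field_form k'"
    using pullback_field_form by blast
  have ge: "g *v vector [1, 0, 0] = w$1 *s s 0" "g *v vector [0, 1, 0] = w$2 *s s 1"
    "g *v e3 = w$3 *s s 2" "g *v vector [1, 1, 1] = s 3"
    unfolding s3 by (simp_all add: g_def frame_mult vector_3)
  have nd': "nondegenerate_form (field_form k')"
    using nondegenerate_form_pullback[OF nd g] k' by simp
  have rad': "radial (field_form k') (vector [1, 0, 0])" "radial (field_form k') (vector [0, 1, 0])"
    "radial (field_form k') e3" "radial (field_form k') (vector [1, 1, 1])"
    unfolding k'[symmetric] radial_pullback[OF g] ge using rad radial_scale w by simp_all
  show ?thesis
    using radial_frame_fermat[OF nd' rad'(1-3) radial_singular[OF nd' rad'(4)]] g k' by metis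
qed


section \<open>Curvature of the dual web\<close>

definition web_disc :: "complex poly poly \<Rightarrow> complex poly poly \<Rightarrow> complex poly poly \<Rightarrow> complex poly poly" where
  "web_disc \<alpha> \<beta> \<gamma> = \<beta>^2 - 4 * \<alpha> * \<gamma>"

text \<open>
  The form \<open>\<eta>\<close> of the web \<open>x (\<alpha> x\<^sup>2 + \<beta> x + \<gamma>) = 0\<close> is
  \<open>eta_p \<gamma> \<Delta> / (2 \<gamma> \<Delta>) dp + eta_q \<beta> \<Delta> / (4 \<gamma> \<Delta>) dq\<close>.
\<close>

definition eta_p :: "complex poly poly \<Rightarrow> complex poly poly \<Rightarrow> complex poly poly" where
  "eta_p \<gamma> \<Delta> = \<gamma> * Dp \<Delta> - 2 * Dp \<gamma> * \<Delta>"

definition eta_q :: "complex poly poly \<Rightarrow> complex poly poly \<Rightarrow> complex poly poly" where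
  "eta_q \<beta> \<Delta> = \<beta> * Dp \<Delta> - 2 * \<Delta> * Dp \<beta>"

definition holomorphic_at2 :: "(complex \<times> complex \<Rightarrow> complex) \<Rightarrow> complex \<times> complex \<Rightarrow> bool" where
  "holomorphic_at2 f z \<longleftrightarrow> (\<exists>a b. (f has_derivative (\<lambda>h. a * fst h + b * snd h)) (at z))"

lemma holomorphic_at2_ev: "holomorphic_at2 (\<lambda>z. ev P (fst z) (snd z)) z"
  unfolding holomorphic_at2_def using has_derivative_ev by blast

lemma holomorphic_at2_add:
  assumes "holomorphic_at2 f z" "holomorphic_at2 g z"
  shows "holomorphic_at2 (\<lambda>z. f z + g z) z"
proof -
  obtain a b c d where
    "(f has_derivative (\<lambda>h. a * fst h + b * snd h)) (at z)" "(g has_derivative (\<lambda>h. c * fst h + d * snd h)) (at z)"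
    using assms unfolding holomorphic_at2_def by blast
  from has_derivative_add[OF this]
  have "((\<lambda>z. f z + g z) has_derivative (\<lambda>h. (a + c) * fst h + (b + d) * snd h)) (at z)"
    by (simp add: algebra_simps)
  then show ?thesis unfolding holomorphic_at2_def by blast
qed

lemma holomorphic_at2_comp:
  assumes "holomorphic_at2 f z" "(\<phi> has_field_derivative c) (at (f z))"
  shows "holomorphic_at2 (\<lambda>z. \<phi> (f z)) z"
proof -
  obtain a b where "(f has_derivative (\<lambda>h. a * fst h + b * snd h)) (at z)"
    using assms unfolding holomorphic_at2_def by blast
  from has_derivative_compose[OF this has_field_derivative_imp_has_derivative[OF assms(2)]]
  have "((\<lambda>z. \<phi> (f z)) has_derivative (\<lambda>h. (c * a) * fst h + (c * b) * snd h)) (at z)"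
    by (simp add: algebra_simps)
  then show ?thesis unfolding holomorphic_at2_def by blast
qed

lemma holomorphic_at2_mult:
  assumes "holomorphic_at2 f z" "holomorphic_at2 g z"
  shows "holomorphic_at2 (\<lambda>z. f z * g z) z"
proof -
  obtain a b c d where
    "(f has_derivative (\<lambda>h. a * fst h + b * snd h)) (at z)" "(g has_derivative (\<lambda>h. c * fst h + d * snd h)) (at z)"
    using assms unfolding holomorphic_at2_def by blast
  from has_derivative_mult[OF this]
  have "((\<lambda>z. f z * g z) has_derivative (\<lambda>h. (f z * c + a * g z) * fst h + (f z * d + b * g z) * snd h)) (at z)"
    by (simp add: algebra_simps)
  then show ?thesis unfolding holomorphic_at2_def by blast
qed

text \<open>The form \<eta> is computed from an explicit local decomposition of the web, and
  \<open>d \<eta> = 0\<close> is multiplied by \<open>4 * G^2\<close>. The conditions at the base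
  point keep the directions distinct and nonvertical.\<close>

lemma web_curvature_eq_0:
  fixes \<alpha> \<beta> \<gamma> :: "complex poly poly" and p0 q0 :: complex
  defines "\<Delta> \<equiv> web_disc \<alpha> \<beta> \<gamma>"
  defines "M \<equiv> eta_p \<gamma> \<Delta>" and "N \<equiv> eta_q \<beta> \<Delta>" and "G \<equiv> \<gamma> * \<Delta>"
  assumes F: "\<And>p q x. F (p, q) x = 0 \<longleftrightarrow> x = 0 \<or> ev \<alpha> p q * x^2 + ev \<beta> p q * x + ev \<gamma> p q = 0"
    and flat: "\<And>U \<omega>1 \<omega>2 \<omega>3 z. web3_on F U \<omega>1 \<omega>2 \<omega>3 \<Longrightarrow> z \<in> U \<Longrightarrow> web_curvature \<omega>1 \<omega>2 \<omega>3 z = 0"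
    and nz: "ev \<alpha> p0 q0 \<noteq> 0" "ev \<gamma> p0 q0 \<noteq> 0" "ev \<Delta> p0 q0 \<noteq> 0"
  shows "ev (G * (Dp N - 2 * Dq M) - (N * Dp G - 2 * M * Dq G)) p0 q0 = 0"
proof -
  define E where "E = (\<lambda>P z. ev P (fst z) (snd z))"
  define d0 where "d0 = ev \<Delta> p0 q0"
  \<comment> \<open>A branch of the square root of \<Delta>: on \<open>U\<close> the quotient
    \<open>E \<Delta> z / d0\<close> has positive real part, so the principal root is holomorphic
    there.\<close>
  define r where "r = (\<lambda>z. csqrt d0 * csqrt (E \<Delta> z / d0))"
  define U where "U = {z. E \<alpha> z \<noteq> 0 \<and> E \<gamma> z \<noteq> 0 \<and> 0 < Re (E \<Delta> z / d0)}"
  have d0: "d0 \<noteq> 0" using nz by (simp add: d0_def)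
  have contE: "continuous_on A (E P)" for A P
    unfolding E_def by (intro continuous_at_imp_continuous_on ballI isCont_ev)
  have "open U"
    unfolding U_def using d0
    by (intro open_Collect_conj open_Collect_neq open_Collect_less continuous_intros contE) auto
  have z0: "(p0, q0) \<in> U" using nz d0 by (simp add: U_def E_def d0_def)
  have U: "E \<alpha> z \<noteq> 0" "E \<gamma> z \<noteq> 0" "E \<Delta> z \<noteq> 0" "E \<Delta> z / d0 \<notin> \<real>\<^sub>\<le>\<^sub>0" if "z \<in> U" for z
    using that by (auto simp: U_def complex_nonpos_Reals_iff)
  have r2: "r z ^ 2 = E \<Delta> z" for z
    using d0 by (simp add: r_def power_mult_distrib)
  have r0: "r z \<noteq> 0" if "z \<in> U" for z
    using r2[of z] U(3)[OF that] by auto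
  have E\<Delta>: "E \<Delta> z = E \<beta> z ^ 2 - 4 * E \<alpha> z * E \<gamma> z" for z
    by (simp add: E_def \<Delta>_def web_disc_def)
  have holE: "holomorphic_at2 (E P) z" for P z
    unfolding E_def by (rule holomorphic_at2_ev)
  have holr: "holomorphic_at2 r z" if "z \<in> U" for z
  proof -
    have "((\<lambda>t. csqrt d0 * csqrt (t / d0)) has_field_derivative
       csqrt d0 * (inverse (2 * csqrt (E \<Delta> z / d0)) * (1 / d0))) (at (E \<Delta> z))"
      by (rule DERIV_cmult, rule DERIV_chain2[where f = csqrt and g = "\<lambda>t. t / d0", OF has_field_derivative_csqrt[OF U(4)[OF that]]])
        (auto intro!: derivative_eq_intros simp: d0)
    from holomorphic_at2_comp[OF holE this] show ?thesis unfolding r_def .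
  qed
  have pE: "((\<lambda>t. E P (t, q)) has_field_derivative E (Dp P) (p, q)) (at p)" for P p q
    unfolding E_def using DERIV_ev_p by simp
  have qE: "((\<lambda>t. E P (p, t)) has_field_derivative E (Dq P) (p, q)) (at q)" for P p q
    unfolding E_def using DERIV_ev_q by simp
  have pr: "((\<lambda>t. r (t, q)) has_field_derivative E (Dp \<Delta>) (p, q) / (2 * r (p, q))) (at p)"
    if "(p, q) \<in> U" for p q
  proof -
    have nz: "csqrt d0 \<noteq> 0" "csqrt (E \<Delta> (p, q) / d0) \<noteq> 0" using d0 U(3)[OF that] by auto
    have d0': "d0 = csqrt d0 * csqrt d0" using power2_csqrt[of d0] by (simp add: power2_eq_square)
    have eq: "csqrt d0 * (inverse (2 * csqrt (E \<Delta> (p, q) / d0)) * (E (Dp \<Delta>) (p, q) / d0)) = E (Dp \<Delta>) (p, q) / (2 * r (p, q))"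
      unfolding r_def by (subst (3) d0') (use nz in \<open>simp add: field_simps\<close>)
    have "((\<lambda>t. csqrt d0 * csqrt (E \<Delta> (t, q) / d0)) has_field_derivative
       csqrt d0 * (inverse (2 * csqrt (E \<Delta> (p, q) / d0)) * (E (Dp \<Delta>) (p, q) / d0))) (at p)"
      by (rule DERIV_cmult, rule DERIV_chain2[where f = csqrt and g = "\<lambda>t. E \<Delta> (t, q) / d0", OF has_field_derivative_csqrt[OF U(4)[OF that]]])
        (rule DERIV_cdivide[OF pE])
    then show ?thesis unfolding eq unfolding r_def .
  qed
  \<comment> \<open>Reciprocals of the two nonzero roots x, that is, the slopes dp/dq. They suit the
    first foliation, which is dq = 0.\<close>
  define y2 y3 where "y2 = (\<lambda>z. (- E \<beta> z + r z) / (2 * E \<gamma> z))" and "y3 = (\<lambda>z. (- E \<beta> z - r z) / (2 * E \<gamma> z))"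
  have hol_y: "holomorphic_at2 y2 z" "holomorphic_at2 y3 z" if "z \<in> U" for z
  proof -
    have inv: "holomorphic_at2 (\<lambda>z. inverse (2 * E \<gamma> z)) z"
      by (rule holomorphic_at2_comp[OF holE, where \<phi> = "\<lambda>t. inverse (2 * t)"])
        (use U(2)[OF that] in \<open>auto intro!: derivative_eq_intros\<close>)
    have min: "holomorphic_at2 (\<lambda>z. - f z) z" if "holomorphic_at2 f z" for f
      by (rule holomorphic_at2_comp[OF that, where \<phi> = uminus]) (auto intro!: derivative_eq_intros)
    show "holomorphic_at2 y2 z" "holomorphic_at2 y3 z"
      unfolding y2_def y3_def divide_inverse diff_conv_add_uminus
      by (intro holomorphic_at2_mult holomorphic_at2_add min inv holE holr[OF that])+
  qed
  have y_prod: "y2 z * y3 z = E \<alpha> z / E \<gamma> z" and y_sum: "y2 z + y3 z = - E \<beta> z / E \<gamma> z"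
    and y_diff: "y2 z - y3 z = r z / E \<gamma> z" if "z \<in> U" for z
  proof -
    have "(- E \<beta> z + r z) * (- E \<beta> z - r z) = 4 * E \<alpha> z * E \<gamma> z"
      using r2[of z] unfolding E\<Delta> by algebra
    then show "y2 z * y3 z = E \<alpha> z / E \<gamma> z"
      using U(2)[OF that] by (simp add: y2_def y3_def)
    show "y2 z + y3 z = - E \<beta> z / E \<gamma> z" "y2 z - y3 z = r z / E \<gamma> z"
      using U(2)[OF that] by (simp_all add: y2_def y3_def field_simps)
  qed
  have y_nz: "y2 z \<noteq> 0" "y3 z \<noteq> 0" "y2 z \<noteq> y3 z" if "z \<in> U" for z
    using y_prod[OF that] y_diff[OF that] U(1,2)[OF that] r0[OF that] by auto
  define \<omega>1 \<omega>2 \<omega>3 :: form2 where "\<omega>1 = (\<lambda>z. (0, 1))" and "\<omega>2 = (\<lambda>z. (-1, y2 z))" and "\<omega>3 = (\<lambda>z. (-1, y3 z))"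
  have const: "holomorphic2 (\<lambda>z. c) U" for c
    unfolding holomorphic2_def by (auto intro!: exI[of _ 0])
  have roots: "F z x = 0 \<longleftrightarrow> x = 0 \<or> y2 z * x = 1 \<or> y3 z * x = 1" if "z \<in> U" for z x
  proof -
    have "E \<alpha> z = E \<gamma> z * (y2 z * y3 z)" "E \<beta> z = - E \<gamma> z * (y2 z + y3 z)"
      using y_prod[OF that] y_sum[OF that] U(2)[OF that] by simp_all
    then have "E \<alpha> z * x^2 + E \<beta> z * x + E \<gamma> z = E \<gamma> z * ((y2 z * x - 1) * (y3 z * x - 1))"
      by algebra
    then have "E \<alpha> z * x^2 + E \<beta> z * x + E \<gamma> z = 0 \<longleftrightarrow> y2 z * x = 1 \<or> y3 z * x = 1"
      using U(2)[OF that] by simp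
    then show ?thesis using F[of "fst z" "snd z" x] by (simp add: E_def)
  qed
  have web: "web3_on F U \<omega>1 \<omega>2 \<omega>3"
    unfolding web3_on_def
  proof (intro conjI ballI allI)
    fix \<omega> assume "\<omega> \<in> {\<omega>1, \<omega>2, \<omega>3}"
    then show "holomorphic_form \<omega> U"
      using hol_y const unfolding holomorphic_form_def \<omega>1_def \<omega>2_def \<omega>3_def holomorphic2_def holomorphic_at2_def
      by auto
  next
    fix \<omega> z assume "\<omega> \<in> {\<omega>1, \<omega>2, \<omega>3}" "z \<in> U"
    then show "snd (\<omega> z) \<noteq> 0"
      using y_nz[of z] by (auto simp: \<omega>1_def \<omega>2_def \<omega>3_def)
  next
    fix z x assume "z \<in> U"
    then show "F z x = 0 \<longleftrightarrow> (\<exists>\<omega>\<in>{\<omega>1, \<omega>2, \<omega>3}. fst (\<omega> z) + snd (\<omega> z) * x = 0)"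
      using roots[of z x] by (auto simp: \<omega>1_def \<omega>2_def \<omega>3_def)
  qed (use y_nz \<open>open U\<close> in \<open>auto simp: \<omega>1_def \<omega>2_def \<omega>3_def wedge_def\<close>)
  have nz3: "E G z \<noteq> 0" if "z \<in> U" for z
    using U(2,3)[OF that] by (simp add: G_def E_def)
  have h: "E M z / (2 * E G z) = E (Dp \<Delta>) z / (2 * E \<Delta> z) - E (Dp \<gamma>) z / E \<gamma> z"
    and k: "E N z / (4 * E G z) = (E \<beta> z * E (Dp \<Delta>) z / (2 * E \<Delta> z) - E (Dp \<beta>) z) / (2 * E \<gamma> z)"
    if "z \<in> U" for z
    using U(2,3)[OF that] unfolding M_def N_def G_def eta_p_def eta_q_def E_def
    by (simp_all add: field_simps)
  \<comment> \<open>With the forms dq and \<open>- dp + y dq\<close>, the conditions on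
    \<open>\<eta> = h dp + k dq\<close> reduce to \<open>dy/dp = h y + k\<close> for both slopes. As
    \<open>y2\<close> and \<open>y3\<close> are distinct, this determines h and k.\<close>
  have py2: "((\<lambda>t. y2 (t, q)) has_field_derivative E M (p, q) / (2 * E G (p, q)) * y2 (p, q) + E N (p, q) / (4 * E G (p, q))) (at p)"
    and py3: "((\<lambda>t. y3 (t, q)) has_field_derivative E M (p, q) / (2 * E G (p, q)) * y3 (p, q) + E N (p, q) / (4 * E G (p, q))) (at p)"
    if "(p, q) \<in> U" for p q
  proof -
    let ?z = "(p, q)"
    have r\<Delta>: "E \<Delta> ?z = r ?z * r ?z" using r2[of ?z] by (simp add: power2_eq_square)
    have "((\<lambda>t. y2 (t, q)) has_field_derivative
       ((- E (Dp \<beta>) ?z + E (Dp \<Delta>) ?z / (2 * r ?z)) * (2 * E \<gamma> ?z) - (- E \<beta> ?z + r ?z) * (2 * E (Dp \<gamma>) ?z))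
        / (2 * E \<gamma> ?z * (2 * E \<gamma> ?z))) (at p)"
      unfolding y2_def using U(2)[OF that]
      by (intro DERIV_divide DERIV_add DERIV_minus DERIV_cmult pE pr[OF that]) auto
    moreover have "((- E (Dp \<beta>) ?z + E (Dp \<Delta>) ?z / (2 * r ?z)) * (2 * E \<gamma> ?z) - (- E \<beta> ?z + r ?z) * (2 * E (Dp \<gamma>) ?z))
        / (2 * E \<gamma> ?z * (2 * E \<gamma> ?z)) = E M ?z / (2 * E G ?z) * y2 ?z + E N ?z / (4 * E G ?z)"
      unfolding h[OF that] k[OF that] y2_def r\<Delta> using U(2)[OF that] r0[OF that] by (simp add: field_simps)
    ultimately show "((\<lambda>t. y2 (t, q)) has_field_derivative E M (p, q) / (2 * E G (p, q)) * y2 (p, q) + E N (p, q) / (4 * E G (p, q))) (at p)"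
      by simp
    have "((\<lambda>t. y3 (t, q)) has_field_derivative
       ((- E (Dp \<beta>) ?z - E (Dp \<Delta>) ?z / (2 * r ?z)) * (2 * E \<gamma> ?z) - (- E \<beta> ?z - r ?z) * (2 * E (Dp \<gamma>) ?z))
        / (2 * E \<gamma> ?z * (2 * E \<gamma> ?z))) (at p)"
      unfolding y3_def using U(2)[OF that]
      by (intro DERIV_divide DERIV_diff DERIV_minus DERIV_cmult pE pr[OF that]) auto
    moreover have "((- E (Dp \<beta>) ?z - E (Dp \<Delta>) ?z / (2 * r ?z)) * (2 * E \<gamma> ?z) - (- E \<beta> ?z - r ?z) * (2 * E (Dp \<gamma>) ?z))
        / (2 * E \<gamma> ?z * (2 * E \<gamma> ?z)) = E M ?z / (2 * E G ?z) * y3 ?z + E N ?z / (4 * E G ?z)"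
      unfolding h[OF that] k[OF that] y3_def r\<Delta> using U(2)[OF that] r0[OF that] by (simp add: field_simps)
    ultimately show "((\<lambda>t. y3 (t, q)) has_field_derivative E M (p, q) / (2 * E G (p, q)) * y3 (p, q) + E N (p, q) / (4 * E G (p, q))) (at p)"
      by simp
  qed
  have eta: "web_eta \<omega>1 \<omega>2 \<omega>3 z = (E M z / (2 * E G z), E N z / (4 * E G z))" if z: "z \<in> U" for z
  proof -
    obtain p q where pq: "z = (p, q)" by fastforce
    note py = py2[of p q] py3[of p q]
    define h k where "h = E M z / (2 * E G z)" and "k = E N z / (4 * E G z)"
    have p2: "((\<lambda>t. y2 (t, q)) has_field_derivative h * y2 z + k) (at p)"
      and p3: "((\<lambda>t. y3 (t, q)) has_field_derivative h * y3 z + k) (at p)"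
      using py z unfolding pq h_def k_def by blast+
    note d3 = DERIV_imp_deriv[OF p3] and d2m = DERIV_imp_deriv[OF DERIV_minus[OF p2]]
    have d23: "deriv (\<lambda>t. y2 (t, q) - y3 (t, q)) p = h * (y2 z - y3 z)"
      by (rule DERIV_imp_deriv, rule DERIV_cong[OF DERIV_diff[OF p2 p3]]) algebra
    have fs: "fst z = p" "snd z = q" by (simp_all add: pq)
    have e1: "ext_deriv (fmult (wedge \<omega>2 \<omega>3) \<omega>1) z = h * (y2 z - y3 z)"
      unfolding ext_deriv_def fmult_def wedge_def pd1_def pd2_def fs
      by (simp add: \<omega>1_def \<omega>2_def \<omega>3_def d23)
    have e2: "ext_deriv (fmult (wedge \<omega>3 \<omega>1) \<omega>2) z = - (h * y2 z + k)"
      unfolding ext_deriv_def fmult_def wedge_def pd1_def pd2_def fs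
      by (simp add: \<omega>1_def \<omega>2_def \<omega>3_def d2m)
    have e3: "ext_deriv (fmult (wedge \<omega>1 \<omega>2) \<omega>3) z = h * y3 z + k"
      unfolding ext_deriv_def fmult_def wedge_def pd1_def pd2_def fs
      by (simp add: \<omega>1_def \<omega>2_def \<omega>3_def d3)
    show ?thesis
      unfolding web_eta_def h_def[symmetric] k_def[symmetric] e1 e2 e3
    proof (rule the_equality)
      fix e
      assume *: "h * (y2 z - y3 z) = wedge (\<lambda>_. e) (fmult (wedge \<omega>2 \<omega>3) \<omega>1) z \<and>
        - (h * y2 z + k) = wedge (\<lambda>_. e) (fmult (wedge \<omega>3 \<omega>1) \<omega>2) z \<and>
        h * y3 z + k = wedge (\<lambda>_. e) (fmult (wedge \<omega>1 \<omega>2) \<omega>3) z"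
      then have "h * (y2 z - y3 z) = fst e * (y2 z - y3 z)" "- (h * y2 z + k) = - (fst e * y2 z) - snd e"
        by (simp_all add: wedge_def fmult_def \<omega>1_def \<omega>2_def \<omega>3_def)
      with y_nz(3)[OF z] have "fst e = h" "snd e = k"
        by auto
      then show "e = (h, k)" by (simp add: prod_eq_iff)
    qed (simp add: wedge_def fmult_def \<omega>1_def \<omega>2_def \<omega>3_def algebra_simps)
  qed
  have "web_curvature \<omega>1 \<omega>2 \<omega>3 (p0, q0) = 0"
    by (rule flat[OF web z0])
  moreover have "eventually (\<lambda>t. (t, q0) \<in> U) (nhds p0)" "eventually (\<lambda>t. (p0, t) \<in> U) (nhds q0)"
  proof -
    have "continuous_on UNIV (\<lambda>t. (t, q0))" "continuous_on UNIV (\<lambda>t. (p0, t))"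
      by (auto intro!: continuous_intros)
    then have "open ((\<lambda>t. (t, q0)) -` U)" "open ((\<lambda>t. (p0, t)) -` U)"
      using \<open>open U\<close> by (auto intro: open_vimage)
    then show "eventually (\<lambda>t. (t, q0) \<in> U) (nhds p0)" "eventually (\<lambda>t. (p0, t) \<in> U) (nhds q0)"
      using z0 eventually_nhds_in_open[of "(\<lambda>t. (t, q0)) -` U" p0] eventually_nhds_in_open[of "(\<lambda>t. (p0, t)) -` U" q0]
      by auto
  qed
  then have "eventually (\<lambda>t. snd (web_eta \<omega>1 \<omega>2 \<omega>3 (t, q0)) = E N (t, q0) / (4 * E G (t, q0))) (nhds p0)"
    "eventually (\<lambda>t. fst (web_eta \<omega>1 \<omega>2 \<omega>3 (p0, t)) = E M (p0, t) / (2 * E G (p0, t))) (nhds q0)"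
    using eta by (auto elim!: eventually_mono)
  then have "deriv (\<lambda>t. snd (web_eta \<omega>1 \<omega>2 \<omega>3 (t, q0))) p0 = deriv (\<lambda>t. E N (t, q0) / (4 * E G (t, q0))) p0"
    "deriv (\<lambda>t. fst (web_eta \<omega>1 \<omega>2 \<omega>3 (p0, t))) q0 = deriv (\<lambda>t. E M (p0, t) / (2 * E G (p0, t))) q0"
    by (auto intro: deriv_cong_ev)
  moreover have "deriv (\<lambda>t. E N (t, q0) / (4 * E G (t, q0))) p0
     = (E (Dp N) (p0, q0) * (4 * E G (p0, q0)) - E N (p0, q0) * (4 * E (Dp G) (p0, q0))) / (4 * E G (p0, q0) * (4 * E G (p0, q0)))"
    by (rule DERIV_imp_deriv, intro DERIV_divide DERIV_cmult pE) (use nz3[OF z0] in auto)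
  moreover have "deriv (\<lambda>t. E M (p0, t) / (2 * E G (p0, t))) q0
     = (E (Dq M) (p0, q0) * (2 * E G (p0, q0)) - E M (p0, q0) * (2 * E (Dq G) (p0, q0))) / (2 * E G (p0, q0) * (2 * E G (p0, q0)))"
    by (rule DERIV_imp_deriv, intro DERIV_divide DERIV_cmult qE) (use nz3[OF z0] in auto)
  ultimately have 0: "(E (Dp N) (p0, q0) * (4 * E G (p0, q0)) - E N (p0, q0) * (4 * E (Dp G) (p0, q0))) / (4 * E G (p0, q0) * (4 * E G (p0, q0)))
    - (E (Dq M) (p0, q0) * (2 * E G (p0, q0)) - E M (p0, q0) * (2 * E (Dq G) (p0, q0))) / (2 * E G (p0, q0) * (2 * E G (p0, q0))) = 0"
    unfolding web_curvature_def ext_deriv_def pd1_def pd2_def by simp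
  have "(a * (4 * g) - b * (4 * c)) / (4 * g * (4 * g)) - (d * (2 * g) - e * (2 * f)) / (2 * g * (2 * g))
     = (g * (a - 2 * d) - (b * c - 2 * e * f)) / (4 * g^2)" if "g \<noteq> 0" for a b c d e f g :: complex
    using that by (simp add: field_simps power2_eq_square)
  note 0[unfolded this[OF nz3[OF z0]]]
  then have "E G (p0, q0) * (E (Dp N) (p0, q0) - 2 * E (Dq M) (p0, q0))
      - (E N (p0, q0) * E (Dp G) (p0, q0) - 2 * E M (p0, q0) * E (Dq G) (p0, q0)) = 0"
    using nz3[OF z0] by simp
  then show ?thesis
    by (simp add: E_def)
qed

text \<open>Multiplication by \<alpha> \<gamma> \<Delta> extends the pointwise identity to the
  points excluded by \<open>web_curvature_eq_0\<close>; the nonzero factor is then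
  cancelled.\<close>

lemma flat_identity:
  fixes \<alpha> \<beta> \<gamma> :: "complex poly poly"
  defines "\<Delta> \<equiv> web_disc \<alpha> \<beta> \<gamma>"
  defines "M \<equiv> eta_p \<gamma> \<Delta>" and "N \<equiv> eta_q \<beta> \<Delta>" and "G \<equiv> \<gamma> * \<Delta>"
  assumes F: "\<And>p q x. F (p, q) x = 0 \<longleftrightarrow> x = 0 \<or> ev \<alpha> p q * x^2 + ev \<beta> p q * x + ev \<gamma> p q = 0"
    and flat: "\<And>U \<omega>1 \<omega>2 \<omega>3 z. web3_on F U \<omega>1 \<omega>2 \<omega>3 \<Longrightarrow> z \<in> U \<Longrightarrow> web_curvature \<omega>1 \<omega>2 \<omega>3 z = 0"
    and nz: "\<alpha> \<noteq> 0" "\<gamma> \<noteq> 0" "\<Delta> \<noteq> 0"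
  shows "G * (Dp N - 2 * Dq M) = N * Dp G - 2 * M * Dq G"
proof -
  have "\<alpha> * \<gamma> * \<Delta> * (G * (Dp N - 2 * Dq M) - (N * Dp G - 2 * M * Dq G)) = 0"
    by (rule ev_eq_0D)
      (use web_curvature_eq_0[OF F flat] in \<open>force simp: \<Delta>_def M_def N_def G_def\<close>)
  with nz show ?thesis by simp
qed


section \<open>The Legendre transform of a quadratic vector field\<close>

abbreviation "e2 \<equiv> vector [0, 1, 0] :: complex^3"

text \<open>
  The tangency points of \<open>field_form k\<close> with the line \<open>y = px - qz\<close>, which is parametrized by \<open>on_line p q\<close>,
  are the zeros of \<open>leg_a k x\<^sup>2 + leg_b k x z + leg_c k z\<^sup>2\<close>.
\<close>

definition leg_coeff :: "(nat \<Rightarrow> nat \<Rightarrow> complex) \<Rightarrow> nat \<Rightarrow> complex poly poly" where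
  "leg_coeff k j = [:[:- k 2 j, - k 3 j:], [:k 1 j:]:]"

definition leg_a :: "(nat \<Rightarrow> nat \<Rightarrow> complex) \<Rightarrow> complex poly poly" where
  "leg_a k = leg_coeff k 1 + var_p * leg_coeff k 6 + var_p * (var_p * leg_coeff k 2)"

definition leg_b :: "(nat \<Rightarrow> nat \<Rightarrow> complex) \<Rightarrow> complex poly poly" where
  "leg_b k = leg_coeff k 5 - var_q * leg_coeff k 6 + var_p * leg_coeff k 4
     - 2 * (var_p * (var_q * leg_coeff k 2))"

definition leg_c :: "(nat \<Rightarrow> nat \<Rightarrow> complex) \<Rightarrow> complex poly poly" where
  "leg_c k = leg_coeff k 3 - var_q * leg_coeff k 4 + var_q * (var_q * leg_coeff k 2)"

definition leg_disc :: "(nat \<Rightarrow> nat \<Rightarrow> complex) \<Rightarrow> complex poly poly" where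
  "leg_disc k = web_disc (leg_a k) (leg_b k) (leg_c k)"

definition on_line :: "complex \<Rightarrow> complex \<Rightarrow> complex \<Rightarrow> complex \<Rightarrow> complex^3" where
  "on_line p q x z = vector [x, p * x - q * z, z]"

lemma on_line_nth [simp]:
  "on_line p q x z $ 1 = x" "on_line p q x z $ 2 = p * x - q * z" "on_line p q x z $ 3 = z"
  by (simp_all add: on_line_def vector_3)

lemma ev_leg_coeff: "ev (leg_coeff k j) p q = p * k 1 j - k 2 j - q * k 3 j"
  by (simp add: leg_coeff_def algebra_simps)

lemma ev_leg:
  "ev (leg_a k) p q = ev (leg_coeff k 1) p q + p * ev (leg_coeff k 6) p q + p^2 * ev (leg_coeff k 2) p q"
  "ev (leg_b k) p q = ev (leg_coeff k 5) p q - q * ev (leg_coeff k 6) p q + p * ev (leg_coeff k 4) p q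
     - 2 * p * q * ev (leg_coeff k 2) p q"
  "ev (leg_c k) p q = ev (leg_coeff k 3) p q - q * ev (leg_coeff k 4) p q + q^2 * ev (leg_coeff k 2) p q"
  by (simp_all add: leg_a_def leg_b_def leg_c_def power2_eq_square algebra_simps)

lemma ev_leg_disc: "ev (leg_disc k) p q = ev (leg_b k) p q ^ 2 - 4 * ev (leg_a k) p q * ev (leg_c k) p q"
  by (simp add: leg_disc_def web_disc_def)

lemma leg_quadratic:
  "p * quad (k 1) (on_line p q x z) - quad (k 2) (on_line p q x z) - q * quad (k 3) (on_line p q x z)
     = ev (leg_a k) p q * x^2 + ev (leg_b k) p q * x * z + ev (leg_c k) p q * z^2"
  unfolding quad_def on_line_nth ev_leg ev_leg_coeff by algebra

text \<open>At a point of the line, the form is F times (z, 0, -x) plus its second component times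
  the covector (-p, 1, q) of the line. So a tangency point is singular as soon as the second
  component vanishes.\<close>

lemma field_form_on_line:
  fixes k :: "nat \<Rightarrow> nat \<Rightarrow> complex"
  defines "F \<equiv> \<lambda>p q x z. ev (leg_a k) p q * x^2 + ev (leg_b k) p q * x * z + ev (leg_c k) p q * z^2"
  shows "field_form k (on_line p q x z) $ 1 = z * F p q x z - p * field_form k (on_line p q x z) $ 2"
    and "field_form k (on_line p q x z) $ 3 = q * field_form k (on_line p q x z) $ 2 - x * F p q x z"
  unfolding F_def leg_quadratic[symmetric] field_form_nth on_line_nth by algebra+

text \<open>The right-hand side is \<open>z * Dp + x * Dq\<close> applied to the tangency form with
  x, z constant. The motion (z, x) of (p, q) fixes the point \<open>on_line p q x z\<close>, so only
  the factors p and -q in front of the field are differentiated.\<close>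

lemma field_form_on_line2:
  "field_form k (on_line p q x z) $ 2 = ev (Dp (leg_c k)) p q * z^3
     + (ev (Dp (leg_b k)) p q + ev (Dq (leg_c k)) p q) * x * z^2
     + (ev (Dp (leg_a k)) p q + ev (Dq (leg_b k)) p q) * x^2 * z + ev (Dq (leg_a k)) p q * x^3"
proof -
  have c: "ev (leg_coeff k j) p q = p * k 1 j - k 2 j - q * k 3 j"
    "ev (Dp (leg_coeff k j)) p q = k 1 j" "ev (Dq (leg_coeff k j)) p q = - k 3 j" for j
    by (simp_all add: leg_coeff_def pderiv_pCons algebra_simps)
  have "ev (Dp (leg_c k)) p q = k 1 3 - q * k 1 4 + q^2 * k 1 2"
    "ev (Dp (leg_b k)) p q = k 1 5 - q * k 1 6 + (p * k 1 4 - k 2 4 - q * k 3 4) + p * k 1 4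
       - 2 * q * (p * k 1 2 - k 2 2 - q * k 3 2) - 2 * p * q * k 1 2"
    "ev (Dp (leg_a k)) p q = k 1 1 + (p * k 1 6 - k 2 6 - q * k 3 6) + p * k 1 6
       + 2 * p * (p * k 1 2 - k 2 2 - q * k 3 2) + p^2 * k 1 2"
    "ev (Dq (leg_c k)) p q = - k 3 3 - (p * k 1 4 - k 2 4 - q * k 3 4) + q * k 3 4
       + 2 * q * (p * k 1 2 - k 2 2 - q * k 3 2) - q^2 * k 3 2"
    "ev (Dq (leg_b k)) p q = - k 3 5 - (p * k 1 6 - k 2 6 - q * k 3 6) + q * k 3 6 - p * k 3 4
       - 2 * p * (p * k 1 2 - k 2 2 - q * k 3 2) + 2 * p * q * k 3 2"
    "ev (Dq (leg_a k)) p q = - k 3 1 - p * k 3 6 - p^2 * k 3 2"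
    unfolding leg_a_def leg_b_def leg_c_def
    by (simp_all add: c pderiv_add pderiv_diff pderiv_mult Dq_add Dq_diff Dq_mult pderiv_pCons
        power2_eq_square algebra_simps del: mult_pCons_left mult_pCons_right)
  note d = this
  show ?thesis
    unfolding d field_form_nth quad_def on_line_nth by algebra
qed

lemma tangency_disc_on_line:
  "tangency_disc (field_form k) (on_line p q 1 0) (on_line p q 0 1) = ev (leg_disc k) p q"
proof -
  have "tangency_disc (field_form k) (on_line p q 1 0) (on_line p q 0 1)
     = (- ev (leg_b k) p q)^2 - 4 * (- ev (leg_a k) p q) * (- ev (leg_c k) p q)"
  proof (rule tangency_disc_eq)
    fix y
    have "on_line p q 1 0 + y *s on_line p q 0 1 = on_line p q 1 y"
      by (simp add: vec3_eq_iff algebra_simps)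
    moreover have "pair (field_form k (on_line p q 1 y)) (on_line p q 0 1)
       = - (ev (leg_a k) p q + ev (leg_b k) p q * y + ev (leg_c k) p q * y^2)"
      unfolding pair_eq field_form_on_line by (simp add: algebra_simps)
    ultimately show "pair (field_form k (on_line p q 1 0 + y *s on_line p q 0 1)) (on_line p q 0 1)
       = - ev (leg_a k) p q + - ev (leg_b k) p q * y + - ev (leg_c k) p q * y^2"
      by (simp add: algebra_simps)
  qed
  then show ?thesis by (simp add: ev_leg_disc)
qed

text \<open>The line joining \<open>v\<close> and \<open>w\<close> has coefficients
  \<open>n\<close>; solving for the second coordinate gives its parameters, and \<open>n$2\<close>
  is the determinant relating the basis \<open>v\<close>, \<open>w\<close> to the standard
  one.\<close>

lemma tangency_disc_leg_disc:
  fixes v w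
  defines "n \<equiv> crs w v"
  assumes n2: "n$2 \<noteq> 0"
  shows "tangency_disc (field_form k) v w = (n$2)^4 * ev (leg_disc k) (- n$1 / n$2) (n$3 / n$2)"
proof -
  define p q where "p = - n$1 / n$2" and "q = n$3 / n$2"
  have on: "u = u$1 *s on_line p q 1 0 + u$3 *s on_line p q 0 1" if "pair n u = 0" for u
  proof -
    have "n$2 * u$2 = n$2 * (p * u$1 - q * u$3)"
      using that n2 unfolding p_def q_def pair_eq by (simp add: field_simps) algebra
    then have "u$2 = p * u$1 - q * u$3" unfolding mult_left_cancel[OF n2] .
    then show ?thesis by (simp add: vec3_eq_iff algebra_simps)
  qed
  have "pair n v = 0" "pair n w = 0"
    unfolding n_def pair_eq crs_nth by algebra+
  then have "tangency_disc (field_form k) v w = tangency_disc (field_form k)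
     (v$1 *s on_line p q 1 0 + v$3 *s on_line p q 0 1) (w$1 *s on_line p q 1 0 + w$3 *s on_line p q 0 1)"
    using on by metis
  also have "\<dots> = (v$1 * w$3 - v$3 * w$1)^4 * ev (leg_disc k) p q"
    unfolding tangency_disc_basis_change tangency_disc_on_line ..
  also have "v$1 * w$3 - v$3 * w$1 = n$2"
    by (simp add: n_def)
  finally show ?thesis unfolding p_def q_def .
qed

section \<open>Radial points as linear components of the discriminant\<close>

lemma tangency_disc_isCont:
  "isCont (\<lambda>t. tangency_disc (field_form k) (v + t *s v') (w + t *s w')) a"
  unfolding tangency_disc_field_form pair_eq quad_def polar_def crs_nth qfield_nth pfield_nth
    vector_add_component vector_smult_component
  by (intro continuous_intros)

lemma punctured_zero:
  fixes f :: "complex \<Rightarrow> complex"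
  assumes "isCont f 0" "\<And>t. t \<noteq> 0 \<Longrightarrow> f t = 0"
  shows "f 0 = 0"
proof -
  have "(f \<longlongrightarrow> f 0) (at 0)" using assms(1) by (simp add: isCont_def)
  moreover have "(f \<longlongrightarrow> 0) (at 0)"
    by (rule tendsto_eventually) (auto simp: eventually_at_filter assms(2))
  ultimately show ?thesis by (rule LIM_unique)
qed

text \<open>Divisibility makes every line through \<open>s\<close> in the (p, q) chart doubly
  tangent. The lines through \<open>e2\<close> are outside the chart and are reached by
  continuity.\<close>

lemma radial_if_lin_dvd:
  assumes s: "crs s e2 \<noteq> 0" and dvd: "lin s dvd leg_disc k"
  shows "radial (field_form k) s"
  unfolding radial_def
proof (intro conjI allI)
  let ?T = "tangency_disc (field_form k)"
  show "s \<noteq> 0" using s by (auto simp: vec3_eq_iff)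
  have gen: "?T s w = 0" if n2: "crs w s $ 2 \<noteq> 0" for w
  proof -
    define n where "n = crs w s"
    have "ev (lin s) (- n$1 / n$2) (n$3 / n$2) = - (n$1 * s$1 + n$2 * s$2 + n$3 * s$3) / n$2"
      using n2 by (simp add: ev_lin n_def[symmetric] field_simps)
    also have "n$1 * s$1 + n$2 * s$2 + n$3 * s$3 = 0"
      unfolding n_def crs_nth by algebra
    finally have "ev (leg_disc k) (- n$1 / n$2) (n$3 / n$2) = 0"
      using ev_dvd[OF dvd] by simp
    then show ?thesis
      using tangency_disc_leg_disc[OF n2] by (simp add: n_def)
  qed
  fix w
  show "?T s w = 0"
  proof (cases "crs w s $ 2 = 0")
    case True
    obtain w' where w': "crs w' s $ 2 \<noteq> 0"
    proof -
      have "s$1 \<noteq> 0 \<or> s$3 \<noteq> 0" using s by (auto simp: vec3_eq_iff vector_3)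
      then have "crs (vector [0, 0, 1]) s $ 2 \<noteq> 0 \<or> crs (vector [1, 0, 0]) s $ 2 \<noteq> 0"
        by (auto simp: vector_3)
      then show thesis using that by blast
    qed
    have "?T (s + 0 *s 0) (w + 0 *s w') = 0"
    proof (rule punctured_zero[OF tangency_disc_isCont])
      fix t :: complex assume "t \<noteq> 0"
      have "crs (w + t *s w') s $ 2 = crs w s $ 2 + t * crs w' s $ 2"
        by (simp add: algebra_simps)
      then have "crs (w + t *s w') s $ 2 \<noteq> 0" using True w' \<open>t \<noteq> 0\<close> by simp
      then show "?T (s + t *s 0) (w + t *s w') = 0"
        using gen by simp
    qed
    then show ?thesis by simp
  qed (rule gen)
qed

text \<open>Along the path of \<open>radial_tangency_order\<close>, \<open>lin s\<close> is O(t), so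
  a square factor would make the discriminant \<open>t^2\<close> times a function continuous at 0,
  with derivative 0 instead of \<kappa>.\<close>

lemma lin_square_not_dvd:
  assumes nd: "nondegenerate_form (field_form k)" and rad: "radial (field_form k) s"
    and s: "crs s e2 \<noteq> 0"
  shows "\<not> lin s * lin s dvd leg_disc k"
proof
  let ?T = "tangency_disc (field_form k)"
  assume "lin s * lin s dvd leg_disc k"
  then obtain H where H: "leg_disc k = lin s * lin s * H" by (elim dvdE)
  obtain r w \<kappa> where rw: "crs w s $ 2 \<noteq> 0" "\<kappa> \<noteq> 0"
    "((\<lambda>t. ?T (s + t *s r) w) has_field_derivative \<kappa>) (at 0)"
    using radial_tangency_order[OF nd rad s] .
  define n where "n = (\<lambda>t. crs w (s + t *s r))"
  define K where "K = (\<lambda>t. (n t$2)^2 * (pair (crs w r) s)^2 * ev H (- n t$1 / n t$2) (n t$3 / n t$2))"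
  have n: "n t $ i = crs w s $ i + t * crs w r $ i" for t i
    using exhaust_3[of i] by (auto simp: n_def algebra_simps)
  have contn: "isCont (\<lambda>t. n t $ i) 0" for i
    unfolding n by (intro continuous_intros)
  have n0: "n 0 $ 2 \<noteq> 0" using rw by (simp add: n)
  have "isCont K 0"
  proof -
    have "isCont (\<lambda>t. (- n t$1 / n t$2, n t$3 / n t$2)) 0"
      by (intro continuous_intros contn n0)
    from isCont_o2[OF this isCont_ev[where P = H]] show ?thesis
      unfolding K_def by (intro continuous_intros contn) simp
  qed
  have T: "?T (s + t *s r) w = t * (t * K t)" if "n t $ 2 \<noteq> 0" for t
  proof -
    have "?T (s + t *s r) w
        = (n t$2)^4 * ev (leg_disc k) (- n t$1 / n t$2) (n t$3 / n t$2)"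
      using tangency_disc_leg_disc[of w "s + t *s r" k] that unfolding n_def by blast
    also have "\<dots> = (n t$2)^2 * (n t$2 * ev (lin s) (- n t$1 / n t$2) (n t$3 / n t$2))^2
        * ev H (- n t$1 / n t$2) (n t$3 / n t$2)"
      unfolding H by (simp add: power2_eq_square power4_eq_xxxx)
    also have "n t$2 * ev (lin s) (- n t$1 / n t$2) (n t$3 / n t$2) = - (n t$1 * s$1 + n t$2 * s$2 + n t$3 * s$3)"
      using that by (simp add: ev_lin field_simps)
    also have "n t$1 * s$1 + n t$2 * s$2 + n t$3 * s$3 = t * pair (crs w r) s"
      unfolding n_def pair_eq by (simp add: algebra_simps)
    finally show ?thesis by (simp add: K_def power2_eq_square algebra_simps)
  qed
  have "eventually (\<lambda>t. n t $ 2 \<noteq> 0) (at 0)"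
    using tendsto_imp_eventually_ne[OF contn[of 2, unfolded isCont_def] n0] .
  then have ev_eq: "eventually (\<lambda>h. (?T (s + (0 + h) *s r) w
      - ?T (s + 0 *s r) w) / h = h * K h) (at 0)"
    using T[OF n0] by (auto elim!: eventually_mono simp: T eventually_at_filter)
  have "((\<lambda>h. h * K h) \<longlongrightarrow> 0 * K 0) (at 0)"
    using \<open>isCont K 0\<close> unfolding isCont_def by (intro tendsto_mult) auto
  then have "((\<lambda>h. (?T (s + (0 + h) *s r) w
      - ?T (s + 0 *s r) w) / h) \<longlongrightarrow> 0 * K 0) (at 0)"
    using tendsto_cong[OF ev_eq] by blast
  then have "\<kappa> = 0 * K 0"
    using rw(3) unfolding DERIV_def by (rule LIM_unique[rotated])
  with rw(2) show False by simp
qed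


section \<open>Components of the discriminant\<close>

text \<open>For nonzero \<open>G\<close>: closedness of
  \<open>M / (2 * G) dp + N / (4 * G) dq\<close>, cleared of denominators.\<close>

definition flat_at :: "complex poly poly \<Rightarrow> complex poly poly \<Rightarrow> complex poly poly \<Rightarrow> bool" where
  "flat_at G N M \<longleftrightarrow> G * (Dp N - 2 * Dq M) = N * Dp G - 2 * M * Dq G"

lemma flat_at_cancel:
  assumes "flat_at (c * G) (c * N) (c * M)" "c \<noteq> 0"
  shows "flat_at G N M"
proof -
  have "(c * G) * (Dp (c * N) - 2 * Dq (c * M)) - ((c * N) * Dp (c * G) - 2 * (c * M) * Dq (c * G))
     = c * (c * (G * (Dp N - 2 * Dq M) - (N * Dp G - 2 * M * Dq G)))"
    by (simp add: pderiv_mult Dq_mult algebra_simps)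
  then have "c * (c * (G * (Dp N - 2 * Dq M) - (N * Dp G - 2 * M * Dq G))) = 0"
    using assms(1) unfolding flat_at_def by simp
  then show ?thesis
    using assms(2) unfolding flat_at_def by simp
qed

text \<open>After cancellation \<open>f\<close> occurs once in the denominator. Modulo
  \<open>f\<close>, closedness leaves only the coefficient of the double pole, \<open>g\<close>
  times the expression in the conclusion.\<close>

lemma flat_at_pole:
  assumes flat: "flat_at (c * (f * g)) (c * N) (c * M)" and c: "c \<noteq> 0"
    and f: "prime_elem f" and g: "\<not> f dvd g"
  shows "f dvd N * Dp f - 2 * M * Dq f"
proof -
  have "(f * g) * (Dp N - 2 * Dq M) = N * Dp (f * g) - 2 * M * Dq (f * g)"
    using flat_at_cancel[OF flat c] unfolding flat_at_def .
  then have "g * (N * Dp f - 2 * M * Dq f) = f * (g * (Dp N - 2 * Dq M) - (N * Dp g - 2 * M * Dq g))"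
    by (simp add: pderiv_mult Dq_mult algebra_simps)
  then have "f dvd g * (N * Dp f - 2 * M * Dq f)"
    by simp
  then show ?thesis
    using f g prime_elem_dvd_multD by blast
qed

lemma mult_Dp_power: "f * Dp (f ^ n) = of_nat n * f ^ n * Dp f"
  by (induction n) (simp_all add: pderiv_mult algebra_simps)

lemma not_dvd_Dp:
  fixes f :: "complex poly poly"
  assumes "degree f > 0"
  shows "\<not> f dvd Dp f"
proof
  assume "f dvd Dp f"
  moreover have "Dp f \<noteq> 0" using assms by (simp add: pderiv_eq_0_iff)
  ultimately have "degree f \<le> degree (Dp f)" by (rule dvd_imp_degree_le)
  with assms show False by (simp add: degree_pderiv)
qed

lemma prime_elem_not_dvd_const:
  fixes f :: "complex poly poly"
  assumes "prime_elem f" "c \<noteq> 0"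
  shows "\<not> f dvd cst c"
  using assms unit_const dvd_unit_imp_unit prime_elem_not_unit by blast

lemma of_nat_cst: "of_nat n = cst (of_nat n)"
  by (simp add: of_nat_poly)

lemma numeral_cst: "numeral n = cst (numeral n)"
  by (simp add: numeral_poly)

text \<open>
  The curvature has a double pole along a component \<open>f\<close> of the discriminant, unless
  \<open>f\<close> is invariant by the web.
\<close>

lemma flat_disc_component:
  fixes \<beta> \<gamma> f :: "complex poly poly"
  assumes flat: "flat_at (\<gamma> * \<Delta>) (eta_q \<beta> \<Delta>) (eta_p \<gamma> \<Delta>)"
    and f: "prime_elem f" "degree f > 0" and "\<not> f dvd \<gamma>"
    and \<Delta>: "\<Delta> = f ^ Suc n * u" "\<not> f dvd u"
  shows "f dvd \<beta> * Dp f - 2 * \<gamma> * Dq f"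
proof -
  \<comment> \<open>What remains of the numerators of \<eta> after removing \<open>f ^ n\<close>.
    Modulo \<open>f\<close> they are \<beta> and \<gamma> times
    \<open>of_nat (Suc n) * u * Dp f\<close>. The resulting divisibility means invariance: on
    \<Delta> = 0 the double root satisfies \<open>\<beta> x = - 2 \<gamma>\<close>, and tangency to
    \<open>f = 0\<close> is \<open>Dp f + x * Dq f = 0\<close>.\<close>
  define N M where "N = \<beta> * (of_nat (Suc n) * u * Dp f + f * Dp u) - 2 * f * u * Dp \<beta>"
    and "M = \<gamma> * (of_nat (Suc n) * u * Dp f + f * Dp u) - 2 * Dp \<gamma> * f * u"
  have "Dp \<Delta> = f ^ n * (of_nat (Suc n) * u * Dp f + f * Dp u)"
    using mult_Dp_power[of f n] unfolding \<Delta>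
    by (simp add: pderiv_mult algebra_simps)
  then have "eta_q \<beta> \<Delta> = f ^ n * N" "eta_p \<gamma> \<Delta> = f ^ n * M" "\<gamma> * \<Delta> = f ^ n * (f * (\<gamma> * u))"
    unfolding N_def M_def eta_q_def eta_p_def \<Delta> by (simp_all add: algebra_simps)
  moreover have "\<not> f dvd \<gamma> * u"
    using f \<open>\<not> f dvd \<gamma>\<close> \<Delta> prime_elem_dvd_multD by blast
  moreover have "f ^ n \<noteq> 0" using f by (auto simp: prime_elem_def)
  ultimately have "f dvd N * Dp f - 2 * M * Dq f"
    using flat_at_pole[OF _ _ f(1)] flat by metis
  also have "N * Dp f - 2 * M * Dq f = f * ((\<beta> * Dp u - 2 * u * Dp \<beta>) * Dp f - 2 * (\<gamma> * Dp u - 2 * Dp \<gamma> * u) * Dq f)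
      + of_nat (Suc n) * u * Dp f * (\<beta> * Dp f - 2 * \<gamma> * Dq f)"
    unfolding N_def M_def by (simp only: ring_distribs mult_ac) (simp add: algebra_simps)
  finally have "f dvd of_nat (Suc n) * u * Dp f * (\<beta> * Dp f - 2 * \<gamma> * Dq f)"
    by (simp add: dvd_add_right_iff)
  moreover have "\<not> f dvd of_nat (Suc n)"
    unfolding of_nat_cst[of "Suc n"] by (rule prime_elem_not_dvd_const[OF f(1)]) (simp del: of_nat_Suc)
  ultimately show ?thesis
    using f \<Delta>(2) not_dvd_Dp[OF f(2)] prime_elem_dvd_multD by blast
qed

text \<open>The case in which the double direction along \<open>f\<close> is also the direction x =
  0. Here \<open>f\<close> divides \<Delta> exactly once and cancels from \<eta>, so the surviving
  double pole involves the quotients \<open>b\<close> and \<open>c\<close>.\<close>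

lemma flat_disc_common_component:
  fixes \<alpha> \<beta> \<gamma> f :: "complex poly poly"
  assumes flat: "flat_at (\<gamma> * \<Delta>) (eta_q \<beta> \<Delta>) (eta_p \<gamma> \<Delta>)"
    and f: "prime_elem f" "degree f > 0"
    and \<Delta>: "\<Delta> = web_disc \<alpha> \<beta> \<gamma>" and \<beta>: "\<beta> = f * b" and \<gamma>: "\<gamma> = f * c"
    and "\<not> f dvd \<alpha>" "\<not> f dvd c"
  shows "f dvd b * Dp f - 2 * c * Dq f"
proof -
  define u where "u = f * b^2 - 4 * \<alpha> * c"
  have \<Delta>u: "\<Delta> = f * u"
    unfolding \<Delta> web_disc_def \<beta> \<gamma> u_def by (simp add: power2_eq_square algebra_simps)
  have "\<not> f dvd 4" unfolding numeral_cst[of "num.Bit0 (num.Bit0 num.One)"]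
    by (rule prime_elem_not_dvd_const[OF f(1)]) simp
  then have "\<not> f dvd 4 * \<alpha> * c"
    using assms prime_elem_dvd_multD by blast
  then have u: "\<not> f dvd u"
    unfolding u_def by (simp add: dvd_diff_right_iff)
  define N M where "N = f * (b * Dp u - 2 * u * Dp b) - u * b * Dp f"
    and "M = f * (c * Dp u - 2 * u * Dp c) - u * c * Dp f"
  have "eta_q \<beta> \<Delta> = f * N" "eta_p \<gamma> \<Delta> = f * M" "\<gamma> * \<Delta> = f * (f * (c * u))"
    unfolding N_def M_def eta_q_def eta_p_def \<Delta>u \<beta> \<gamma> by (simp_all add: pderiv_mult algebra_simps)
  moreover have "\<not> f dvd c * u"
    using f assms u prime_elem_dvd_multD by blast
  moreover have "f \<noteq> 0" using f by auto
  ultimately have "f dvd N * Dp f - 2 * M * Dq f"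
    using flat_at_pole[OF _ _ f(1)] flat by metis
  also have "N * Dp f - 2 * M * Dq f = f * ((b * Dp u - 2 * u * Dp b) * Dp f - 2 * (c * Dp u - 2 * u * Dp c) * Dq f)
      - u * Dp f * (b * Dp f - 2 * c * Dq f)"
    unfolding N_def M_def by (simp add: algebra_simps)
  finally have "f dvd u * Dp f * (b * Dp f - 2 * c * Dq f)"
    by (simp add: dvd_diff_right_iff)
  then show ?thesis
    using f u not_dvd_Dp[OF f(2)] prime_elem_dvd_multD by blast
qed

text \<open>Over the complex numbers such a factor is a multiple of \<open>q - q0\<close>, the dual
  line of the point (0, -q0, 1) of the base line x = 0.\<close>

lemma irreducible_degree_0:
  fixes f :: "complex poly poly"
  assumes f: "irreducible f" "degree f = 0"
  obtains c s where "c \<noteq> 0" "f = smult [:c:] (lin s)" "crs s e2 \<noteq> 0"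
proof -
  obtain a where a: "f = [:a:]" using f by (auto elim: degree_eq_zeroE)
  have "degree a \<noteq> 0"
  proof
    assume "degree a = 0"
    then obtain c where "a = [:c:]" by (auto elim: degree_eq_zeroE)
    with f a show False
      using unit_const[of c] by (cases "c = 0") (auto simp: irreducible_def)
  qed
  then have "\<not> constant (poly a)" by (simp add: constant_degree)
  then obtain q0 where "poly a q0 = 0" using fundamental_theorem_of_algebra by blast
  then obtain b where "a = [:- q0, 1:] * b" unfolding poly_eq_0_iff_dvd by (elim dvdE)
  then have fb: "f = [:[:- q0, 1:]:] * [:b:]" by (simp add: a)
  have "\<not> is_unit [:[:- q0, 1:]:]"
    by (simp add: is_unit_const_poly_iff is_unit_poly_iff)
  then have "is_unit [:b:]" using irreducibleD[OF f(1) fb] by blast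
  then obtain c where c: "b = [:c:]" "c \<noteq> 0" by (auto simp: is_unit_poly_iff is_unit_const_poly_iff dvd_field_iff)
  have "f = smult [:- c:] (lin (vector [0, - q0, 1]))"
    unfolding fb c lin_def by (simp add: vector_3)
  moreover have "crs (vector [0, - q0, 1]) e2 \<noteq> 0" by (simp add: vec3_eq_iff vector_3)
  ultimately show thesis using that[of "- c"] c by simp
qed

lemma infinite_curve_not_singular:
  assumes nd: "nondegenerate_form (field_form k)"
    and h: "\<And>t. h t \<noteq> 0" "\<And>t::complex. field_form k (h t) = 0"
    and indep: "\<And>t t'. t \<noteq> t' \<Longrightarrow> crs (h t) (h t') \<noteq> 0"
  shows False
proof -
  obtain S where S: "finite S" "0 \<notin> S" "\<And>v. v \<noteq> 0 \<Longrightarrow> field_form k v = 0 \<Longrightarrow> \<exists>s\<in>S. \<exists>c. v = c *s s"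
    using finite_singularities[OF nd] by blast
  have "\<forall>t. \<exists>s. s \<in> S \<and> (\<exists>c. h t = c *s s)"
    using S(3)[OF h] by blast
  then obtain s where s: "\<And>t. s t \<in> S \<and> (\<exists>c. h t = c *s s t)"
    using choice[of "\<lambda>t s. s \<in> S \<and> (\<exists>c. h t = c *s s)"] by blast
  have "inj s"
  proof (rule injI, rule ccontr)
    fix t t' assume "s t = s t'" "t \<noteq> t'"
    then obtain c c' where "h t = c *s s t" "h t' = c' *s s t" using s by metis
    then have "crs (h t) (h t') = 0" by (simp add: vec3_eq_iff)
    with indep \<open>t \<noteq> t'\<close> show False by blast
  qed
  then have "infinite (range s)" using finite_imageD infinite_UNIV_char_0 by blast
  moreover have "range s \<subseteq> S" using s by blast
  ultimately show False using S(1) finite_subset by blast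
qed

text \<open>Each vanishing would give a line of singular points: z = 0 for \<open>leg_a\<close>, x =
  0 for \<open>leg_c\<close>, and y = 0, through radial points, for \<open>leg_disc\<close>.\<close>

lemma leg_nonzero:
  assumes nd: "nondegenerate_form (field_form k)"
  shows "leg_a k \<noteq> 0" "leg_c k \<noteq> 0" "leg_disc k \<noteq> 0"
proof -
  show "leg_a k \<noteq> 0"
  proof
    assume "leg_a k = 0"
    then have "ev (leg_a k) p q = 0" for p q by simp
    then have 0: "p * quad (k 1) (on_line p 0 1 0) - quad (k 2) (on_line p 0 1 0) - q * quad (k 3) (on_line p 0 1 0) = 0" for p q
      using leg_quadratic[of p k q 1 0] by (simp add: on_line_def)
    show False
    proof (rule infinite_curve_not_singular[OF nd])
      fix t t' :: complex
      have "quad (k 3) (on_line t 0 1 0) = 0"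
        using 0[of t 0] 0[of t 1] by simp
      moreover have "quad (k 2) (on_line t 0 1 0) = t * quad (k 1) (on_line t 0 1 0)"
        using 0[of t 0] by simp
      ultimately show "field_form k (on_line t 0 1 0) = 0"
        unfolding vec3_eq_iff field_form_nth by simp
      show "on_line t 0 1 0 \<noteq> 0" by (simp add: vec3_eq_iff)
      assume "t \<noteq> t'"
      then show "crs (on_line t 0 1 0) (on_line t' 0 1 0) \<noteq> 0" by (simp add: vec3_eq_iff)
    qed
  qed
  show "leg_c k \<noteq> 0"
  proof
    assume "leg_c k = 0"
    then have "ev (leg_c k) p q = 0" for p q by simp
    then have 0: "p * quad (k 1) (on_line 0 q 0 1) - quad (k 2) (on_line 0 q 0 1) - q * quad (k 3) (on_line 0 q 0 1) = 0" for p q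
      using leg_quadratic[of p k q 0 1] by (simp add: on_line_def)
    show False
    proof (rule infinite_curve_not_singular[OF nd])
      fix t t' :: complex
      have "quad (k 1) (on_line 0 t 0 1) = 0"
        using 0[of 0 t] 0[of 1 t] by algebra
      moreover have "quad (k 2) (on_line 0 t 0 1) = - t * quad (k 3) (on_line 0 t 0 1)"
        using 0[of 0 t] by algebra
      ultimately show "field_form k (on_line 0 t 0 1) = 0"
        unfolding vec3_eq_iff field_form_nth by simp
      show "on_line 0 t 0 1 \<noteq> 0" by (simp add: vec3_eq_iff)
      assume "t \<noteq> t'"
      then show "crs (on_line 0 t 0 1) (on_line 0 t' 0 1) \<noteq> 0" by (simp add: vec3_eq_iff)
    qed
  qed
  show "leg_disc k \<noteq> 0"
  proof
    assume 0: "leg_disc k = 0"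
    show False
    proof (rule infinite_curve_not_singular[OF nd])
      fix t t' :: complex
      have "crs (vector [1, 0, t]) e2 \<noteq> 0" by (simp add: vec3_eq_iff vector_3)
      then have "radial (field_form k) (vector [1, 0, t])"
        by (rule radial_if_lin_dvd) (simp add: 0)
      then show "field_form k (vector [1, 0, t]) = 0" by (rule radial_singular[OF nd])
      show "vector [1, 0, t] \<noteq> (0 :: complex^3)" by (simp add: vec3_eq_iff vector_3)
      assume "t \<noteq> t'"
      then show "crs (vector [1, 0, t]) (vector [1, 0, t']) \<noteq> 0" by (simp add: vec3_eq_iff vector_3)
    qed
  qed
qed

text \<open>Write 4 \<gamma> times the tangency form as
  \<open>(\<beta> x + 2 \<gamma> z)^2 - \<Delta> x^2\<close>. At the double tangency point, its
  derivative in the direction (z, x) is, up to a factor, that of \<Delta> along the double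
  direction, which invariance makes zero. So this point is singular, and the lines of the curve pass
  through finitely many points.\<close>

lemma invariant_component_is_lin:
  assumes nd: "nondegenerate_form (field_form k)"
    and f: "prime_elem f" "degree f > 0" "f dvd leg_disc k" "\<not> f dvd leg_c k"
    and inv: "f dvd leg_b k * Dp f - 2 * leg_c k * Dq f"
    and deg: "degree (leg_c k) \<le> 1"
  shows "\<exists>s c. s$1 \<noteq> 0 \<and> c \<noteq> 0 \<and> f = smult [:c:] (lin s)"
proof -
  let ?\<alpha> = "leg_a k" and ?\<beta> = "leg_b k" and ?\<gamma> = "leg_c k" and ?\<Delta> = "leg_disc k"
  obtain S where S: "finite S" "0 \<notin> S" "\<And>v. v \<noteq> 0 \<Longrightarrow> field_form k v = 0 \<Longrightarrow> \<exists>s\<in>S. \<exists>c. v = c *s s"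
    using finite_singularities[OF nd] by blast
  have irr: "irreducible f" using f by (simp add: prime_elem_iff_irreducible)
  obtain B where B: "finite B" "\<And>p q. ev f p q = 0 \<Longrightarrow> ev ?\<gamma> p q = 0 \<Longrightarrow> q \<in> B"
    using finite_common_zeros[OF irr f(4) deg] by blast
  obtain u where u: "?\<Delta> = f * u" using f(3) by (elim dvdE)
  have "\<exists>s\<in>S. p * s$1 - s$2 - q * s$3 = 0" if "q \<notin> B" "ev f p q = 0" for p q
  proof -
    \<comment> \<open>The double root (x : z) = (-2 \<gamma> : \<beta>); excluding the common zeros
      of \<open>f\<close> and \<gamma> ensures that the vector is nonzero.\<close>
    define V where "V = on_line p q (- 2 * ev ?\<gamma> p q) (ev ?\<beta> p q)"
    have \<gamma>: "ev ?\<gamma> p q \<noteq> 0" using B that by blast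
    have \<Delta>: "ev ?\<Delta> p q = 0" using u that by simp
    then have disc: "ev ?\<beta> p q ^ 2 = 4 * ev ?\<alpha> p q * ev ?\<gamma> p q" by (simp add: ev_leg_disc)
    then have F: "ev ?\<alpha> p q * (- 2 * ev ?\<gamma> p q)^2 + ev ?\<beta> p q * (- 2 * ev ?\<gamma> p q) * ev ?\<beta> p q + ev ?\<gamma> p q * ev ?\<beta> p q ^ 2 = 0"
      by algebra
    have d\<Delta>: "ev (Dp ?\<Delta>) p q = ev u p q * ev (Dp f) p q" "ev (Dq ?\<Delta>) p q = ev u p q * ev (Dq f) p q"
      unfolding u using that by (simp_all add: pderiv_mult Dq_mult)
    have "ev ?\<beta> p q * ev (Dp f) p q - 2 * ev ?\<gamma> p q * ev (Dq f) p q = 0"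
      using ev_dvd[OF inv that(2)] by simp
    then have "ev ?\<beta> p q * ev (Dp ?\<Delta>) p q - 2 * ev ?\<gamma> p q * ev (Dq ?\<Delta>) p q = 0"
      unfolding d\<Delta> by algebra
    moreover have "ev (Dp ?\<Delta>) p q = 2 * ev ?\<beta> p q * ev (Dp ?\<beta>) p q
        - 4 * (ev ?\<alpha> p q * ev (Dp ?\<gamma>) p q + ev (Dp ?\<alpha>) p q * ev ?\<gamma> p q)"
      "ev (Dq ?\<Delta>) p q = 2 * ev ?\<beta> p q * ev (Dq ?\<beta>) p q
        - 4 * (ev ?\<alpha> p q * ev (Dq ?\<gamma>) p q + ev (Dq ?\<alpha>) p q * ev ?\<gamma> p q)"
      unfolding leg_disc_def web_disc_def
      by (simp_all add: pderiv_diff pderiv_mult Dq_diff Dq_mult Dp_power2 Dq_power2 algebra_simps)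
    ultimately have "field_form k V $ 2 = 0"
      unfolding V_def field_form_on_line2 using disc by algebra
    then have "field_form k V = 0"
      using F unfolding V_def vec3_eq_iff field_form_on_line by simp
    moreover have "V \<noteq> 0" using \<gamma> by (simp add: V_def vec3_eq_iff)
    ultimately obtain s c where s: "s \<in> S" "V = c *s s" using S by blast
    then have "c \<noteq> 0" using \<open>V \<noteq> 0\<close> by auto
    have "p * V$1 - V$2 - q * V$3 = 0" by (simp add: V_def)
    then have "c * (p * s$1 - s$2 - q * s$3) = 0" unfolding s by (simp add: algebra_simps)
    with s \<open>c \<noteq> 0\<close> show ?thesis by auto
  qed
  from irreducible_eq_lin[OF irr f(2) S(1,2) B(1) this] show ?thesis by blast
qed

lemma leg_c_explicit:
  "leg_c k = [:[:- k 2 3, k 2 4 - k 3 3, k 3 4 - k 2 2, - k 3 2:], [:k 1 3, - k 1 4, k 1 2:]:]"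
  by (simp add: leg_c_def leg_coeff_def)

lemma leg_b_explicit:
  "leg_b k = [:[:- k 2 5, k 2 6 - k 3 5, k 3 6:],
     [:k 1 5 - k 2 4, 2 * k 2 2 - k 1 6 - k 3 4, 2 * k 3 2:], [:k 1 4, - 2 * k 1 2:]:]"
  by (simp add: leg_b_def leg_coeff_def numeral_poly)

lemma degree_leg: "degree (leg_c k) \<le> 1" "degree (leg_b k) \<le> 2"
  unfolding leg_c_explicit leg_b_explicit
  by (auto intro!: degree_pCons_le[THEN order_trans] simp: degree_pCons_le)

lemma poly_degree_le_1:
  fixes h :: "'a::zero poly"
  assumes "degree h \<le> 1"
  obtains r t where "h = [:r, t:]"
proof -
  obtain r h' where h: "h = pCons r h'" by (cases h) auto
  have "degree h' = 0" using assms unfolding h by (auto split: if_splits)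
  then show thesis using that h by (auto elim: degree_eq_zeroE)
qed

text \<open>Since \<open>leg_c k\<close> has degree at most one in p, \<open>f\<close> is linear in
  p and \<open>g\<close> is free of p. The divisibility along \<open>f\<close> becomes an identity
  linear in p; expanding it at q = 0 gives either a degenerate singularity at \<open>e3\<close> or
  \<open>k 1 2 = 0\<close>, both excluded.\<close>

lemma base_line_component_contradiction:
  assumes nd: "nondegenerate_form (field_form k)"
    and flat: "flat_at (leg_c k * leg_disc k) (eta_q (leg_b k) (leg_disc k)) (eta_p (leg_c k) (leg_disc k))"
    and f: "prime_elem f" "degree f > 0" "f dvd leg_c k" "f dvd leg_b k" "\<not> f dvd leg_a k"
    and k13: "k 1 3 = 0" and k12: "k 1 2 \<noteq> 0 \<or> k 1 4 = 0"
  shows False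
proof -
  obtain g h where g: "leg_c k = f * g" and h: "leg_b k = f * h"
    using f by (elim dvdE)
  have "f \<noteq> 0" using f by auto
  have "leg_c k \<noteq> 0" using leg_nonzero[OF nd] by blast
  then have "g \<noteq> 0" using g by auto
  then have "degree f + degree g \<le> 1"
    using degree_leg(1)[of k] \<open>f \<noteq> 0\<close> unfolding g by (simp add: degree_mult_eq)
  then have deg: "degree f = 1" "degree g = 0" using f by auto
  then obtain c where c: "g = [:c:]" by (auto elim: degree_eq_zeroE)
  obtain a b where ab: "f = [:a, b:]" using deg poly_degree_le_1[of f] by auto
  have "degree h \<le> 1"
  proof (cases "h = 0")
    case False
    then show ?thesis
      using degree_leg(2)[of k] \<open>f \<noteq> 0\<close> deg unfolding h by (simp add: degree_mult_eq)
  qed simp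
  then obtain r t where rt: "h = [:r, t:]" by (rule poly_degree_le_1)
  have "\<not> f dvd g"
    using deg \<open>g \<noteq> 0\<close> by (auto dest: dvd_imp_degree_le)
  have "f dvd h * Dp f - 2 * g * Dq f"
    by (rule flat_disc_common_component[OF flat f(1,2) leg_disc_def h g f(5) \<open>\<not> f dvd g\<close>])
  then obtain j where j: "h * Dp f - 2 * g * Dq f = f * j" by (elim dvdE)
  have hj: "h * Dp f - 2 * g * Dq f = [:r * b - 2 * c * pderiv a, t * b - 2 * c * pderiv b:]"
    unfolding rt c ab by (simp add: pderiv_pCons numeral_poly algebra_simps)
  have "degree j = 0"
  proof (cases "j = 0")
    case False
    have "degree (f * j) \<le> 1" unfolding j[symmetric] hj by (simp add: degree_pCons_le)
    then show ?thesis using False \<open>f \<noteq> 0\<close> deg by (simp add: degree_mult_eq)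
  qed simp
  then obtain \<kappa> where \<kappa>: "j = [:\<kappa>:]" by (auto elim: degree_eq_zeroE)
  have eqs: "c * a = [:- k 2 3, k 2 4 - k 3 3, k 3 4 - k 2 2, - k 3 2:]" "c * b = [:k 1 3, - k 1 4, k 1 2:]"
    using g unfolding leg_c_explicit c ab by (simp_all add: mult.commute)
  have eqs2: "r * a = [:- k 2 5, k 2 6 - k 3 5, k 3 6:]"
    "r * b + t * a = [:k 1 5 - k 2 4, 2 * k 2 2 - k 1 6 - k 3 4, 2 * k 3 2:]"
    "t * b = [:k 1 4, - 2 * k 1 2:]"
    using h unfolding leg_b_explicit rt ab by (simp_all add: mult.commute add.commute)
  have eqs3: "r * b - 2 * c * pderiv a = \<kappa> * a" "t * b - 2 * c * pderiv b = \<kappa> * b"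
    using trans[OF hj[symmetric] j] unfolding \<kappa> ab by (simp_all add: mult.commute)
  \<comment> \<open>Value and derivative at q = 0, the dual line of the tangency point
    \<open>e3\<close> of the base line.\<close>
  define v d where "v = (\<lambda>P::complex poly. poly P 0)" and "d = (\<lambda>P::complex poly. poly (pderiv P) 0)"
  note v = v_def d_def
  have 1: "v c * v a = - k 2 3" "v c * d a + v a * d c = k 2 4 - k 3 3"
    "v c * v b = 0" "v c * d b + v b * d c = - k 1 4"
    using arg_cong[OF eqs(1), of v] arg_cong[OF eqs(1), of d] arg_cong[OF eqs(2), of v] arg_cong[OF eqs(2), of d] k13
    unfolding v by (simp_all add: pderiv_mult pderiv_pCons)
  have 2: "v r * v a = - k 2 5" "v r * v b + v t * v a = k 1 5 - k 2 4"
    "v t * v b = k 1 4" "v t * d b + v b * d t = - 2 * k 1 2"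
    using arg_cong[OF eqs2(1), of v] arg_cong[OF eqs2(2), of v] arg_cong[OF eqs2(3), of v] arg_cong[OF eqs2(3), of d]
    unfolding v by (simp_all add: pderiv_mult pderiv_pCons)
  have 3: "v r * v b - 2 * v c * d a = v \<kappa> * v a" "v t * d b + v b * d t - 2 * (v c * v (pderiv (pderiv b)) + d b * d c) = v \<kappa> * d b + v b * d \<kappa>"
    using arg_cong[OF eqs3(1), of v] arg_cong[OF eqs3(2), of d]
    unfolding v by (simp_all add: pderiv_mult pderiv_diff numeral_poly pderiv_smult algebra_simps)
  have 4: "v c * v (pderiv (pderiv b)) + 2 * d c * d b + v b * v (pderiv (pderiv c)) = 2 * k 1 2"
    using arg_cong[OF eqs(2), of "\<lambda>P. v (pderiv (pderiv P))"]
    unfolding v by (simp add: pderiv_mult pderiv_add pderiv_pCons algebra_simps)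
  \<comment> \<open>Otherwise \<open>k 1 4 = 0\<close> as well, and the p-coefficient
    \<open>c * b\<close> of \<open>leg_c k\<close> would vanish although \<open>f\<close> has degree
    one.\<close>
  have "k 1 2 \<noteq> 0"
  proof
    assume 0: "k 1 2 = 0"
    with k12 k13 eqs(2) have "c * b = 0" by simp
    then show False using \<open>g \<noteq> 0\<close> deg unfolding c ab by auto
  qed
  \<comment> \<open>Otherwise both \<open>b\<close> and its derivative vanish at 0, which forces
    \<open>k 1 2 = 0\<close>. With \<open>v c = 0\<close> also \<open>k 2 3 = 0\<close>, so
    \<open>e3\<close> is singular.\<close>
  have vc: "v c = 0"
  proof (rule ccontr)
    assume nz: "v c \<noteq> 0"
    with 1 have vb: "v b = 0" by simp
    with 1 2 nz have "d b = 0" by simp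
    with vb 2(4) \<open>k 1 2 \<noteq> 0\<close> show False by simp
  qed
  show False
  proof (cases "v b = 0")
    case False
    have "v b * (v t + d c) = 0" using 1(4) 2(3) vc by algebra
    then have "v t = - d c" using False by (simp add: eq_neg_iff_add_eq_0)
    then have "(k 1 5 - k 3 3) * (k 2 4 - k 3 3) = k 1 4 * k 2 5"
      using 1 2 vc by algebra
    moreover have "invertible (mat 1 :: complex^3^3)" "pullback (mat 1) (field_form k) = field_form k"
      by (simp_all add: invertible_det_nz pullback_def fun_eq_iff transpose_mat)
    then have "(k 1 5 - k 3 3) * (k 2 4 - k 3 3) \<noteq> k 1 4 * k 2 5"
      using nd k13 1(1) vc unfolding nondegenerate_form_def by simp
    ultimately show False by simp
  next
    case True
    \<comment> \<open>If both \<open>a\<close> and \<open>b\<close> vanished at 0, q would divide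
      the irreducible \<open>f\<close>, which involves p.\<close>
    have "v a \<noteq> 0"
    proof
      assume "v a = 0"
      with True have "[:0, 1:] dvd a" "[:0, 1:] dvd b"
        unfolding v using poly_eq_0_iff_dvd[of a 0] poly_eq_0_iff_dvd[of b 0] by simp_all
      then obtain a' b' where "a = [:0, 1:] * a'" "b = [:0, 1:] * b'" by (elim dvdE)
      then have fac: "f = [:[:0, 1:]:] * [:a', b':]" by (simp add: ab)
      have "\<not> is_unit ([:[:0, 1:]:] :: complex poly poly)"
        by (simp add: is_unit_const_poly_iff is_unit_poly_iff)
      then have "is_unit [:a', b':]"
        using irreducibleD[OF _ fac] f(1) by (simp add: prime_elem_iff_irreducible)
      then have "degree [:a', b':] = 0" by (auto simp: is_unit_poly_iff)
      then have "b' = 0" by (auto split: if_splits)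
      with \<open>b = [:0, 1:] * b'\<close> deg show False by (simp add: ab)
    qed
    moreover have "v \<kappa> * v a = 0" using 3(1) True vc by simp
    ultimately have "v \<kappa> = 0" by simp
    then have "k 1 2 = 0" using 2(4) 3(2) 4 True vc by algebra
    with \<open>k 1 2 \<noteq> 0\<close> show False by simp
  qed
qed

text \<open>All lines on \<open>f = 0\<close> would be invariant. Their envelope points are
  singular, hence finite in number, so \<open>f\<close> is a dual line; but the square of
  \<open>f\<close> divides the discriminant, and radial points are simple components.\<close>

lemma totally_invariant_component_contradiction:
  assumes nd: "nondegenerate_form (field_form k)"
    and f: "prime_elem f" "degree f > 0" "f dvd leg_a k" "f dvd leg_b k" "f dvd leg_c k"
  shows False
proof -
  obtain a b c where abc: "leg_a k = f * a" "leg_b k = f * b" "leg_c k = f * c"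
    using f by (elim dvdE)
  have irr: "irreducible f" using f by (simp add: prime_elem_iff_irreducible)
  have "leg_c k \<noteq> 0" using leg_nonzero[OF nd] by blast
  then have "degree f \<le> 1" using dvd_imp_degree_le[OF f(5)] degree_leg(1)[of k] by linarith
  then have "degree (Dp f) \<le> 1" by (simp add: degree_pderiv)
  then obtain B where B: "finite B" "\<And>p q. ev f p q = 0 \<Longrightarrow> ev (Dp f) p q = 0 \<Longrightarrow> q \<in> B"
    using finite_common_zeros[OF irr not_dvd_Dp[OF f(2)]] by blast
  obtain S where S: "finite S" "0 \<notin> S" "\<And>v. v \<noteq> 0 \<Longrightarrow> field_form k v = 0 \<Longrightarrow> \<exists>s\<in>S. \<exists>c. v = c *s s"
    using finite_singularities[OF nd] by blast
  have "\<exists>s\<in>S. p * s$1 - s$2 - q * s$3 = 0" if "q \<notin> B" "ev f p q = 0" for p q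
  proof -
    \<comment> \<open>The point where the line touches the envelope of the family: its ratio x : z
      is the slope dq/dp of \<open>f = 0\<close>. There the second component, the tangency quotient
      times \<open>z * Dp f + x * Dq f\<close>, vanishes.\<close>
    define V where "V = on_line p q (- ev (Dp f) p q) (ev (Dq f) p q)"
    have "ev (Dp f) p q \<noteq> 0" using B that by blast
    then have "V \<noteq> 0" by (simp add: V_def vec3_eq_iff)
    have "field_form k V $ 2 = 0"
      unfolding V_def field_form_on_line2 abc by (simp add: pderiv_mult Dq_mult that(2)) algebra
    then have "field_form k V = 0"
      unfolding V_def vec3_eq_iff field_form_on_line abc using that(2) by simp
    then obtain s c where s: "s \<in> S" "V = c *s s" using S \<open>V \<noteq> 0\<close> by blast
    then have "c \<noteq> 0" using \<open>V \<noteq> 0\<close> by auto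
    have "p * V$1 - V$2 - q * V$3 = 0" by (simp add: V_def)
    then have "c * (p * s$1 - s$2 - q * s$3) = 0" unfolding s by (simp add: algebra_simps)
    with s \<open>c \<noteq> 0\<close> show ?thesis by auto
  qed
  from irreducible_eq_lin[OF irr f(2) S(1,2) B(1) this]
  obtain s c0 where s: "s$1 \<noteq> 0" "c0 \<noteq> 0" "f = smult [:c0:] (lin s)" by blast
  have e2: "crs s e2 \<noteq> 0" using s(1) by (simp add: vec3_eq_iff vector_3)
  have "leg_disc k = f * f * (b^2 - 4 * a * c)"
    unfolding leg_disc_def web_disc_def abc by (simp add: power2_eq_square algebra_simps)
  then have sq: "lin s * lin s dvd leg_disc k"
    unfolding s(3) by (simp add: dvd_smult)
  then have "radial (field_form k) s"
    using radial_if_lin_dvd[OF e2] dvd_mult_left by blast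
  then show False using lin_square_not_dvd[OF nd _ e2] sq by blast
qed

lemma disc_component_radial:
  assumes nd: "nondegenerate_form (field_form k)"
    and flat: "flat_at (leg_c k * leg_disc k) (eta_q (leg_b k) (leg_disc k)) (eta_p (leg_c k) (leg_disc k))"
    and k13: "k 1 3 = 0" and k12: "k 1 2 \<noteq> 0 \<or> k 1 4 = 0"
    and f: "prime_elem f" "f dvd leg_disc k"
  shows "\<exists>s c. c \<noteq> 0 \<and> f = smult [:c:] (lin s) \<and> crs s e2 \<noteq> 0 \<and> radial (field_form k) s"
proof -
  have "\<exists>s c. c \<noteq> 0 \<and> f = smult [:c:] (lin s) \<and> crs s e2 \<noteq> 0"
  proof (cases "degree f = 0")
    case True
    then show ?thesis
      using irreducible_degree_0[of f] f(1) by (metis prime_elem_iff_irreducible)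
  next
    case False
    then have deg: "degree f > 0" by simp
    have "\<not> f dvd leg_c k"
    proof
      assume c: "f dvd leg_c k"
      have "leg_b k ^ 2 = leg_disc k + 4 * leg_a k * leg_c k"
        by (simp add: leg_disc_def web_disc_def)
      then have "f dvd leg_b k ^ 2" using f(2) c by simp
      then have b: "f dvd leg_b k" using f(1) prime_elem_dvd_power by blast
      show False
        using totally_invariant_component_contradiction[OF nd f(1) deg _ b c]
          base_line_component_contradiction[OF nd flat f(1) deg c b _ k13 k12] by blast
    qed
    have "leg_disc k \<noteq> 0" "\<not> is_unit f"
      using leg_nonzero[OF nd] f(1) by auto
    then obtain u where u: "leg_disc k = f ^ multiplicity f (leg_disc k) * u" "\<not> f dvd u"
      using multiplicity_decompose' by metis
    have "multiplicity f (leg_disc k) \<noteq> 0"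
      using f(2) \<open>leg_disc k \<noteq> 0\<close> \<open>\<not> is_unit f\<close> by (simp add: multiplicity_eq_zero_iff)
    then obtain n where "multiplicity f (leg_disc k) = Suc n" by (cases "multiplicity f (leg_disc k)") auto
    with u have "leg_disc k = f ^ Suc n * u" by simp
    from flat_disc_component[OF flat f(1) deg \<open>\<not> f dvd leg_c k\<close> this u(2)]
    have "f dvd leg_b k * Dp f - 2 * leg_c k * Dq f" .
    from invariant_component_is_lin[OF nd f(1) deg f(2) \<open>\<not> f dvd leg_c k\<close> this degree_leg(1)]
    obtain s c where "s$1 \<noteq> 0" "c \<noteq> 0" "f = smult [:c:] (lin s)" by blast
    then show ?thesis by (intro exI[of _ s] exI[of _ c]) (simp add: vec3_eq_iff vector_3)
  qed
  then obtain s c where s: "c \<noteq> 0" "f = smult [:c:] (lin s)" "crs s e2 \<noteq> 0" by blast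
  then have "lin s dvd leg_disc k" using f(2) by (auto dest: smult_dvd_cancel)
  then show ?thesis using s radial_if_lin_dvd by blast
qed

text \<open>The dual line of \<open>e2\<close> is at infinity in the (p, q) chart. A line through
  \<open>e2\<close> that is not doubly tangent is a direction at infinity in which the quartic
  discriminant keeps its top-degree term.\<close>

lemma line_restriction_quartic:
  assumes "\<not> radial (field_form k) e2"
  obtains p1 q1 P where "degree P = 4" "\<And>t. ev (leg_disc k) (t * p1) (t * q1) = poly P t"
proof -
  let ?T = "tangency_disc (field_form k)"
  have nz: "e2 \<noteq> 0" by (simp add: vec3_eq_iff vector_3)
  have expand: "\<exists>c0 c1 c2 c3. \<forall>t. ?T (u + t *s w) m
      = poly [:c0, c1, c2, c3, ?T w m:] t" for u w m
  proof -
    define n0 n1 where "n0 = crs m u" and "n1 = crs m w"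
    have n: "crs m (u + t *s w) = n0 + t *s n1" for t
      by (simp add: n0_def n1_def vec3_eq_iff algebra_simps)
    have P: "pfield k (u + t *s w) m = pfield k u m + t *s pfield k w m" for t
      by (simp add: vec3_eq_iff polar_def algebra_simps)
    have Q: "qfield k (u + t *s w) = qfield k u + t *s pfield k u w + t^2 *s qfield k w" for t
      using qfield_comb[of k 1 u t w] by simp
    define A0 A1 A2 B0 B1 B2 B3 C0 C1 where "A0 = pair n0 (pfield k u m)"
      and "A1 = pair n0 (pfield k w m) + pair n1 (pfield k u m)" and "A2 = pair n1 (pfield k w m)"
      and "B0 = pair n0 (qfield k u)" and "B1 = pair n0 (pfield k u w) + pair n1 (qfield k u)"
      and "B2 = pair n0 (qfield k w) + pair n1 (pfield k u w)" and "B3 = pair n1 (qfield k w)"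
      and "C0 = pair n0 (qfield k m)" and "C1 = pair n1 (qfield k m)"
    have eq1: "?T (u + t *s w) m
       = (A0 + A1 * t + A2 * t^2)^2 - 4 * (B0 + B1 * t + B2 * t^2 + B3 * t^3) * (C0 + C1 * t)" for t
      unfolding tangency_disc_field_form n P Q pair_comb A0_def A1_def A2_def B0_def B1_def B2_def B3_def C0_def C1_def
      by algebra
    have eq2: "?T w m = A2^2 - 4 * B3 * C1"
      unfolding tangency_disc_field_form A2_def B3_def C1_def n1_def ..
    have "?T (u + t *s w) m =
       poly [:A0^2 - 4 * B0 * C0, 2 * A0 * A1 - 4 * (B0 * C1 + B1 * C0), A1^2 + 2 * A0 * A2 - 4 * (B1 * C1 + B2 * C0),
         2 * A1 * A2 - 4 * (B2 * C1 + B3 * C0), ?T w m:] t" for t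
      unfolding eq1 eq2 poly_pCons poly_0 by algebra
    then show ?thesis by blast
  qed
  obtain w where w: "?T e2 w \<noteq> 0"
    using assms nz unfolding radial_def by blast
  \<comment> \<open>All lines with parameters (t p1, t q1) pass through \<open>m\<close> and tend to
    the line joining \<open>e2\<close> and \<open>m\<close> as t grows, so the coefficient of
    \<open>t^4\<close> is a nonzero multiple of the discriminant of that line.\<close>
  define q1 p1 m where "q1 = w$1" and "p1 = w$3" and "m = (vector [w$1, 0, w$3] :: complex^3)"
  have "?T (1 *s e2 + 0 *s w) (- w$2 *s e2 + 1 *s w) = ?T e2 w"
    unfolding tangency_disc_basis_change by simp
  moreover have "- w$2 *s e2 + 1 *s w = m" by (simp add: m_def vec3_eq_iff vector_3)
  ultimately have m: "?T e2 m \<noteq> 0" using w by simp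
  have m_line: "m = q1 *s on_line (t * p1) (t * q1) 1 0 + p1 *s on_line (t * p1) (t * q1) 0 1" for t
    by (simp add: m_def p1_def q1_def vec3_eq_iff vector_3)
  have scale: "?T (c *s e2) m = c^4 * ?T e2 m" for c
    using tangency_disc_basis_change[of k c e2 0 m 0 1] by simp
  have div: "y = poly (smult (inverse x) Q) t" if "x \<noteq> 0" "x * y = poly Q t" for x y t :: complex and Q
    using that(1) by (simp add: that(2)[symmetric])
  have quartic: "\<exists>P. degree P = 4 \<and> (\<forall>t. ev (leg_disc k) (t * p1) (t * q1) = poly P t)"
    if c: "c \<noteq> 0" and eq: "\<And>t. c^4 * ev (leg_disc k) (t * p1) (t * q1) = ?T (u + t *s (c *s e2)) m"
    for c u
  proof -
    obtain c0 c1 c2 c3 where "\<And>t. ?T (u + t *s (c *s e2)) m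
      = poly [:c0, c1, c2, c3, ?T (c *s e2) m:] t"
      using expand by blast
    then have "ev (leg_disc k) (t * p1) (t * q1)
        = poly (smult (inverse (c^4)) [:c0, c1, c2, c3, c^4 * ?T e2 m:]) t" for t
      by (intro div[of "c^4"]) (use c in \<open>simp_all only: eq scale power_eq_0_iff simp_thms\<close>)
    moreover have "degree (smult (inverse (c^4)) [:c0, c1, c2, c3, c^4 * ?T e2 m:]) = 4"
      using c m by simp
    ultimately show ?thesis by blast
  qed
  have "\<exists>P. degree P = 4 \<and> (\<forall>t. ev (leg_disc k) (t * p1) (t * q1) = poly P t)"
  proof (cases "p1 = 0")
    case False
    then show ?thesis
    proof (rule quartic[where u = "vector [1, 0, 0]"])
      fix t
      have "p1^4 * ev (leg_disc k) (t * p1) (t * q1) = ?T (1 *s on_line (t * p1) (t * q1) 1 0 + 0 *s on_line (t * p1) (t * q1) 0 1) m"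
        unfolding m_line[of t] tangency_disc_basis_change tangency_disc_on_line by simp
      also have "1 *s on_line (t * p1) (t * q1) 1 0 + 0 *s on_line (t * p1) (t * q1) 0 1 = vector [1, 0, 0] + t *s (p1 *s e2)"
        by (simp add: vec3_eq_iff vector_3)
      finally show "p1^4 * ev (leg_disc k) (t * p1) (t * q1) = ?T (vector [1, 0, 0] + t *s (p1 *s e2)) m" .
    qed
  next
    case True
    have "q1 \<noteq> 0"
    proof
      assume "q1 = 0"
      then have "m = 0 *s m" using True by (simp add: m_def p1_def q1_def vec3_eq_iff vector_3)
      then have "?T e2 m = ?T (1 *s e2 + 0 *s m) (0 *s e2 + 0 *s m)"
        by simp
      then show False using m unfolding tangency_disc_basis_change by simp
    qed
    then have "- q1 \<noteq> 0" by simp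
    then show ?thesis
    proof (rule quartic[where u = e3])
      fix t
      have "(- q1)^4 * ev (leg_disc k) (t * p1) (t * q1) = ?T (0 *s on_line (t * p1) (t * q1) 1 0 + 1 *s on_line (t * p1) (t * q1) 0 1) m"
        unfolding m_line[of t] tangency_disc_basis_change tangency_disc_on_line by simp
      also have "0 *s on_line (t * p1) (t * q1) 1 0 + 1 *s on_line (t * p1) (t * q1) 0 1 = e3 + t *s (- q1 *s e2)"
        by (simp add: vec3_eq_iff vector_3)
      finally show "(- q1)^4 * ev (leg_disc k) (t * p1) (t * q1) = ?T (e3 + t *s (- q1 *s e2)) m" .
    qed
  qed
  then show thesis using that by blast
qed

lemma smult_const_dvd:
  fixes X :: "complex poly poly"
  assumes "a \<noteq> 0"
  shows "smult [:a:] X dvd X"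
proof -
  have "smult [:inverse a:] (smult [:a:] X) = X"
    using assms by (simp flip: one_pCons)
  then show ?thesis by (metis dvd_refl dvd_smult)
qed

text \<open>By unique factorization: the prime factors of the discriminant are dual lines of radial
  points, each simple by \<open>lin_square_not_dvd\<close>. Restricted to the path of
  \<open>line_restriction_quartic\<close>, every factor has degree at most one and the product has
  degree four, so at least four factors occur.\<close>

lemma four_radial_points:
  assumes nd: "nondegenerate_form (field_form k)"
    and flat: "flat_at (leg_c k * leg_disc k) (eta_q (leg_b k) (leg_disc k)) (eta_p (leg_c k) (leg_disc k))"
    and k13: "k 1 3 = 0" and k12: "k 1 2 \<noteq> 0 \<or> k 1 4 = 0" and e2: "\<not> radial (field_form k) e2"
  obtains s where "\<And>i. i < (4::nat) \<Longrightarrow> radial (field_form k) (s i)"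
    "\<And>i j. i < 4 \<Longrightarrow> j < 4 \<Longrightarrow> i \<noteq> j \<Longrightarrow> crs (s i) (s j) \<noteq> 0"
proof -
  define A where "A = prime_factorization (leg_disc k)"
  have nz: "leg_disc k \<noteq> 0" using leg_nonzero[OF nd] by blast
  have A: "prime f" "f dvd leg_disc k" if "f \<in># A" for f
    using that unfolding A_def by (auto simp: in_prime_factors_iff)
  then have "\<forall>f\<in>#A. \<exists>s c. c \<noteq> 0 \<and> f = smult [:c:] (lin s) \<and> crs s e2 \<noteq> 0 \<and> radial (field_form k) s"
    using disc_component_radial[OF nd flat k13 k12] by blast
  then obtain s c where s: "\<And>f. f \<in># A \<Longrightarrow> c f \<noteq> 0 \<and> f = smult [:c f:] (lin (s f)) \<and> crs (s f) e2 \<noteq> 0 \<and> radial (field_form k) (s f)"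
    by metis
  have "count A f \<le> 1" for f
  proof (rule ccontr)
    assume "\<not> count A f \<le> 1"
    then have "{#f, f#} \<subseteq># A" by (simp add: subseteq_mset_def)
    then have "prod_mset {#f, f#} dvd prod_mset A" by (rule prod_mset_subset_imp_dvd)
    also have "prod_mset A dvd leg_disc k"
      unfolding A_def using prod_mset_prime_factorization_weak[OF nz] associatedD1 by blast
    finally have "f * f dvd leg_disc k" by simp
    moreover have f: "f \<in># A" using \<open>\<not> count A f \<le> 1\<close> by (intro count_inI) simp
    moreover have "lin (s f) * lin (s f) dvd f * f"
      using s[OF f] by (metis dvd_refl dvd_smult mult_dvd_mono)
    ultimately show False
      using lin_square_not_dvd[OF nd, of "s f"] s[OF f] dvd_trans by blast
  qed
  then have "A = mset_set (set_mset A)"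
    by (intro multiset_eqI) (metis count_mset_set(1) count_mset_set(3) finite_set_mset le_neq_implies_less less_one not_in_iff)
  then have size: "size A = card (set_mset A)" by (metis size_mset_set)
  obtain u where u: "leg_disc k = u * prod_mset A" "is_unit u"
    using prod_mset_prime_factorization_weak[OF nz] unfolding A_def
    by (metis associatedE2 mult.commute)
  then obtain u0 where u0: "u = [:[:u0:]:]" by (auto simp: is_unit_poly_iff)
  obtain p1 q1 P where P: "degree P = 4" "\<And>t. ev (leg_disc k) (t * p1) (t * q1) = poly P t"
    using line_restriction_quartic[OF e2] by blast
  define L where "L = (\<lambda>f. smult (c f) [:- s f$2, p1 * s f$1 - q1 * s f$3:])"
  have L: "ev f (t * p1) (t * q1) = poly (L f) t" if "f \<in># A" for f t
  proof -
    have "f = smult [:c f:] (lin (s f))" using s[OF that] by blast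
    then have "ev f (t * p1) (t * q1) = ev (smult [:c f:] (lin (s f))) (t * p1) (t * q1)"
      by (rule arg_cong)
    then show ?thesis unfolding L_def ev_smult ev_lin by (simp add: algebra_simps)
  qed
  have "poly P t = poly (smult u0 (\<Prod>f\<in>#A. L f)) t" for t
  proof -
    have "poly (\<Prod>f\<in>#A. L f) t = (\<Prod>f\<in>#A. ev f (t * p1) (t * q1))"
      using L by (simp add: poly_prod_mset image_mset.compositionality o_def cong: image_mset_cong)
    then show ?thesis
      unfolding P(2)[symmetric] u(1) by (simp add: ev_prod_mset u0)
  qed
  then have "P = smult u0 (\<Prod>f\<in>#A. L f)" by (simp add: poly_eq_poly_eq_iff[symmetric] fun_eq_iff)
  then have "4 \<le> degree (\<Prod>f\<in>#A. L f)" using P(1) by (metis degree_smult_le)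
  also have "\<dots> \<le> size A"
  proof -
    have deg: "degree (L f) \<le> 1" for f unfolding L_def by (simp add: degree_pCons_le)
    have "degree (\<Prod>f\<in>#B. L f) \<le> size B" for B
    proof (induction B)
      case (add x B)
      have "degree (L x * (\<Prod>f\<in>#B. L f)) \<le> degree (L x) + degree (\<Prod>f\<in>#B. L f)"
        by (rule degree_mult_le)
      also have "\<dots> \<le> 1 + size B" using add deg by (intro add_mono)
      finally show ?case by simp
    qed simp
    then show ?thesis .
  qed
  finally have "4 \<le> card (set_mset A)" using size by simp
  then obtain T where T: "T \<subseteq> set_mset A" "card T = 4" by (meson obtain_subset_with_card_n)
  then have "finite T" by (metis card.infinite zero_neq_numeral)
  then obtain b where b: "bij_betw b {0..<4::nat} T"
    using ex_bij_betw_nat_finite T by metis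
  show thesis
  proof (rule that[of "s \<circ> b"])
    fix i :: nat assume i: "i < 4"
    then have bi: "b i \<in># A" using b T by (auto simp: bij_betw_def)
    then show "radial (field_form k) ((s \<circ> b) i)" using s by simp
    fix j :: nat assume j: "j < 4" "i \<noteq> j"
    then have bj: "b j \<in># A" using b T by (auto simp: bij_betw_def)
    have neq: "b i \<noteq> b j" using b i j by (auto simp: bij_betw_def inj_on_def)
    \<comment> \<open>Proportional points give associated linear polynomials, whereas distinct
      normalized primes are not associated.\<close>
    show "crs ((s \<circ> b) i) ((s \<circ> b) j) \<noteq> 0"
    proof
      assume "crs ((s \<circ> b) i) ((s \<circ> b) j) = 0"
      moreover have "s (b i) \<noteq> 0" using s[OF bi] by (simp add: radial_def)
      ultimately obtain a where a: "s (b j) = a *s s (b i)" using crs_eq_0_iff by auto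
      have "a \<noteq> 0" using s[OF bj] a by (auto simp: radial_def)
      have "lin (s (b j)) = smult [:a:] (lin (s (b i)))" unfolding a by (simp add: lin_def)
      then have "lin (s (b j)) dvd lin (s (b i))" "lin (s (b i)) dvd lin (s (b j))"
        using smult_const_dvd[OF \<open>a \<noteq> 0\<close>] by (simp_all add: dvd_smult)
      moreover have "b i dvd lin (s (b i))" "lin (s (b j)) dvd b j"
      proof -
        have eq: "f = smult [:c f:] (lin (s f))" "c f \<noteq> 0" if "f \<in># A" for f
          using s[OF that] by blast+
        show "b i dvd lin (s (b i))"
          using smult_const_dvd[OF eq(2)[OF bi], of "lin (s (b i))"] eq(1)[OF bi] by simp
        have "lin (s (b j)) dvd smult [:c (b j):] (lin (s (b j)))" by (simp add: dvd_smult)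
        then show "lin (s (b j)) dvd b j" using eq(1)[OF bj] by simp
      qed
      ultimately have "b i dvd b j" using dvd_trans by blast
      then show False
        using neq A(1)[OF bi] A(1)[OF bj] primes_dvd_imp_eq by blast
    qed
  qed
qed


section \<open>Adapted charts\<close>

lemma pullback_line_nth:
  "pullback_line g l $ i = l$1 * g$1$i + l$2 * g$2$i + l$3 * g$3$i"
  by (simp add: pullback_line_def matrix_vector_3 transpose_def mult.commute)

lemma pullback_line_pair: "pair (pullback_line g l) v = pair l (g *v v)"
  by (simp add: pair_eq pullback_line_nth matrix_vector_3 algebra_simps)

lemma pullback_line_frame: "pullback_line (frame a b c) l = vector [pair l a, pair l b, pair l c]"
  by (simp add: vec3_eq_iff pullback_line_nth frame_def pair_eq vector_3)

lemma pullback_line_mult: "pullback_line (g ** h) l = pullback_line h (pullback_line g l)"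
  by (simp only: pullback_line_def matrix_transpose_mul matrix_vector_mul_assoc)

text \<open>Let \<phi> be the binary form of the tangency points of \<open>l\<close>. If it is not
  identically zero, \<open>g3\<close> is a root and \<open>g2\<close> a non-root, which is
  nonsingular. If it is zero, \<open>l\<close> is invariant and \<open>g2\<close> is any nonsingular
  point of it, which exists since singularities are finite in number. A nonsingular point is not
  radial.\<close>

lemma adapted_frame:
  assumes nd: "nondegenerate_form (field_form k0)" and l: "l \<noteq> 0"
  obtains g k \<kappa> where "invertible g" "pullback g (field_form k0) = field_form k"
    "pullback_line g l = vector [\<kappa>, 0, 0]" "\<kappa> \<noteq> 0" "k 1 3 = 0" "k 1 2 \<noteq> 0 \<or> k 1 4 = 0"
    "\<not> radial (field_form k) e2"
proof -
  note result = that
  obtain b where b: "crs l b \<noteq> 0" using l by (rule exists_not_proportional)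
  define a1 where "a1 = crs l b"
  have a1: "pair l a1 = 0" "a1 \<noteq> 0" using b by (auto simp: a1_def pair_eq algebra_simps)
  obtain a2 where a2: "pair l a2 = 0" "crs a1 a2 \<noteq> 0"
  proof -
    have *: "pair l (crs l v) = 0" for v by (simp add: pair_eq algebra_simps)
    have "\<exists>v. crs a1 (crs l v) \<noteq> 0"
    proof (rule ccontr)
      assume "\<not> (\<exists>v. crs a1 (crs l v) \<noteq> 0)"
      then have "crs a1 (crs l (vector [1, 0, 0])) = 0" "crs a1 (crs l (vector [0, 1, 0])) = 0"
        "crs a1 (crs l (vector [0, 0, 1])) = 0" by blast+
      then have e: "a1$2 * l$2 = - (a1$3 * l$3)" "a1$1 * l$2 = 0" "a1$1 * l$3 = 0" "a1$2 * l$1 = 0" "a1$2 * l$3 = 0"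
        "a1$3 * l$1 = 0" "a1$3 * l$2 = 0" "a1$1 * l$1 = - (a1$3 * l$3)" "a1$1 * l$1 = - (a1$2 * l$2)"
        by (auto simp: vec3_eq_iff vector_3 eq_neg_iff_add_eq_0 algebra_simps)
      have "a1 = 0"
      proof -
        consider "l$1 \<noteq> 0" | "l$2 \<noteq> 0" | "l$3 \<noteq> 0" using l by (auto simp: vec3_eq_iff)
        then show ?thesis
        proof cases
          case 1
          then have "a1$2 = 0" "a1$3 = 0" using e by auto
          with e 1 show ?thesis by (auto simp: vec3_eq_iff)
        next
          case 2
          then have "a1$1 = 0" "a1$3 = 0" using e by auto
          with e 2 show ?thesis by (auto simp: vec3_eq_iff)
        next
          case 3
          then have "a1$1 = 0" "a1$2 = 0" using e by auto
          with e 3 show ?thesis by (auto simp: vec3_eq_iff)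
        qed
      qed
      with a1 show False by simp
    qed
    then show thesis using that * by blast
  qed
  have ker: "pair l r \<noteq> 0" if "pair l u = 0" "pair l v = 0" "pair (crs u v) r \<noteq> 0" for u v r
  proof
    assume "pair l r = 0"
    then have "pullback_line (frame u v r) l = 0"
      using that by (simp add: pullback_line_frame vec3_eq_iff vector_3)
    moreover have "invertible (transpose (frame u v r))"
      using that by (simp add: invertible_det_nz det_transpose det_frame)
    ultimately show False
      using invertible_mult_eq_0 l unfolding pullback_line_def by blast
  qed
  text \<open>In any basis of the line, completed to a frame, the conditions on \<open>k\<close> read off the form.\<close>
  have finish: thesis if g: "pair l g2 = 0" "pair l g3 = 0" "crs g2 g3 \<noteq> 0"
    and g3: "pair (field_form k0 g3) g2 = 0" and g2: "field_form k0 g2 \<noteq> 0"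
    and dich: "pair (field_form k0 g2) g3 \<noteq> 0 \<or> (\<forall>y z. pair (field_form k0 (y *s g2 + z *s g3)) g2 = 0)"
    for g2 g3
  proof -
    obtain r where r: "pair (crs g2 g3) r \<noteq> 0" using g(3) by (rule frame_complete)
    define f where "f = frame r g2 g3"
    have "pair (crs r g2) g3 = pair (crs g2 g3) r" by (simp add: pair_eq algebra_simps)
    then have inv: "invertible f" using r by (simp add: f_def invertible_frame_iff)
    obtain k where k: "pullback f (field_form k0) = field_form k" using pullback_field_form by blast
    have val: "field_form k (vector [0, y, z]) $ 2 = pair (field_form k0 (y *s g2 + z *s g3)) g2"
      "field_form k (vector [0, y, z]) $ 3 = pair (field_form k0 (y *s g2 + z *s g3)) g3" for y z
    proof -
      have "field_form k (vector [0, y, z]) $ 2 = pair (pullback f (field_form k0) (vector [0, y, z])) (vector [0, 1, 0])"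
        "field_form k (vector [0, y, z]) $ 3 = pair (pullback f (field_form k0) (vector [0, y, z])) (vector [0, 0, 1])"
        unfolding k by (simp_all add: pair_eq vector_3)
      then show "field_form k (vector [0, y, z]) $ 2 = pair (field_form k0 (y *s g2 + z *s g3)) g2"
        "field_form k (vector [0, y, z]) $ 3 = pair (field_form k0 (y *s g2 + z *s g3)) g3"
        unfolding pullback_pair by (simp_all add: f_def frame_mult vector_3)
    qed
    have k13: "k 1 3 = 0"
      using val(1)[of 0 1] g3 by (simp add: field_form_nth quad_def vector_3)
    have k12: "k 1 2 \<noteq> 0 \<or> k 1 4 = 0"
    proof (cases "pair (field_form k0 g2) g3 = 0")
      case False
      have "pair (field_form k0 g2) g3 = - k 1 2"
        using val(2)[of 1 0] by (simp add: field_form_nth quad_def vector_3)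
      then show ?thesis using False by auto
    next
      case True
      then have "field_form k (vector [0, 1, 1]) $ 2 = 0" "field_form k (vector [0, 1, -1]) $ 2 = 0"
        using dich unfolding val by blast+
      then show ?thesis by (simp add: field_form_nth quad_def vector_3) algebra
    qed
    have nonrad: "\<not> radial (field_form k) e2"
    proof
      assume "radial (field_form k) e2"
      then have "field_form k e2 = 0"
        using radial_singular nondegenerate_form_pullback[OF nd inv] k by metis
      moreover have "f *v e2 = g2" by (simp add: f_def frame_mult vector_3)
      ultimately have "transpose f *v field_form k0 g2 = 0"
        unfolding k[symmetric] pullback_def by simp
      then show False
        using g2 invertible_mult_eq_0[of "transpose f"] inv by (simp add: invertible_det_nz det_transpose)
    qed
    have fl: "pullback_line f l = vector [pair l r, 0, 0]"
      using g unfolding f_def pullback_line_frame by simp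
    show thesis
      by (rule result[OF inv k fl ker[OF g(1,2) r] k13 k12 nonrad])
  qed
  obtain r where r: "pair (crs a1 a2) r \<noteq> 0" using a2(2) by (rule frame_complete)
  obtain k' where k': "pullback (frame r a1 a2) (field_form k0) = field_form k'"
    using pullback_field_form by blast
  define \<phi> where "\<phi> = (\<lambda>y z. k' 1 2 * y^2 + k' 1 4 * y * z + k' 1 3 * z^2)"
  have \<Phi>: "pair (field_form k0 (y *s a1 + z *s a2)) (y' *s a1 + z' *s a2) = (y' * z - z' * y) * \<phi> y z" for y z y' z'
  proof -
    have "pair (field_form k0 (y *s a1 + z *s a2)) (y' *s a1 + z' *s a2)
       = pair (pullback (frame r a1 a2) (field_form k0) (vector [0, y, z])) (vector [0, y', z'])"
      unfolding pullback_pair by (simp add: frame_mult vector_3)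
    also have "\<dots> = (y' * z - z' * y) * \<phi> y z"
      unfolding k' by (simp add: pair_eq field_form_nth quad_def vector_3 \<phi>_def algebra_simps)
    finally show ?thesis .
  qed
  have lin: "pair l (y *s a1 + z *s a2) = 0" for y z
    using a1 a2 by (simp add: pair_comb)
  have crs_lin: "crs (y *s a1 + z *s a2) (y' *s a1 + z' *s a2) = (y * z' - z * y') *s crs a1 a2" for y z y' z'
    by (simp add: vec3_eq_iff algebra_simps)
  show thesis
  proof (cases "\<forall>y z. \<phi> y z = 0")
    case True
    have "\<exists>t. field_form k0 (a1 + t *s a2) \<noteq> 0"
    proof (rule ccontr)
      assume "\<not> (\<exists>t. field_form k0 (a1 + t *s a2) \<noteq> 0)"
      then have 0: "field_form k0 (1 *s a1 + t *s a2) = 0" for t by simp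
      have ind: "crs (1 *s a1 + t *s a2) (1 *s a1 + t' *s a2) \<noteq> 0" if "t \<noteq> t'" for t t'
        unfolding crs_lin using that a2(2) by (simp add: vec3_eq_iff)
      have "1 *s a1 + t *s a2 \<noteq> 0" for t
        using ind[of t "t + 1"] by (auto simp: vec3_eq_iff)
      then show False
        using infinite_curve_not_singular[OF nd, of "\<lambda>t. 1 *s a1 + t *s a2"] 0 ind by blast
    qed
    then obtain t where t: "field_form k0 (1 *s a1 + t *s a2) \<noteq> 0" by auto
    define g2 where "g2 = 1 *s a1 + t *s a2"
    have van: "pair (field_form k0 (y *s g2 + z *s a2)) g2 = 0" for y z
    proof -
      have e: "y *s g2 + z *s a2 = y *s a1 + (y * t + z) *s a2"
        by (simp add: g2_def vec3_eq_iff algebra_simps)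
      show ?thesis unfolding e unfolding g2_def \<Phi> using True by simp
    qed
    show thesis
    proof (rule finish)
      show "pair l g2 = 0" unfolding g2_def by (rule lin)
      show "pair l a2 = 0" by (rule a2)
      show "crs g2 a2 \<noteq> 0" using crs_lin[of 1 t 0 1] a2(2) unfolding g2_def by simp
      show "pair (field_form k0 a2) g2 = 0" using van[of 0 1] by simp
      show "field_form k0 g2 \<noteq> 0" using t unfolding g2_def .
    qed (use van in blast)
  next
    case False
    obtain y z where yz: "y \<noteq> 0 \<or> z \<noteq> 0" "\<phi> y z = 0"
      unfolding \<phi>_def by (rule binary_quadratic_root)
    obtain y' z' where yz': "\<phi> y' z' \<noteq> 0" using False by blast
    have nz: "y' * z - z' * y \<noteq> 0"
    proof
      assume eq: "y' * z - z' * y = 0"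
      have "\<exists>c. y' = c * y \<and> z' = c * z"
      proof (cases "y = 0")
        case True
        with eq yz have "y' = 0" "z \<noteq> 0" by auto
        with True show ?thesis by (intro exI[of _ "z' / z"]) simp
      next
        case False
        with eq show ?thesis by (intro exI[of _ "y' / y"]) (simp add: field_simps)
      qed
      then obtain c where "y' = c * y" "z' = c * z" by blast
      then have "\<phi> y' z' = c^2 * \<phi> y z"
        by (simp add: \<phi>_def power2_eq_square algebra_simps)
      with yz yz' show False by simp
    qed
    define g2 g3 where "g2 = y' *s a1 + z' *s a2" and "g3 = y *s a1 + z *s a2"
    have g23: "pair (field_form k0 g2) g3 \<noteq> 0"
      unfolding g2_def g3_def \<Phi> using nz yz' by (simp add: algebra_simps)
    show thesis
    proof (rule finish)
      show "pair l g2 = 0" "pair l g3 = 0" unfolding g2_def g3_def by (rule lin)+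
      show "crs g2 g3 \<noteq> 0" unfolding g2_def g3_def crs_lin using nz a2(2) by (simp add: vec3_eq_iff)
      show "pair (field_form k0 g3) g2 = 0" unfolding g2_def g3_def \<Phi> using yz by simp
      show "field_form k0 g2 \<noteq> 0" using g23 by (auto simp: pair_eq)
    qed (use g23 in blast)
  qed
qed

lemma legendre_eq_0_iff:
  assumes g: "pullback g \<Omega> = (\<lambda>v. c *s field_form k v)" "c \<noteq> 0"
    and l: "pullback_line g l = vector [\<kappa>, 0, 0]" "\<kappa> \<noteq> 0"
  shows "legendre g l \<Omega> (p, q) x = 0 \<longleftrightarrow>
     x = 0 \<or> ev (leg_a k) p q * x^2 + ev (leg_b k) p q * x + ev (leg_c k) p q = 0"
proof -
  have "legendre g l \<Omega> (p, q) x = (\<kappa> * x) *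
      (c * (field_form k (on_line p q x 1) $ 1 + p * field_form k (on_line p q x 1) $ 2))"
    unfolding legendre_def affine_form_def g l on_line_def by (simp add: Let_def pair_eq vector_3 algebra_simps)
  also have "\<dots> = (\<kappa> * x) * (c * (ev (leg_a k) p q * x^2 + ev (leg_b k) p q * x + ev (leg_c k) p q))"
    unfolding field_form_on_line by simp
  finally show ?thesis using g(2) l(2) by simp
qed

lemma flat_legendre_flat_at:
  assumes flat: "flat_legendre l \<Omega>" and inv: "invertible g"
    and g: "pullback g \<Omega> = (\<lambda>v. c *s field_form k v)" "c \<noteq> 0"
    and l: "pullback_line g l = vector [\<kappa>, 0, 0]" "\<kappa> \<noteq> 0"
    and nz: "leg_a k \<noteq> 0" "leg_c k \<noteq> 0" "leg_disc k \<noteq> 0"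
  shows "flat_at (leg_c k * leg_disc k) (eta_q (leg_b k) (leg_disc k)) (eta_p (leg_c k) (leg_disc k))"
  unfolding flat_at_def leg_disc_def
proof (rule flat_identity[where F = "legendre g l \<Omega>"])
  show "legendre g l \<Omega> (p, q) x = 0 \<longleftrightarrow>
     x = 0 \<or> ev (leg_a k) p q * x^2 + ev (leg_b k) p q * x + ev (leg_c k) p q = 0" for p q x
    by (rule legendre_eq_0_iff[OF g l])
  show "web_curvature \<omega>1 \<omega>2 \<omega>3 z = 0" if "web3_on (legendre g l \<Omega>) U \<omega>1 \<omega>2 \<omega>3" "z \<in> U" for U \<omega>1 \<omega>2 \<omega>3 z
    using flat inv that unfolding flat_legendre_def by blast
qed (use nz in \<open>auto simp: leg_disc_def\<close>)

lemma flat_conjugate_fermat: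
  assumes nd: "nondegenerate_form (field_form k0)" and l: "l \<noteq> 0"
    and flat: "flat_legendre l (field_form k0)"
  obtains g c where "invertible g" "c \<noteq> 0" "pullback g (field_form k0) = (\<lambda>v. c *s fermat2 v)"
proof -
  obtain g k \<kappa> where g: "invertible g" "pullback g (field_form k0) = field_form k"
    "pullback_line g l = vector [\<kappa>, 0, 0]" "\<kappa> \<noteq> 0" and k: "k 1 3 = 0" "k 1 2 \<noteq> 0 \<or> k 1 4 = 0"
    "\<not> radial (field_form k) e2"
    using adapted_frame[OF nd l] by blast
  have nd': "nondegenerate_form (field_form k)"
    using nondegenerate_form_pullback[OF nd g(1)] g(2) by simp
  have "flat_at (leg_c k * leg_disc k) (eta_q (leg_b k) (leg_disc k)) (eta_p (leg_c k) (leg_disc k))"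
    by (rule flat_legendre_flat_at[OF flat g(1) _ _ g(3,4), of 1]) (use g(2) leg_nonzero[OF nd'] in auto)
  then obtain s where "\<And>i. i < (4::nat) \<Longrightarrow> radial (field_form k) (s i)"
    "\<And>i j. i < 4 \<Longrightarrow> j < 4 \<Longrightarrow> i \<noteq> j \<Longrightarrow> crs (s i) (s j) \<noteq> 0"
    using four_radial_points[OF nd' _ k] by blast
  then obtain h c where h: "invertible h" "c \<noteq> 0" "\<And>v. pullback h (field_form k) v = c *s fermat2 v"
    using four_radial_points_fermat[OF nd', of s] by blast
  have "pullback (g ** h) (field_form k0) = (\<lambda>v. c *s fermat2 v)"
    unfolding pullback_pullback[symmetric] g(2) using h(3) by blast
  then show thesis
    using that h(2) invertible_mult[OF g(1) h(1)] by blast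
qed


section \<open>Lines with flat dual web for the Fermat foliation\<close>

text \<open>Up to sign, the Fermat form comes from the field with components X^2, Y^2, Z^2;
  \<open>k\<close> is this field in the coordinates x = X + m Y + n Z, y = Y, z = Z, which turn the
  line into x = 0. The curve p = 0 is the dual line of the radial point (1, 0, 0), and flatness is
  examined along it.\<close>

lemma
  fixes m n :: complex
  defines "k \<equiv> (\<lambda>i j. if i = 1 then [0, 1, m^2 + m, n^2 + n, 2 * m * n, - 2 * n, - 2 * m] ! j
     else if i = j then 1 else (0::complex))"
  shows fermat_leg_nonzero: "leg_a k \<noteq> 0" "leg_c k \<noteq> 0" "leg_disc k \<noteq> 0"
    and fermat_flat_at: "flat_at (leg_c k * leg_disc k) (eta_q (leg_b k) (leg_disc k)) (eta_p (leg_c k) (leg_disc k)) \<Longrightarrow>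
      m^3 = m \<and> n^3 = n \<and> n * (1 + n) * (5 - 2 * n + 3 * m) = 0 \<and> m * (1 + m) * (5 - 2 * m + 3 * n) = 0"
proof -
  define A B C D where "A = [:[:1:], [:- 1 - 2 * m:], [:m^2 + m:]:]"
    and "B = [:[:- 2 * n, 2 + 2 * m:], [:2 * m * n, - 2 * (m^2 + m):]:]"
    and "C = [:[:0, -1, -1:], [:n^2 + n, - 2 * m * n, m^2 + m:]:]"
    and "D = var_p * B^2 - 4 * A * C"
  \<comment> \<open>On a line through (1, 0, 0) the double tangency point is (1, 0, 0) itself, so
    modulo p only the coefficient of \<open>z^2\<close> survives.\<close>
  have leg: "leg_a k = var_p * A" "leg_b k = var_p * B" "leg_c k = C"
    unfolding leg_a_def leg_b_def leg_c_def leg_coeff_def A_def B_def C_def k_def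
    by (simp_all add: numeral_poly)
  have disc: "leg_disc k = var_p * D"
    unfolding leg_disc_def web_disc_def leg D_def by (simp only: power_mult_distrib) (simp only: power2_eq_square algebra_simps)
  have ev0: "ev A 0 q = 1" "ev (Dp A) 0 q = - 1 - 2 * m"
    "ev B 0 q = - 2 * n + (2 + 2 * m) * q" "ev (Dp B) 0 q = 2 * m * n - 2 * (m^2 + m) * q"
    "ev C 0 q = - q - q^2" "ev (Dp C) 0 q = n^2 + n - 2 * m * n * q + (m^2 + m) * q^2"
    "ev (Dq A) 0 q = 0" "ev (Dq B) 0 q = 2 + 2 * m" "ev (Dq C) 0 q = - 1 - 2 * q"
    "ev (Dq (Dp A)) 0 q = 0" "ev (Dq (Dp B)) 0 q = - 2 * (m^2 + m)" "ev (Dq (Dp C)) 0 q = - 2 * m * n + 2 * (m^2 + m) * q" for q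
    by (simp_all add: A_def B_def C_def pderiv_pCons power2_eq_square algebra_simps)
  have D0: "ev D 0 q = 4 * (q + q^2)"
    "ev (Dp D) 0 q = ev B 0 q ^ 2 - 4 * (ev A 0 q * ev (Dp C) 0 q + ev (Dp A) 0 q * ev C 0 q)"
    "ev (Dq D) 0 q = 4 * (1 + 2 * q)"
    "ev (Dq (Dp D)) 0 q = 2 * ev B 0 q * ev (Dq B) 0 q - 4 * (ev (Dq (Dp C)) 0 q + ev (Dp A) 0 q * ev (Dq C) 0 q)" for q
    unfolding D_def
    by (simp_all add: pderiv_diff pderiv_mult Dp_power2 Dq_diff Dq_add Dq_mult Dq_power2 pderiv_pCons ev0 algebra_simps
        del: mult_pCons_left mult_pCons_right)
  show "leg_a k \<noteq> 0"
  proof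
    assume "leg_a k = 0"
    then have "A = 0" unfolding leg by simp
    with ev0(1) show False by simp
  qed
  show "leg_c k \<noteq> 0"
    unfolding leg C_def by simp
  show "leg_disc k \<noteq> 0"
  proof
    assume "leg_disc k = 0"
    then have "D = 0" unfolding disc by simp
    with D0(1)[of 1] show False by simp
  qed
  assume flat: "flat_at (leg_c k * leg_disc k) (eta_q (leg_b k) (leg_disc k)) (eta_p (leg_c k) (leg_disc k))"
  text \<open>Away from \<open>p = 0\<close> the condition reads \<open>R = 0\<close>, and the \<open>q\<close>-coefficients of \<open>R\<close> at \<open>p = 0\<close> suffice.\<close>
  define N where "N = - B * D + var_p * (B * Dp D - 2 * D * Dp B)"
  define M where "M = C * Dp D - 2 * Dp C * D"
  define R where "R = C * D * Dp N - N * Dp (C * D) - 2 * C * D * Dq M + 2 * M * Dq (C * D)"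
  have eq: "eta_q (leg_b k) (leg_disc k) = var_p * N" "eta_p (leg_c k) (leg_disc k) = C * D + var_p * M"
    "leg_c k * leg_disc k = var_p * (C * D)"
    unfolding leg disc eta_q_def eta_p_def N_def M_def
    by (simp_all add: pderiv_mult pderiv_pCons algebra_simps del: mult_pCons_left mult_pCons_right)
  have dv: "Dp var_p = 1" "Dq var_p = 0" by (simp_all add: pderiv_pCons)
  have "var_p * (var_p * R) = 0"
    using flat unfolding flat_at_def eq R_def
    by (simp add: pderiv_mult Dq_mult Dq_add dv algebra_simps del: mult_pCons_left mult_pCons_right)
  then have "R = 0" by simp
  then have R0: "ev R 0 q = 0" for q by simp
  have N0: "ev N 0 q = - ev B 0 q * ev D 0 q" "ev (Dp N) 0 q = - 3 * ev (Dp B) 0 q * ev D 0 q" for q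
    unfolding N_def
    by (simp_all add: pderiv_add pderiv_minus pderiv_diff pderiv_mult dv algebra_simps del: mult_pCons_left mult_pCons_right)
  have M0: "ev M 0 q = ev C 0 q * ev (Dp D) 0 q - 2 * ev (Dp C) 0 q * ev D 0 q"
    "ev (Dq M) 0 q = ev C 0 q * ev (Dq (Dp D)) 0 q + ev (Dq C) 0 q * ev (Dp D) 0 q
       - 2 * (ev (Dp C) 0 q * ev (Dq D) 0 q + ev (Dq (Dp C)) 0 q * ev D 0 q)" for q
    unfolding M_def by (simp_all add: Dq_diff Dq_mult algebra_simps)
  have "32 * q^2 * ((n - n^3) + (5 * n + 3 * n^2 - 2 * n^3 + 3 * m * n + 3 * m * n^2) * q
     + (7 * n + 6 * n^2 - n^3 - 3 * m + 3 * m * n + 6 * m * n^2 - 3 * m^2 - 3 * m^2 * n) * q^2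
     + (3 * n + 3 * n^2 - 7 * m - 3 * m * n + 3 * m * n^2 - 6 * m^2 - 6 * m^2 * n + m^3) * q^3
     + (- 5 * m - 3 * m * n - 3 * m^2 - 3 * m^2 * n + 2 * m^3) * q^4 + (m^3 - m) * q^5) = 0" for q
  proof -
    have "ev C 0 q * ev D 0 q * ev (Dp N) 0 q - ev N 0 q * (ev C 0 q * ev (Dp D) 0 q + ev (Dp C) 0 q * ev D 0 q)
      - 2 * (ev C 0 q * ev D 0 q) * ev (Dq M) 0 q + 2 * ev M 0 q * (ev C 0 q * ev (Dq D) 0 q + ev (Dq C) 0 q * ev D 0 q) = 0"
      using R0[of q] unfolding R_def by (simp add: pderiv_mult Dq_mult algebra_simps)
    then show ?thesis
      unfolding N0 M0 D0 ev0 by algebra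
  qed
  note E = this
  define P where "P = [:0, 0, n - n^3, 5 * n + 3 * n^2 - 2 * n^3 + 3 * m * n + 3 * m * n^2,
     7 * n + 6 * n^2 - n^3 - 3 * m + 3 * m * n + 6 * m * n^2 - 3 * m^2 - 3 * m^2 * n,
     3 * n + 3 * n^2 - 7 * m - 3 * m * n + 3 * m * n^2 - 6 * m^2 - 6 * m^2 * n + m^3,
     - 5 * m - 3 * m * n - 3 * m^2 - 3 * m^2 * n + 2 * m^3, m^3 - m:]"
  have "poly P q = 0" for q
  proof -
    have "32 * poly P q = 0"
      using E[of q] unfolding P_def poly_pCons poly_0 by algebra
    then show ?thesis by simp
  qed
  then have "P = 0" using poly_all_0_iff_0 by blast
  \<comment> \<open>Coefficients of degree 7, 2, 3 and 6.\<close>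
  then have "m^3 - m = 0" "n - n^3 = 0" "5 * n + 3 * n^2 - 2 * n^3 + 3 * m * n + 3 * m * n^2 = 0"
    "- 5 * m - 3 * m * n - 3 * m^2 - 3 * m^2 * n + 2 * m^3 = 0"
    unfolding P_def pCons_eq_0_iff by blast+
  then show "m^3 = m \<and> n^3 = n \<and> n * (1 + n) * (5 - 2 * n + 3 * m) = 0 \<and> m * (1 + m) * (5 - 2 * m + 3 * n) = 0"
    by (intro conjI) algebra+
qed

text \<open>The first three pairs are the invariant lines x = 0, x = y and x = z; the other three
  are the lines joining two of the nodes (1, 1, 0), (1, 0, 1) and (0, 1, 1).\<close>

lemma fermat_lines_cases:
  fixes m n :: complex
  assumes "m^3 = m" "n^3 = n" "n * (1 + n) * (5 - 2 * n + 3 * m) = 0" "m * (1 + m) * (5 - 2 * m + 3 * n) = 0"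
  shows "(m, n) \<in> {(0, 0), (-1, 0), (0, -1), (-1, -1), (1, -1), (-1, 1)}"
proof -
  have "m = 0 \<or> m = 1 \<or> m = - 1" "n = 0 \<or> n = 1 \<or> n = - 1"
  proof -
    have "m * ((m - 1) * (m + 1)) = 0" using assms(1) by (simp add: power3_eq_cube algebra_simps)
    moreover have "n * ((n - 1) * (n + 1)) = 0" using assms(2) by (simp add: power3_eq_cube algebra_simps)
    ultimately show "m = 0 \<or> m = 1 \<or> m = - 1" "n = 0 \<or> n = 1 \<or> n = - 1"
      by (simp_all add: add_eq_0_iff2)
  qed
  then show ?thesis using assms(3,4) by (elim disjE) simp_all
qed

text \<open>A model chart at a nonradial singularity: its linear part is diagonal with entries e and
  -e. The factor \<open>e\<close> absorbs the sign with which the Fermat form is pulled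
  back.\<close>

definition fermat_node_chart :: "complex^3 \<Rightarrow> complex^3^3 \<Rightarrow> bool" where
  "fermat_node_chart s f \<longleftrightarrow> invertible f \<and> f *v e3 = s \<and>
     (\<exists>e. e \<noteq> 0 \<and> (\<forall>v. pullback f fermat2 v =
        field_form (\<lambda>i j. if i = j then e else if (i, j) = (1, 5) then 2 * e else 0) v))"

lemma fermat_node_charts:
  "fermat_node_chart (vector [1, 1, 0]) (frame (vector [1, 0, 0]) (vector [0, 0, 1]) (vector [1, 1, 0]))"
  "fermat_node_chart (vector [1, 0, 1]) (frame (vector [1, 0, 0]) (vector [0, 1, 0]) (vector [1, 0, 1]))"
  "fermat_node_chart (vector [0, 1, 1]) (frame (vector [0, 1, 0]) (vector [1, 0, 0]) (vector [0, 1, 1]))"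
proof -
  note inv = invertible_frame_iff pair_eq vector_3
  note simps = frame_mult vec3_eq_iff pullback_nth frame_def
    fermat2_def Let_def field_form_nth quad_def vector_3 matrix_vector_3 power2_eq_square algebra_simps
  show "fermat_node_chart (vector [1, 1, 0]) (frame (vector [1, 0, 0]) (vector [0, 0, 1]) (vector [1, 1, 0]))"
    unfolding fermat_node_chart_def
    by (intro conjI exI[of _ 1] allI) (simp add: inv, simp_all add: simps)
  show "fermat_node_chart (vector [1, 0, 1]) (frame (vector [1, 0, 0]) (vector [0, 1, 0]) (vector [1, 0, 1]))"
    unfolding fermat_node_chart_def
    by (intro conjI exI[of _ "-1"] allI) (simp add: inv, simp_all add: simps)
  show "fermat_node_chart (vector [0, 1, 1]) (frame (vector [0, 1, 0]) (vector [1, 0, 0]) (vector [0, 1, 1]))"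
    unfolding fermat_node_chart_def
    by (intro conjI exI[of _ 1] allI) (simp add: inv, simp_all add: simps)
qed

lemma pullback_scale: "pullback g (\<lambda>v. c *s \<Omega> v) v = c *s pullback g \<Omega> v"
  by (simp add: vec3_eq_iff pullback_nth algebra_simps)

lemma fermat_node_nonradial:
  assumes g: "invertible g" and \<Omega>: "pullback g \<Omega> = (\<lambda>v. c *s fermat2 v)" "c \<noteq> 0"
    and f: "fermat_node_chart s f"
  shows "singular \<Omega> (g *v s) \<and> \<not> radial_singularity \<Omega> (g *v s)"
proof -
  obtain e where e: "invertible f" "f *v e3 = s" "e \<noteq> 0" "\<And>v. pullback f fermat2 v =
      field_form (\<lambda>i j. if i = j then e else if (i, j) = (1, 5) then 2 * e else 0) v"
    using f unfolding fermat_node_chart_def by blast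
  have inv: "invertible (g ** f)" using g e(1) by (rule invertible_mult)
  define k where "k = (\<lambda>i j. if i = j then c * e else if (i, j) = (1::nat, 5::nat) then 2 * (c * e) else (0::complex))"
  have k: "pullback (g ** f) \<Omega> = field_form k"
  proof
    fix v
    have "pullback (g ** f) \<Omega> v = c *s pullback f fermat2 v"
      unfolding pullback_pullback[symmetric] \<Omega> by (rule pullback_scale)
    then show "pullback (g ** f) \<Omega> v = field_form k v"
      unfolding e(4) by (simp add: vec3_eq_iff field_form_nth quad_def k_def algebra_simps)
  qed
  have s: "(g ** f) *v e3 = g *v s" by (simp add: matrix_vector_mul_assoc[symmetric] e(2))
  have "field_form k e3 = 0" by (simp add: vec3_eq_iff field_form_nth quad_def vector_3 k_def)
  then have "transpose (g ** f) *v \<Omega> (g *v s) = 0"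
    unfolding k[symmetric] pullback_def s .
  then have "\<Omega> (g *v s) = 0"
    using invertible_mult_eq_0[of "transpose (g ** f)"] inv by (simp add: invertible_det_nz det_transpose)
  moreover have "e3 \<noteq> 0" by (simp add: vec3_eq_iff vector_3)
  then have "g *v s \<noteq> 0" unfolding s[symmetric] using invertible_mult_eq_0[OF inv] by blast
  moreover have "linear_part (g ** f) \<Omega> (0, 0) \<noteq> mat \<mu>" for \<mu>
  proof
    assume "linear_part (g ** f) \<Omega> (0, 0) = mat \<mu>"
    then have eq: "vector [vector [k 1 5 - k 3 3, k 1 4], vector [k 2 5, k 2 4 - k 3 3]] = (mat \<mu> :: complex^2^2)"
      unfolding linear_part_field_form[OF k] .
    have "k 1 5 - k 3 3 = \<mu>" "k 2 4 - k 3 3 = \<mu>"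
      using arg_cong[OF eq, of "\<lambda>A. A $ 1 $ 1"] arg_cong[OF eq, of "\<lambda>A. A $ 2 $ 2"]
      by (simp_all add: vector_2 mat_def)
    then show False using \<Omega>(2) e(3) by (simp add: k_def)
  qed
  then have "\<not> radial_singularity \<Omega> (g *v s)"
    unfolding radial_singularity_def using chart_at_origin[OF inv] unfolding s by blast
  ultimately show ?thesis unfolding singular_def by blast
qed

text \<open>Exchanging two coordinates changes only the sign of the Fermat form, so a nonzero
  coefficient of the line can be moved to the first place.\<close>

lemma fermat_conjugate_normalized:
  assumes g: "invertible g" and \<Omega>: "pullback g \<Omega> = (\<lambda>v. c *s fermat2 v)" "c \<noteq> 0" and l: "l \<noteq> 0"
  obtains h d where "invertible h" "pullback h \<Omega> = (\<lambda>v. d *s fermat2 v)" "d \<noteq> 0" "pullback_line h l $ 1 \<noteq> 0"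
proof -
  have nz: "pullback_line g l \<noteq> 0"
    unfolding pullback_line_def using invertible_mult_eq_0[of "transpose g" l] g l
    by (auto simp: invertible_det_nz det_transpose)
  have swap: "\<exists>h d. invertible h \<and> pullback h \<Omega> = (\<lambda>v. d *s fermat2 v) \<and> d \<noteq> 0 \<and> pullback_line h l $ 1 \<noteq> 0"
    if s: "invertible s" "\<And>v. pullback s fermat2 v = - fermat2 v" "pullback_line s (pullback_line g l) $ 1 \<noteq> 0" for s
  proof (intro exI conjI)
    show "invertible (g ** s)" using g s(1) by (rule invertible_mult)
    show "pullback (g ** s) \<Omega> = (\<lambda>v. (- c) *s fermat2 v)"
    proof
      fix v
      have "pullback (g ** s) \<Omega> v = c *s pullback s fermat2 v"
        unfolding pullback_pullback[symmetric] \<Omega> by (rule pullback_scale)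
      then show "pullback (g ** s) \<Omega> v = (- c) *s fermat2 v" unfolding s(2) by (simp add: vec3_eq_iff)
    qed
    show "- c \<noteq> 0" using \<Omega> by simp
    show "pullback_line (g ** s) l $ 1 \<noteq> 0" unfolding pullback_line_mult by (rule s(3))
  qed
  consider "pullback_line g l $ 1 \<noteq> 0" | "pullback_line g l $ 2 \<noteq> 0" | "pullback_line g l $ 3 \<noteq> 0"
    using nz by (auto simp: vec3_eq_iff)
  then show thesis
  proof cases
    case 1
    then show thesis using that g \<Omega> by blast
  next
    case 2
    have "\<exists>h d. invertible h \<and> pullback h \<Omega> = (\<lambda>v. d *s fermat2 v) \<and> d \<noteq> 0 \<and> pullback_line h l $ 1 \<noteq> 0"
      by (rule swap[of "frame (vector [0, 1, 0]) (vector [1, 0, 0]) (vector [0, 0, 1])"])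
        (use 2 in \<open>simp add: invertible_frame_iff pair_eq vector_3,
          simp_all add: vec3_eq_iff pullback_nth frame_def vector_3 pullback_line_nth
          matrix_vector_3 fermat2_def Let_def algebra_simps\<close>)
    then show thesis using that by blast
  next
    case 3
    have "\<exists>h d. invertible h \<and> pullback h \<Omega> = (\<lambda>v. d *s fermat2 v) \<and> d \<noteq> 0 \<and> pullback_line h l $ 1 \<noteq> 0"
      by (rule swap[of "frame (vector [0, 0, 1]) (vector [0, 1, 0]) (vector [1, 0, 0])"])
        (use 3 in \<open>simp add: invertible_frame_iff pair_eq vector_3,
          simp_all add: vec3_eq_iff pullback_nth frame_def vector_3 pullback_line_nth
          matrix_vector_3 fermat2_def Let_def algebra_simps\<close>)
    then show thesis using that by blast
  qed
qed

lemma fermat_line_position: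
  assumes g: "invertible g" and \<Omega>: "pullback g \<Omega> = (\<lambda>v. c *s fermat2 v)" "c \<noteq> 0" and l: "l \<noteq> 0"
    and flat: "flat_legendre l \<Omega>"
  shows "invariant_line l \<Omega> \<or> joins_two_nonradial l \<Omega>"
proof -
  obtain h d where h: "invertible h" "pullback h \<Omega> = (\<lambda>v. d *s fermat2 v)" "d \<noteq> 0" "pullback_line h l $ 1 \<noteq> 0"
    using fermat_conjugate_normalized[OF g \<Omega> l] by blast
  define \<kappa> m n where "\<kappa> = pullback_line h l $ 1" and "m = pullback_line h l $ 2 / \<kappa>" and "n = pullback_line h l $ 3 / \<kappa>"
  have \<kappa>: "\<kappa> \<noteq> 0" using h(4) by (simp add: \<kappa>_def)
  have l': "pullback_line h l = \<kappa> *s vector [1, m, n]"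
    using \<kappa> by (simp add: vec3_eq_iff vector_3 m_def n_def \<kappa>_def)
  define k where "k = (\<lambda>i j. if i = 1 then [0, 1, m^2 + m, n^2 + n, 2 * m * n, - 2 * n, - 2 * m] ! j
     else if i = j then 1 else (0::complex))"
  define f where "f = frame (vector [1, 0, 0]) (vector [- m, 1, 0]) (vector [- n, 0, 1])"
  have f: "invertible f" by (simp add: f_def invertible_frame_iff pair_eq vector_3)
  have "pullback f fermat2 v = (- 1) *s field_form k v" for v
    unfolding f_def k_def
    by (simp add: vec3_eq_iff pullback_nth frame_def vector_3 matrix_vector_3 fermat2_def Let_def field_form_nth quad_def
        power2_eq_square algebra_simps)
  then have fk: "pullback (h ** f) \<Omega> = (\<lambda>v. (- d) *s field_form k v)"
    unfolding pullback_pullback[symmetric] h(2) by (simp add: fun_eq_iff pullback_scale)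
  have fl: "pullback_line (h ** f) l = vector [\<kappa>, 0, 0]"
    unfolding pullback_line_mult l' f_def pullback_line_frame by (simp add: vec3_eq_iff pair_eq vector_3)
  have "flat_at (leg_c k * leg_disc k) (eta_q (leg_b k) (leg_disc k)) (eta_p (leg_c k) (leg_disc k))"
    by (rule flat_legendre_flat_at[OF flat invertible_mult[OF h(1) f] fk _ fl \<kappa>])
      (use h(3) fermat_leg_nonzero[of m n] in \<open>simp_all add: k_def\<close>)
  then have mn: "(m, n) \<in> {(0, 0), (-1, 0), (0, -1), (-1, -1), (1, -1), (-1, 1)}"
    using fermat_flat_at[of m n] fermat_lines_cases[of m n] unfolding k_def by blast
  have invariant: "invariant_line l \<Omega>"
    if "\<And>v w. pair (vector [1, m, n]) v = 0 \<Longrightarrow> pair (vector [1, m, n]) w = 0 \<Longrightarrow> pair (fermat2 v) w = 0"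
    unfolding invariant_line_def
  proof safe
    fix v w assume vw: "pair l v = 0" "pair l w = 0"
    obtain v' w' where v': "v = h *v v'" "w = h *v w'" using invertible_surj[OF h(1)] by metis
    have "pair (vector [1, m, n]) v' = 0" "pair (vector [1, m, n]) w' = 0"
      using vw \<kappa> unfolding v' pullback_line_pair[symmetric] l' pair_comb by simp_all
    then have "pair (fermat2 v') w' = 0" by (rule that)
    then show "pair (\<Omega> v) w = 0"
      unfolding v' pullback_pair[symmetric] h(2) pair_comb by simp
  qed
  have joins: "joins_two_nonradial l \<Omega>"
    if "fermat_node_chart s fs" "fermat_node_chart t ft" "crs s t \<noteq> 0" "pair (vector [1, m, n]) s = 0" "pair (vector [1, m, n]) t = 0"
    for s t fs ft
    unfolding joins_two_nonradial_def
  proof (intro exI conjI)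
    show "singular \<Omega> (h *v s)" "\<not> radial_singularity \<Omega> (h *v s)"
      using fermat_node_nonradial[OF h(1-3) that(1)] by blast+
    show "singular \<Omega> (h *v t)" "\<not> radial_singularity \<Omega> (h *v t)"
      using fermat_node_nonradial[OF h(1-3) that(2)] by blast+
    show "\<nexists>c. h *v t = c *s (h *v s)"
    proof
      assume "\<exists>c. h *v t = c *s (h *v s)"
      then obtain c where "h *v t = h *v (c *s s)" by (auto simp: vector_scalar_commute)
      then have "h *v (t - c *s s) = 0" by (simp add: matrix_vector_mult_diff_distrib)
      then have "t = c *s s" using invertible_mult_eq_0[OF h(1)] by fastforce
      then show False using that(3) by (simp add: vec3_eq_iff)
    qed
    show "pair l (h *v s) = 0" "pair l (h *v t) = 0"
      using that(4,5) unfolding pullback_line_pair[symmetric] l' pair_comb by simp_all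
  qed
  consider (inv) "(m, n) \<in> {(0, 0), (-1, 0), (0, -1)}" | (a) "m = - 1" "n = - 1" | (b) "m = 1" "n = - 1" | (c) "m = - 1" "n = 1"
    using mn by auto
  then show ?thesis
  proof cases
    case inv
    have "invariant_line l \<Omega>"
    proof (rule invariant)
      fix v w :: "complex^3"
      assume "pair (vector [1, m, n]) v = 0" "pair (vector [1, m, n]) w = 0"
      then have "v$1 + m * v$2 + n * v$3 = 0" "w$1 + m * w$2 + n * w$3 = 0"
        by (simp_all add: pair_eq vector_3)
      with inv show "pair (fermat2 v) w = 0"
        by (auto simp: pair_eq fermat2_def Let_def vector_3 algebra_simps)
    qed
    then show ?thesis ..
  next
    case a
    then show ?thesis
      using joins[OF fermat_node_charts(1) fermat_node_charts(2)] by (simp add: vec3_eq_iff pair_eq vector_3)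
  next
    case b
    then show ?thesis
      using joins[OF fermat_node_charts(2) fermat_node_charts(3)] by (simp add: vec3_eq_iff pair_eq vector_3)
  next
    case c
    then show ?thesis
      using joins[OF fermat_node_charts(1) fermat_node_charts(3)] by (simp add: vec3_eq_iff pair_eq vector_3)
  qed
qed

theorem theoremH:
  fixes l :: "complex^3" and \<Omega> :: form3
  assumes "prefoliation 3 l \<Omega>"
    and "\<And>s. singular \<Omega> s \<Longrightarrow> nondegenerate_singularity \<Omega> s"
    and "flat_legendre l \<Omega>"
  shows "linearly_conjugate \<Omega> fermat2 \<and> (invariant_line l \<Omega> \<or> joins_two_nonradial l \<Omega>)"
proof -
  have l: "l \<noteq> 0" and "foliation 2 \<Omega>"
    using assms(1) by (simp_all add: prefoliation_def)
  then obtain k where k: "\<Omega> = field_form k" using foliation2_field_form by blast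
  have nd: "nondegenerate_form \<Omega>" using assms(2) by (rule nondegenerate_formI)
  obtain g c where g: "invertible g" "c \<noteq> 0" "pullback g \<Omega> = (\<lambda>v. c *s fermat2 v)"
    using flat_conjugate_fermat[of k l] nd l assms(3) unfolding k by blast
  then have "linearly_conjugate \<Omega> fermat2"
    unfolding linearly_conjugate_def by (intro exI[of _ g] exI[of _ c]) simp
  moreover have "invariant_line l \<Omega> \<or> joins_two_nonradial l \<Omega>"
    by (rule fermat_line_position[OF g(1,3,2) l assms(3)])
  ultimately show ?thesis ..
qed

end
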